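(* Let $L$ be a field, let $\{\Gamma_i\}_{i\in\mathbb{N}}$ be a family of finite simplicial graphs, and let $\{A(\Gamma_i)\}_{i\in\mathbb{N}}$ denote the corresponding family of right-angled Artin groups. Then $\{\Gamma_i\}_{i\in\mathbb{N}}$ is a graph expander family if and only if $\{(H^1(A(\Gamma_i),L),H^2(A(\Gamma_i),L),\smile)\}_{i\in\mathbb{N}}$ is a vector space expander family.
   Context: A simplicial graph is an undirected graph with no multiple edges and no loops. The right-angled Artin group on a finite simplicial graph $\Gamma$ is $A(\Gamma)=\langle \mathrm{Vert}(\Gamma)\mid [v,w]=1 \text{ for every } \{v,w\}\in\mathrm{Edge}(\Gamma)\rangle$. $H^i(A(\Gamma),L)$ is group cohomology with trivial coefficients in the field $L$, and $\smile$ is the cup product $H^1(A(\Gamma),L)\times H^1(A(\Gamma),L)\to H^2(A(\Gamma),L)$. Graph Cheeger constant: for nonempty $A\subset\mathrm{Vert}(\Gamma)$, let $\partial A$ be the set of vertices not in $A$ that are adjacent to some vertex of $A$, and $h_A=|\partial A|/|A|$. Then $h_\Gamma=\min_A h_A$, the minimum over nonempty $A\subset \mathrm{Vert}(\Gamma)$ with $|A|\le |\mathrm{Vert}(\Gamma)|/2$. Graph expander family: a sequence $\{\Gamma_i\}_{i\in\mathbb{N}}$ of finite graphs such that $|\mathrm{Vert}(\Gamma_i)|\to\infty$, the valence of each vertex of $\Gamma_i$ is bounded independently of $i$, and $\inf_i h_{\Gamma_i}>0$. (Connectedness is not assumed; it is a consequence of $h_{\Gamma_i}>0$.) Let $V$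 be a finite dimensional $L$-vector space, $W$ an $L$-vector space, $q\colon V\times V\to W$ a symmetric or anti-symmetric bilinear pairing. Cheeger constant of a triple $(V,W,q)$: for a subspace $F\subset V$ with $0<\dim F\le(\dim V)/2$, let $C=\{v\in V\mid q(f,v)=0 \text{ for all } f\in F\}$ and $$h_F=\frac{\dim V-\dim F-\dim C+\dim(C\cap F)}{\dim F}.$$ Then $h_V=\inf_F h_F$ over all subspaces $F$ with $0<\dim F\le(\dim V)/2$. A minimum or infimum over the empty set (which occurs for graphs with at most one vertex) is taken to be $+\infty$. $q$-valence: for $\emptyset\ne S\subset V$ and a basis $B$ of $V$, let $$d_B(S)=\max_{s\in S}|\{b\in B\mid q(s,b)\ne0\}|,\quad d(S)=\min_{B\text{ a basis of }V}d_B(S),\quad d(V)=\min_{S\text{ spans }V}d(S).$$ The number $d(V)$ is the $q$-valence of $V$. Vector space expander family: a family $\{(V_i,W_i,q_i)\}_{i\in\mathbb{N}}$ of such triples is a vector space expander family if (1) $\lim_{i\to\infty}\dim V_i=\infty$; (2) there exists $N$ such that $d(V_i)\le N$ for all $i$; (3) $\inf_i h_{V_i}>0$. *)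

theory Defs
  imports
    "HOL-Algebra.Module"
    "HOL-Algebra.AbelCoset"
    "HOL-Library.Extended_Real"
    "Graph_Theory.Pair_Digraph"
begin

section \<open>Graphs\<close>

text \<open>
  Finite simplicial graphs are the library's \<open>pair_graph\<close>: a finite vertex set with a
  symmetric, irreflexive set of arcs. An undirected edge \<open>{v, w}\<close> is represented by its two
  orientations \<open>(v, w)\<close> and \<open>(w, v)\<close>.
\<close>

definition graph_boundary :: "'v pair_pre_digraph \<Rightarrow> 'v set \<Rightarrow> 'v set" where
  "graph_boundary \<Gamma> A = {w \<in> pverts \<Gamma> - A. \<exists>v\<in>A. (v, w) \<in> parcs \<Gamma>}"

text \<open>The value is an extended real, so that the infimum over the empty set is \<open>\<infinity>\<close>.\<close>

definition graph_cheeger :: "'v pair_pre_digraph \<Rightarrow> ereal" where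
  "graph_cheeger \<Gamma> =
     (INF A \<in> {A. A \<noteq> {} \<and> A \<subseteq> pverts \<Gamma> \<and> real (card A) \<le> real (card (pverts \<Gamma>)) / 2}.
        ereal (real (card (graph_boundary \<Gamma> A)) / real (card A)))"

definition graph_valence :: "'v pair_pre_digraph \<Rightarrow> 'v \<Rightarrow> nat" where
  "graph_valence \<Gamma> v = card {w. (v, w) \<in> parcs \<Gamma>}"

definition graph_expander_family :: "(nat \<Rightarrow> 'v pair_pre_digraph) \<Rightarrow> bool" where
  "graph_expander_family \<Gamma> \<longleftrightarrow>
     (\<forall>i. pair_graph (\<Gamma> i)) \<and>
     filterlim (\<lambda>i. card (pverts (\<Gamma> i))) at_top sequentially \<and>
     (\<exists>N. \<forall>i. \<forall>v \<in> pverts (\<Gamma> i). graph_valence (\<Gamma> i) v \<le> N) \<and>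
     (INF i. graph_cheeger (\<Gamma> i)) > 0"

section \<open>Group presentations and right-angled Artin groups\<close>

text \<open>A letter \<open>(x, True)\<close> stands for the generator \<open>x\<close>, and \<open>(x, False)\<close> for its formal inverse.\<close>

type_synonym 'x word = "('x \<times> bool) list"

definition words :: "'x set \<Rightarrow> 'x word set" where
  "words X = lists (X \<times> UNIV)"

text \<open>
  The congruence on words over \<open>X\<close> whose quotient is the group with generators \<open>X\<close> and
  relators \<open>R\<close> (for \<open>R \<subseteq> words X\<close>).
\<close>

inductive_set pres_rel :: "'x set \<Rightarrow> 'x word set \<Rightarrow> ('x word \<times> 'x word) set"
  for X :: "'x set" and R :: "'x word set" where
  refl: "u \<in> words X \<Longrightarrow> (u, u) \<in> pres_rel X R"
| sym: "(u, v) \<in> pres_rel X R \<Longrightarrow> (v, u) \<in> pres_rel X R"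
| trans: "(u, v) \<in> pres_rel X R \<Longrightarrow> (v, w) \<in> pres_rel X R \<Longrightarrow> (u, w) \<in> pres_rel X R"
| cancel: "u \<in> words X \<Longrightarrow> w \<in> words X \<Longrightarrow> x \<in> X \<Longrightarrow>
    (u @ [(x, b), (x, \<not> b)] @ w, u @ w) \<in> pres_rel X R"
| relator: "u \<in> words X \<Longrightarrow> w \<in> words X \<Longrightarrow> r \<in> R \<Longrightarrow> (u @ r @ w, u @ w) \<in> pres_rel X R"

definition presented_group :: "'x set \<Rightarrow> 'x word set \<Rightarrow> 'x word set monoid" where
  "presented_group X R =
     \<lparr>carrier = words X // pres_rel X R,
      monoid.mult = (\<lambda>a b. \<Union>u\<in>a. \<Union>v\<in>b. pres_rel X R `` {u @ v}),
      one = pres_rel X R `` {[]}\<rparr>"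

definition raag :: "'v pair_pre_digraph \<Rightarrow> 'v word set monoid" where
  "raag \<Gamma> = presented_group (pverts \<Gamma>)
     {[(v, True), (w, True), (v, False), (w, False)] |v w. (v, w) \<in> parcs \<Gamma>}"

section \<open>Group cohomology with trivial coefficients in a field\<close>

text \<open>
  Cohomology is computed from the inhomogeneous (bar) cochain complex: an \<open>n\<close>-cochain is a
  function from \<open>n\<close>-tuples of elements of \<open>G\<close> to \<open>L\<close>. Vector spaces are \<^typ>\<open>('l, 'a) module\<close>
  records, whose ring multiplication and unit play no role and are left unspecified.
\<close>

definition tuples :: "('g, 'n) monoid_scheme \<Rightarrow> nat \<Rightarrow> 'g list set" where
  "tuples G n = {xs. length xs = n \<and> set xs \<subseteq> carrier G}"

definition cochains ::
  "('l, 'm) ring_scheme \<Rightarrow> ('g, 'n) monoid_scheme \<Rightarrow> nat \<Rightarrow> ('l, 'g list \<Rightarrow> 'l) module" where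
  "cochains L G n =
     \<lparr>carrier = tuples G n \<rightarrow>\<^sub>E carrier L,
      monoid.mult = undefined,
      one = undefined,
      zero = (\<lambda>xs\<in>tuples G n. \<zero>\<^bsub>L\<^esub>),
      add = (\<lambda>f g. \<lambda>xs\<in>tuples G n. f xs \<oplus>\<^bsub>L\<^esub> g xs),
      smult = (\<lambda>a f. \<lambda>xs\<in>tuples G n. a \<otimes>\<^bsub>L\<^esub> f xs)\<rparr>"

text \<open>
  \<open>(d f)(g\<^sub>1, \<dots>, g\<^sub>n\<^sub>+\<^sub>1) = f(g\<^sub>2, \<dots>, g\<^sub>n\<^sub>+\<^sub>1) +
    \<Sum>i=1..n. (-1)^i f(g\<^sub>1, \<dots>, g\<^sub>i g\<^sub>i\<^sub>+\<^sub>1, \<dots>, g\<^sub>n\<^sub>+\<^sub>1) + (-1)^(n+1) f(g\<^sub>1, \<dots>, g\<^sub>n)\<close>;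
  in the code \<open>g\<^sub>i\<close> is \<open>xs ! (i - 1)\<close>.
\<close>

definition coboundary_map ::
  "('l, 'm) ring_scheme \<Rightarrow> ('g, 'n) monoid_scheme \<Rightarrow> nat \<Rightarrow> ('g list \<Rightarrow> 'l) \<Rightarrow> 'g list \<Rightarrow> 'l" where
  "coboundary_map L G n f = (\<lambda>xs\<in>tuples G (Suc n).
     f (tl xs)
     \<oplus>\<^bsub>L\<^esub> (\<Oplus>\<^bsub>L\<^esub>i\<in>{1..n}. ((\<ominus>\<^bsub>L\<^esub> \<one>\<^bsub>L\<^esub>) [^]\<^bsub>L\<^esub> i) \<otimes>\<^bsub>L\<^esub>
            f (take (i - 1) xs @ [xs ! (i - 1) \<otimes>\<^bsub>G\<^esub> xs ! i] @ drop (i + 1) xs))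
     \<oplus>\<^bsub>L\<^esub> ((\<ominus>\<^bsub>L\<^esub> \<one>\<^bsub>L\<^esub>) [^]\<^bsub>L\<^esub> Suc n) \<otimes>\<^bsub>L\<^esub> f (butlast xs))"

definition cocycles ::
  "('l, 'm) ring_scheme \<Rightarrow> ('g, 'n) monoid_scheme \<Rightarrow> nat \<Rightarrow> ('g list \<Rightarrow> 'l) set" where
  "cocycles L G n =
     {f \<in> carrier (cochains L G n). coboundary_map L G n f = \<zero>\<^bsub>cochains L G (Suc n)\<^esub>}"

definition coboundaries ::
  "('l, 'm) ring_scheme \<Rightarrow> ('g, 'n) monoid_scheme \<Rightarrow> nat \<Rightarrow> ('g list \<Rightarrow> 'l) set" where
  "coboundaries L G n =
     (case n of 0 \<Rightarrow> {\<zero>\<^bsub>cochains L G 0\<^esub>}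
      | Suc m \<Rightarrow> coboundary_map L G m ` carrier (cochains L G m))"

definition quotient_module :: "('l, 'a, 'm) module_scheme \<Rightarrow> 'a set \<Rightarrow> ('l, 'a set) module" where
  "quotient_module M N =
     \<lparr>carrier = a_rcosets\<^bsub>M\<^esub> N,
      monoid.mult = undefined,
      one = undefined,
      zero = N,
      add = (\<lambda>X Y. X <+>\<^bsub>M\<^esub> Y),
      smult = (\<lambda>a X. \<Union>x\<in>X. N +>\<^bsub>M\<^esub> (a \<odot>\<^bsub>M\<^esub> x))\<rparr>"

definition cohomology ::
  "('l, 'm) ring_scheme \<Rightarrow> ('g, 'n) monoid_scheme \<Rightarrow> nat \<Rightarrow> ('l, ('g list \<Rightarrow> 'l) set) module" where
  "cohomology L G n =
     quotient_module ((cochains L G n)\<lparr>carrier := cocycles L G n\<rparr>) (coboundaries L G n)"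

definition cup_cochain ::
  "('l, 'm) ring_scheme \<Rightarrow> ('g, 'n) monoid_scheme \<Rightarrow> nat \<Rightarrow> nat \<Rightarrow>
   ('g list \<Rightarrow> 'l) \<Rightarrow> ('g list \<Rightarrow> 'l) \<Rightarrow> 'g list \<Rightarrow> 'l" where
  "cup_cochain L G p q f g =
     (\<lambda>xs\<in>tuples G (p + q). f (take p xs) \<otimes>\<^bsub>L\<^esub> g (drop p xs))"

definition cup_product ::
  "('l, 'm) ring_scheme \<Rightarrow> ('g, 'n) monoid_scheme \<Rightarrow> nat \<Rightarrow> nat \<Rightarrow>
   ('g list \<Rightarrow> 'l) set \<Rightarrow> ('g list \<Rightarrow> 'l) set \<Rightarrow> ('g list \<Rightarrow> 'l) set" where
  "cup_product L G p q X Y =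
     (\<Union>f\<in>X. \<Union>g\<in>Y. coboundaries L G (p + q) +>\<^bsub>cochains L G (p + q)\<^esub> cup_cochain L G p q f g)"

section \<open>Linear algebra\<close>

definition lin_span :: "('l, 'm) ring_scheme \<Rightarrow> ('l, 'a, 'n) module_scheme \<Rightarrow> 'a set \<Rightarrow> 'a set" where
  "lin_span L V S =
     {\<Oplus>\<^bsub>V\<^esub>b\<in>A. c b \<odot>\<^bsub>V\<^esub> b |A c. finite A \<and> A \<subseteq> S \<and> c \<in> A \<rightarrow> carrier L}"

definition lin_indep :: "('l, 'm) ring_scheme \<Rightarrow> ('l, 'a, 'n) module_scheme \<Rightarrow> 'a set \<Rightarrow> bool" where
  "lin_indep L V S \<longleftrightarrow>
     (\<forall>A c. finite A \<and> A \<subseteq> S \<and> c \<in> A \<rightarrow> carrier L \<and> (\<Oplus>\<^bsub>V\<^esub>b\<in>A. c b \<odot>\<^bsub>V\<^esub> b) = \<zero>\<^bsub>V\<^esub>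
        \<longrightarrow> (\<forall>b\<in>A. c b = \<zero>\<^bsub>L\<^esub>))"

definition is_basis ::
  "('l, 'm) ring_scheme \<Rightarrow> ('l, 'a, 'n) module_scheme \<Rightarrow> 'a set \<Rightarrow> 'a set \<Rightarrow> bool" where
  "is_basis L V F B \<longleftrightarrow> B \<subseteq> F \<and> lin_indep L V B \<and> lin_span L V B = F"

text \<open>Dimension of a subspace \<open>F\<close> of \<open>V\<close>; meaningful when \<open>F\<close> is finite dimensional.\<close>

definition lin_dim :: "('l, 'm) ring_scheme \<Rightarrow> ('l, 'a, 'n) module_scheme \<Rightarrow> 'a set \<Rightarrow> nat" where
  "lin_dim L V F = card (SOME B. is_basis L V F B)"

definition finite_dim :: "('l, 'm) ring_scheme \<Rightarrow> ('l, 'a, 'n) module_scheme \<Rightarrow> bool" where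
  "finite_dim L V \<longleftrightarrow> (\<exists>B. finite B \<and> is_basis L V (carrier V) B)"

definition bilinear_pairing ::
  "('l, 'm) ring_scheme \<Rightarrow> ('l, 'a, 'n) module_scheme \<Rightarrow> ('l, 'b, 'k) module_scheme \<Rightarrow>
   ('a \<Rightarrow> 'a \<Rightarrow> 'b) \<Rightarrow> bool" where
  "bilinear_pairing L V W q \<longleftrightarrow>
     (\<forall>x\<in>carrier V. \<forall>y\<in>carrier V. q x y \<in> carrier W) \<and>
     (\<forall>x\<in>carrier V. \<forall>y\<in>carrier V. \<forall>z\<in>carrier V.
        q (x \<oplus>\<^bsub>V\<^esub> y) z = q x z \<oplus>\<^bsub>W\<^esub> q y z \<and> q z (x \<oplus>\<^bsub>V\<^esub> y) = q z x \<oplus>\<^bsub>W\<^esub> q z y) \<and>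
     (\<forall>a\<in>carrier L. \<forall>x\<in>carrier V. \<forall>y\<in>carrier V.
        q (a \<odot>\<^bsub>V\<^esub> x) y = a \<odot>\<^bsub>W\<^esub> q x y \<and> q x (a \<odot>\<^bsub>V\<^esub> y) = a \<odot>\<^bsub>W\<^esub> q x y)"

definition pairing_triple ::
  "('l, 'm) ring_scheme \<Rightarrow> ('l, 'a, 'n) module_scheme \<Rightarrow> ('l, 'b, 'k) module_scheme \<Rightarrow>
   ('a \<Rightarrow> 'a \<Rightarrow> 'b) \<Rightarrow> bool" where
  "pairing_triple L V W q \<longleftrightarrow>
     Module.module L V \<and> finite_dim L V \<and> Module.module L W \<and> bilinear_pairing L V W q \<and>
     ((\<forall>x\<in>carrier V. \<forall>y\<in>carrier V. q x y = q y x) \<or>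
      (\<forall>x\<in>carrier V. \<forall>y\<in>carrier V. q x y = \<ominus>\<^bsub>W\<^esub> q y x))"

section \<open>Vector space expanders\<close>

definition annihilator ::
  "('l, 'a, 'n) module_scheme \<Rightarrow> ('l, 'b, 'k) module_scheme \<Rightarrow> ('a \<Rightarrow> 'a \<Rightarrow> 'b) \<Rightarrow> 'a set \<Rightarrow> 'a set"
  where
  "annihilator V W q F = {v \<in> carrier V. \<forall>f\<in>F. q f v = \<zero>\<^bsub>W\<^esub>}"

definition subspace_cheeger ::
  "('l, 'm) ring_scheme \<Rightarrow> ('l, 'a, 'n) module_scheme \<Rightarrow> ('l, 'b, 'k) module_scheme \<Rightarrow>
   ('a \<Rightarrow> 'a \<Rightarrow> 'b) \<Rightarrow> 'a set \<Rightarrow> real" where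
  "subspace_cheeger L V W q F =
     (let C = annihilator V W q F in
      (real (lin_dim L V (carrier V)) - real (lin_dim L V F) - real (lin_dim L V C)
         + real (lin_dim L V (C \<inter> F))) / real (lin_dim L V F))"

definition vs_cheeger ::
  "('l, 'm) ring_scheme \<Rightarrow> ('l, 'a, 'n) module_scheme \<Rightarrow> ('l, 'b, 'k) module_scheme \<Rightarrow>
   ('a \<Rightarrow> 'a \<Rightarrow> 'b) \<Rightarrow> ereal" where
  "vs_cheeger L V W q =
     (INF F \<in> {F. submodule F L V \<and> 0 < lin_dim L V F \<and>
                  real (lin_dim L V F) \<le> real (lin_dim L V (carrier V)) / 2}.
        ereal (subspace_cheeger L V W q F))"

definition valence_wrt ::
  "('l, 'b, 'k) module_scheme \<Rightarrow> ('a \<Rightarrow> 'a \<Rightarrow> 'b) \<Rightarrow> 'a set \<Rightarrow> 'a set \<Rightarrow> nat" where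
  "valence_wrt W q B S = Max ((\<lambda>s. card {b \<in> B. q s b \<noteq> \<zero>\<^bsub>W\<^esub>}) ` S)"

definition set_valence ::
  "('l, 'm) ring_scheme \<Rightarrow> ('l, 'a, 'n) module_scheme \<Rightarrow> ('l, 'b, 'k) module_scheme \<Rightarrow>
   ('a \<Rightarrow> 'a \<Rightarrow> 'b) \<Rightarrow> 'a set \<Rightarrow> nat" where
  "set_valence L V W q S = (INF B \<in> {B. is_basis L V (carrier V) B}. valence_wrt W q B S)"

definition q_valence ::
  "('l, 'm) ring_scheme \<Rightarrow> ('l, 'a, 'n) module_scheme \<Rightarrow> ('l, 'b, 'k) module_scheme \<Rightarrow>
   ('a \<Rightarrow> 'a \<Rightarrow> 'b) \<Rightarrow> nat" where
  "q_valence L V W q =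
     (INF S \<in> {S. S \<noteq> {} \<and> S \<subseteq> carrier V \<and> lin_span L V S = carrier V}. set_valence L V W q S)"

definition vs_expander_family ::
  "('l, 'm) ring_scheme \<Rightarrow> (nat \<Rightarrow> ('l, 'a, 'n) module_scheme) \<Rightarrow>
   (nat \<Rightarrow> ('l, 'b, 'k) module_scheme) \<Rightarrow> (nat \<Rightarrow> 'a \<Rightarrow> 'a \<Rightarrow> 'b) \<Rightarrow> bool" where
  "vs_expander_family L V W q \<longleftrightarrow>
     (\<forall>i. pairing_triple L (V i) (W i) (q i)) \<and>
     filterlim (\<lambda>i. lin_dim L (V i) (carrier (V i))) at_top sequentially \<and>
     (\<exists>N. \<forall>i. q_valence L (V i) (W i) (q i) \<le> N) \<and>
     (INF i. vs_cheeger L (V i) (W i) (q i)) > 0"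

end

theory Submission
  imports Defs "Jordan_Normal_Form.Missing_VectorSpace"
begin

text \<open>
  The first cohomology of \<open>A(\<Gamma>)\<close> consists of the homomorphisms from \<open>A(\<Gamma>)\<close> to \<open>L\<close>, that is, of
  arbitrary functions on the vertices. About the cup product one has to know only when it vanishes:
  \<open>f \<smile> g = 0\<close> if and only if \<open>f(v) g(w) = f(w) g(v)\<close> for every edge \<open>{v, w}\<close>
  (\<open>cup_product_raag_zero_iff\<close>). A coboundary is symmetric on commuting pairs of group elements, which
  gives one direction. Conversely, a cochain with coboundary \<open>f \<smile> g\<close> amounts to a homomorphism
  from \<open>A(\<Gamma>)\<close> to the Heisenberg group over \<open>L\<close> that lifts \<open>(f, g)\<close>, a homomorphism to \<open>L \<times> L\<close>. Generators
  can be lifted at will, and the equations on the edges say that the lifts of adjacent generators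
  commute.

  What remains is linear algebra on functions on a finite graph (locale \<open>graph_pairing\<close>), where each of
  the three conditions can be compared with its counterpart. The dimension is the number of vertices,
  and the \<open>q\<close>-valence is the largest valence of a vertex: the dual basis shows one inequality, and for a
  vector \<open>s\<close> with \<open>s(v) \<noteq> 0\<close> the kernel of \<open>q s\<close> has codimension at least the valence of \<open>v\<close>, so that
  every basis has that many elements outside this kernel.

  For the Cheeger constants, the functions supported on a set \<open>A\<close> of vertices form a subspace \<open>F\<close> with
  \<open>h\<^sub>F = h\<^sub>A\<close>, so the constant of the pairing is at most that of the graph. In the other direction it is
  at least half of the minimum of 1 and the constant of the graph (\<open>subspace_cheeger_ge\<close>). The reason is
  that a subspace \<open>F\<close> and its annihilator \<open>C\<close> satisfy \<open>f(u) x(w) = f(w) x(u)\<close> along every edge. Hence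
  the vertices on which \<open>F + C\<close> does not vanish fall into the part seen only by \<open>F\<close>, the part seen only by
  \<open>C\<close>, and classes of vertices on which all functions in \<open>F\<close> and in \<open>C\<close> are multiples of one function.
  No edge joins different classes. Their boundaries therefore lie in the common zero set of \<open>F + C\<close>,
  and the expansion of the graph makes this zero set, and with it the codimension of \<open>F + C\<close>, large.
\<close>

section \<open>Dimensions of subspaces\<close>

context Module.module
begin

text \<open>
  The left-hand notion is the one in which Cheeger constants are phrased, the right-hand one belongs to
  the theory of spans and bases.
\<close>

lemma submodule_iff: "Module.submodule F R M \<longleftrightarrow> LinearCombinations.submodule R F M"
proof
  assume "Module.submodule F R M"
  then interpret Module.submodule F R M .
  show "LinearCombinations.submodule R F M"
    using subset m_closed one_closed smult_closed module_axioms
    by (auto simp: LinearCombinations.submodule_def)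
next
  assume "LinearCombinations.submodule R F M"
  then interpret LinearCombinations.submodule R F M .
  have neg: "\<ominus>\<^bsub>M\<^esub> x \<in> F" if "x \<in> F" for x
  proof -
    have "(\<ominus>\<^bsub>R\<^esub> \<one>\<^bsub>R\<^esub>) \<odot>\<^bsub>M\<^esub> x \<in> F"
      using that by (intro smult_closed) auto
    then show ?thesis using that subset
      by (metis smult_minus_1 subsetD)
  qed
  show "Module.submodule F R M"
  proof (rule Module.submodule.intro)
    show "subgroup F (add_monoid M)"
      by (rule subgroup.intro) (use subset neg in \<open>auto simp flip: a_inv_def\<close>)
    show "submodule_axioms F R M"
      by (rule submodule_axioms.intro) (rule smult_closed)
  qed
qed

lemma submoduleD:
  assumes "Module.submodule F R M"
  shows "F \<subseteq> carrier M" "\<zero>\<^bsub>M\<^esub> \<in> F"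
    and "x \<in> F \<Longrightarrow> y \<in> F \<Longrightarrow> x \<oplus>\<^bsub>M\<^esub> y \<in> F"
    and "a \<in> carrier R \<Longrightarrow> x \<in> F \<Longrightarrow> a \<odot>\<^bsub>M\<^esub> x \<in> F"
  using assms unfolding submodule_iff LinearCombinations.submodule_def by auto

lemma submoduleI:
  assumes "F \<subseteq> carrier M" "\<zero>\<^bsub>M\<^esub> \<in> F"
    and "\<And>x y. x \<in> F \<Longrightarrow> y \<in> F \<Longrightarrow> x \<oplus>\<^bsub>M\<^esub> y \<in> F"
    and "\<And>a x. a \<in> carrier R \<Longrightarrow> x \<in> F \<Longrightarrow> a \<odot>\<^bsub>M\<^esub> x \<in> F"
  shows "Module.submodule F R M"
  using assms module_axioms unfolding submodule_iff LinearCombinations.submodule_def by auto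

end

context vectorspace
begin

text \<open>
  Through these translations the exchange lemma of the locale \<open>vectorspace\<close> becomes applicable.
\<close>

lemma lin_span_eq_span: "lin_span K V S = span S"
  unfolding lin_span_def span_def lincomb_def by blast

lemma lin_indep_iff: "lin_indep K V S \<longleftrightarrow> lin_indpt S"
  unfolding lin_indep_def lin_dep_def lincomb_def by blast

lemma is_basis_iff: "is_basis K V F B \<longleftrightarrow> B \<subseteq> F \<and> lin_indpt B \<and> span B = F"
  unfolding is_basis_def lin_span_eq_span lin_indep_iff ..

lemma submodule_carrier: "Module.submodule (carrier V) K V"
  by (rule submoduleI) auto

lemma submodule_Int:
  assumes "Module.submodule F K V" "Module.submodule C K V"
  shows "Module.submodule (F \<inter> C) K V"
  using submoduleD[OF assms(1)] submoduleD[OF assms(2)] by (intro submoduleI) auto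

text \<open>
  Finiteness of \<open>A\<close> is part of the conclusion: a finite subset with more elements than \<open>B\<close> would
  already contradict the exchange lemma.
\<close>

lemma lin_indpt_card_le_spanning:
  assumes "finite B" "B \<subseteq> carrier V" "lin_indpt A" "A \<subseteq> span B"
  shows "finite A \<and> card A \<le> card B"
proof -
  have le: "card A' \<le> card B" if "A' \<subseteq> A" "finite A'" for A'
  proof -
    have "lin_indpt A'" using that assms(3) subset_li_is_li by blast
    then show ?thesis
      using replacement[of A' B] assms that by fastforce
  qed
  moreover have "finite A"
  proof (rule ccontr)
    assume "infinite A"
    then obtain A' where "finite A'" "card A' = Suc (card B)" "A' \<subseteq> A"
      using infinite_arbitrarily_large by blast
    then show False using le[of A'] by simp
  qed
  ultimately show ?thesis by blast
qed

text \<open>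
  The size of independent sets is bounded by that of a finite generating set of \<open>V\<close>, so there is a
  largest independent subset of \<open>F\<close> that contains \<open>I\<close>. It spans \<open>F\<close>, as any vector of \<open>F\<close> outside its span
  could be added.
\<close>

lemma extend_to_basis:
  assumes fd: "fin_dim" and F: "Module.submodule F K V" and I: "I \<subseteq> F" "lin_indpt I"
  obtains A where "finite (I \<union> A)" "I \<inter> A = {}" "is_basis K V F (I \<union> A)"
proof -
  obtain B where B: "finite B" "B \<subseteq> carrier V" "span B = carrier V"
    using fd unfolding fin_dim_def by blast
  have bound: "finite S \<and> card S \<le> card B" if "S \<subseteq> F" "lin_indpt S" for S
    using lin_indpt_card_le_spanning[OF B(1,2) that(2)] that(1) submoduleD(1)[OF F] B(3) by simp
  let ?P = "\<lambda>S. I \<subseteq> S \<and> S \<subseteq> F \<and> lin_indpt S"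
  have "\<exists>S. ?P S \<and> (\<forall>T. ?P T \<longrightarrow> card T \<le> card S)"
  proof (rule ex_has_greatest_nat[where b = "Suc (card B)" and k = I])
    show "?P I" using I by simp
    show "\<forall>S. ?P S \<longrightarrow> card S < Suc (card B)" using bound by (simp add: less_Suc_eq_le)
  qed
  then obtain S where S: "?P S" and S_max: "\<And>T. ?P T \<Longrightarrow> card T \<le> card S"
    by blast
  have S_carrier: "S \<subseteq> carrier V" using S submoduleD(1)[OF F] by blast
  have fin: "finite S" using bound S by blast
  have "span S = F"
  proof
    show "span S \<subseteq> F" by (rule span_is_subset) (use S F in \<open>simp_all add: submodule_iff\<close>)
    show "F \<subseteq> span S"
    proof (rule subsetI, rule ccontr)
      fix x assume x: "x \<in> F" "x \<notin> span S"
      then have "x \<notin> S" using in_own_span[OF S_carrier] by blast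
      moreover have "lin_indpt (insert x S)"
        using lin_dep_iff_in_span[OF S_carrier _ _ \<open>x \<notin> S\<close>] S x submoduleD(1)[OF F] by auto
      then have "card (insert x S) \<le> card S" using S x by (intro S_max) auto
      ultimately show False using fin by simp
    qed
  qed
  then have "is_basis K V F (I \<union> (S - I))" "finite (I \<union> (S - I))"
    using S fin unfolding is_basis_iff by (auto simp: Un_absorb1)
  then show ?thesis using that[of "S - I"] by blast
qed

lemma obtain_basis:
  assumes "fin_dim" "Module.submodule F K V"
  obtains B where "finite B" "is_basis K V F B"
proof -
  have "lin_indpt {}" unfolding lin_dep_def by auto
  then show ?thesis using extend_to_basis[OF assms, of "{}"] that by auto
qed

lemma finite_basis:
  assumes "fin_dim" "Module.submodule F K V" "is_basis K V F B"
  shows "finite B"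
proof -
  obtain B' where B': "finite B'" "is_basis K V F B'" using obtain_basis[OF assms(1,2)] .
  then show ?thesis
    using lin_indpt_card_le_spanning[of B' B] assms(3) submoduleD(1)[OF assms(2)]
    unfolding is_basis_iff by blast
qed

text \<open>
  The dimension is defined through an arbitrarily chosen basis; it does not depend on the choice.
\<close>

lemma lin_dim_eq_card:
  assumes fd: "fin_dim" and F: "Module.submodule F K V" and B: "is_basis K V F B"
  shows "lin_dim K V F = card B"
proof -
  let ?B = "SOME B. is_basis K V F B"
  have some: "is_basis K V F ?B" using B by (rule someI)
  have "card ?B \<le> card B" "card B \<le> card ?B"
    using lin_indpt_card_le_spanning[of B ?B] lin_indpt_card_le_spanning[of ?B B] B some
      finite_basis[OF fd F B] finite_basis[OF fd F some] submoduleD(1)[OF F]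
    unfolding is_basis_iff by blast+
  then show ?thesis unfolding lin_dim_def by simp
qed

lemma lin_indpt_card_le_lin_dim:
  assumes fd: "fin_dim" and F: "Module.submodule F K V" and A: "A \<subseteq> F" "lin_indpt A"
  shows "finite A" "card A \<le> lin_dim K V F"
proof -
  obtain B where B: "finite B" "is_basis K V F B" using obtain_basis[OF fd F] .
  have "finite A \<and> card A \<le> card B"
    using lin_indpt_card_le_spanning[of B A] A B submoduleD(1)[OF F] unfolding is_basis_iff by blast
  then show "finite A" "card A \<le> lin_dim K V F" using lin_dim_eq_card[OF fd F B(2)] by auto
qed

lemma lin_dim_mono:
  assumes "fin_dim" "Module.submodule F K V" "Module.submodule U K V" "F \<subseteq> U"
  shows "lin_dim K V F \<le> lin_dim K V U"
proof -
  obtain B where B: "finite B" "is_basis K V F B" using obtain_basis[OF assms(1,2)] .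
  then show ?thesis
    using lin_indpt_card_le_lin_dim(2)[OF assms(1,3), of B] lin_dim_eq_card[OF assms(1,2)] assms(4)
    unfolding is_basis_iff by auto
qed

text \<open>
  Two expressions of \<open>x\<close>, by \<open>I\<close> and by \<open>A\<close>, differ by a linear relation on \<open>I \<union> A\<close>.
\<close>

lemma spans_meet_trivially:
  assumes "I \<subseteq> carrier V" "A \<subseteq> carrier V" "I \<inter> A = {}" "lin_indpt (I \<union> A)"
    and x: "x \<in> span I" "x \<in> span A"
  shows "x = \<zero>\<^bsub>V\<^esub>"
proof -
  obtain a I' where a: "finite I'" "I' \<subseteq> I" "a \<in> I' \<rightarrow> carrier K" "x = lincomb a I'"
    using x(1) unfolding span_def by blast
  obtain b A' where b: "finite A'" "A' \<subseteq> A" "b \<in> A' \<rightarrow> carrier K" "x = lincomb b A'"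
    using x(2) unfolding span_def by blast
  have sub: "I' \<subseteq> carrier V" "A' \<subseteq> carrier V" and disj: "I' \<inter> A' = {}"
    using a b assms by auto
  have xV: "x \<in> carrier V" using a sub by auto
  let ?c = "\<lambda>v. if v \<in> I' then a v else (\<ominus>\<^bsub>K\<^esub> \<one>\<^bsub>K\<^esub>) \<otimes>\<^bsub>K\<^esub> b v"
  have c: "?c \<in> I' \<union> A' \<rightarrow> carrier K"
    using a(3) b(3) by (auto simp: Pi_iff intro!: R.m_closed)
  have "lincomb ?c (I' \<union> A') = lincomb ?c I' \<oplus>\<^bsub>V\<^esub> lincomb ?c A'"
    by (rule lincomb_union[OF sub disj a(1) b(1) c])
  also have "lincomb ?c I' = x" unfolding a(4)
    using a(3) sub by (intro lincomb_cong) auto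
  also have "lincomb ?c A' = lincomb (\<lambda>v. (\<ominus>\<^bsub>K\<^esub> \<one>\<^bsub>K\<^esub>) \<otimes>\<^bsub>K\<^esub> b v) A'"
    using b(3) sub disj by (intro lincomb_cong) auto
  also have "\<dots> = (\<ominus>\<^bsub>K\<^esub> \<one>\<^bsub>K\<^esub>) \<odot>\<^bsub>V\<^esub> x"
    unfolding b(4) by (rule lincomb_distrib[symmetric]) (use b sub in auto)
  also have "x \<oplus>\<^bsub>V\<^esub> (\<ominus>\<^bsub>K\<^esub> \<one>\<^bsub>K\<^esub>) \<odot>\<^bsub>V\<^esub> x = \<zero>\<^bsub>V\<^esub>"
    using xV by (simp add: smult_minus_1 M.r_neg)
  finally have "?c \<in> I' \<union> A' \<rightarrow> {\<zero>\<^bsub>K\<^esub>}"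
    using not_lindepD[OF assms(4) _ _ c] a(1,2) b(1,2) by blast
  then have "a \<in> I' \<rightarrow> {\<zero>\<^bsub>K\<^esub>}" by (auto simp: Pi_iff split: if_splits)
  then show ?thesis using a(4) lincomb_zero[OF sub(1)] by simp
qed

lemma lin_indpt_Un:
  assumes "X \<subseteq> carrier V" "A \<subseteq> carrier V" "lin_indpt X" "lin_indpt A"
    and meet: "\<And>x. x \<in> span X \<Longrightarrow> x \<in> span A \<Longrightarrow> x = \<zero>\<^bsub>V\<^esub>"
  shows "X \<inter> A = {}" "lin_indpt (X \<union> A)"
proof -
  show disj: "X \<inter> A = {}"
  proof (rule ccontr)
    assume "X \<inter> A \<noteq> {}"
    then obtain x where x: "x \<in> X" "x \<in> A" by blast
    have "x \<in> span X" "x \<in> span A"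
      by (rule subsetD[OF in_own_span[OF assms(1)] x(1)], rule subsetD[OF in_own_span[OF assms(2)] x(2)])
    then have "x = \<zero>\<^bsub>V\<^esub>" by (rule meet)
    then show False using x vs_zero_lin_dep[OF assms(1,3)] by simp
  qed
  show "lin_indpt (X \<union> A)"
  proof
    assume "lin_dep (X \<union> A)"
    then obtain S c v where S: "finite S" "S \<subseteq> X \<union> A" "c \<in> S \<rightarrow> carrier K"
      "lincomb c S = \<zero>\<^bsub>V\<^esub>" "v \<in> S" "c v \<noteq> \<zero>\<^bsub>K\<^esub>"
      unfolding lin_dep_def by blast
    let ?y = "lincomb c (S \<inter> X)" and ?z = "lincomb c (S \<inter> A)"
    have mem: "?y \<in> span X" "?z \<in> span A"
      unfolding span_def using S by blast+
    have V: "?y \<in> carrier V" "?z \<in> carrier V"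
      using span_is_subset2 mem assms by blast+
    have "S = (S \<inter> X) \<union> (S \<inter> A)" using S by blast
    moreover have "lincomb c ((S \<inter> X) \<union> (S \<inter> A)) = ?y \<oplus>\<^bsub>V\<^esub> ?z"
      by (rule lincomb_union) (use S(1,3) disj assms(1,2) in auto)
    ultimately have "lincomb c S = ?y \<oplus>\<^bsub>V\<^esub> ?z" by simp
    then have sum: "?y \<oplus>\<^bsub>V\<^esub> ?z = \<zero>\<^bsub>V\<^esub>" using S by simp
    have "?y = (\<ominus>\<^bsub>K\<^esub> \<one>\<^bsub>K\<^esub>) \<odot>\<^bsub>V\<^esub> ?z"
      using sum V M.minus_equality[OF sum] by (simp add: smult_minus_1)
    moreover have "(\<ominus>\<^bsub>K\<^esub> \<one>\<^bsub>K\<^esub>) \<odot>\<^bsub>V\<^esub> ?z \<in> span A"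
      using span_is_submodule[OF assms(2)] mem(2)
      unfolding LinearCombinations.submodule_def by auto
    ultimately have "?y = \<zero>\<^bsub>V\<^esub>" using meet mem by auto
    moreover from this have "?z = \<zero>\<^bsub>V\<^esub>" using sum V by auto
    ultimately have "c \<in> S \<inter> X \<rightarrow> {\<zero>\<^bsub>K\<^esub>}" "c \<in> S \<inter> A \<rightarrow> {\<zero>\<^bsub>K\<^esub>}"
      using not_lindepD[OF assms(3), of "S \<inter> X" c] not_lindepD[OF assms(4), of "S \<inter> A" c] S(1,3)
      by auto
    then show False using S(2,5,6) by (auto simp: Pi_iff)
  qed
qed

text \<open>
  Half of the dimension formula, with an arbitrary subspace \<open>U\<close> in place of \<open>F + C\<close>; the applications
  bound \<open>F + C\<close> by an explicit \<open>U\<close>. If a basis \<open>I\<close> of \<open>C \<inter> F\<close> is extended by \<open>A\<close> to a basis of \<open>F\<close>, then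
  \<open>span A\<close> meets \<open>C\<close> trivially, so \<open>A\<close> together with a basis of \<open>C\<close> is independent in \<open>U\<close>.
\<close>

lemma grassmann_le:
  assumes fd: "fin_dim"
    and F: "Module.submodule F K V" and C: "Module.submodule C K V" and U: "Module.submodule U K V"
    and sub: "F \<subseteq> U" "C \<subseteq> U"
  shows "lin_dim K V F + lin_dim K V C \<le> lin_dim K V (C \<inter> F) + lin_dim K V U"
proof -
  have CF: "Module.submodule (C \<inter> F) K V" using C F by (rule submodule_Int)
  note carr = submoduleD(1)[OF F] submoduleD(1)[OF C]
  obtain I where I: "finite I" "is_basis K V (C \<inter> F) I" using obtain_basis[OF fd CF] .
  have I': "I \<subseteq> F" "lin_indpt I" using I unfolding is_basis_iff by auto
  obtain A where A: "finite (I \<union> A)" "I \<inter> A = {}" "is_basis K V F (I \<union> A)"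
    using extend_to_basis[OF fd F I'] .
  obtain X where X: "finite X" "is_basis K V C X"
    using obtain_basis[OF fd C] .
  have A': "A \<subseteq> F" "lin_indpt (I \<union> A)" "lin_indpt A" "span A \<subseteq> F"
    using A subset_li_is_li span_is_monotone[of A "I \<union> A"] unfolding is_basis_iff by auto
  have X': "X \<subseteq> C" "lin_indpt X" "span X = C" using X unfolding is_basis_iff by auto
  have meet: "x = \<zero>\<^bsub>V\<^esub>" if "x \<in> span X" "x \<in> span A" for x
  proof (rule spans_meet_trivially[of I A])
    show "x \<in> span I" using that A' X' I unfolding is_basis_iff by auto
  qed (use A A' I' carr that in auto)
  have "X \<inter> A = {}" "lin_indpt (X \<union> A)"
    using lin_indpt_Un[of X A] meet X' A' carr by blast+
  moreover have "X \<union> A \<subseteq> U" using X' A' sub by blast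
  ultimately have "card X + card A \<le> lin_dim K V U"
    using lin_indpt_card_le_lin_dim(2)[OF fd U, of "X \<union> A"] X A by (simp add: card_Un_disjoint)
  moreover have "lin_dim K V F = card I + card A"
    using lin_dim_eq_card[OF fd F A(3)] A by (simp add: card_Un_disjoint)
  ultimately show ?thesis
    using lin_dim_eq_card[OF fd CF I(2)] lin_dim_eq_card[OF fd C X(2)] by simp
qed

end

section \<open>Pairings governed by a graph\<close>

text \<open>
  Let \<open>X\<close> be a largest union of classes with at most \<open>n / 2\<close> elements. A class outside \<open>X\<close> has at most
  \<open>|X|\<close> elements by the choice of \<open>X\<close>; if \<open>|X| < n / 4\<close>, it could therefore be added to \<open>X\<close>.
\<close>

lemma saturated_set_of_medium_size:
  fixes n :: real
  assumes fin: "finite Y" and r: "equiv Y r" and small: "\<And>u. u \<in> Y \<Longrightarrow> card (r `` {u}) \<le> n / 2"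
    and n: "0 \<le> n"
  obtains X where "X \<subseteq> Y" "r `` X \<subseteq> X" "card X \<le> n / 2" "X = Y \<or> n / 4 \<le> card X"
proof -
  let ?P = "\<lambda>X. X \<subseteq> Y \<and> r `` X \<subseteq> X \<and> card X \<le> n / 2"
  have "\<exists>X. ?P X \<and> (\<forall>Z. ?P Z \<longrightarrow> card Z \<le> card X)"
  proof (rule ex_has_greatest_nat[where b = "Suc (card Y)" and k = "{}"])
    show "?P {}" using n by simp
    show "\<forall>Z. ?P Z \<longrightarrow> card Z < Suc (card Y)"
      using card_mono[OF fin] by (auto simp: less_Suc_eq_le)
  qed
  then obtain X where X: "?P X" and X_max: "\<And>Z. ?P Z \<Longrightarrow> card Z \<le> card X" by blast
  have "n / 4 \<le> card X" if neq: "X \<noteq> Y"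
  proof (rule ccontr)
    assume "\<not> n / 4 \<le> card X"
    obtain u where u: "u \<in> Y" "u \<notin> X" using neq X by blast
    let ?B = "r `` {u}"
    have rY: "r \<subseteq> Y \<times> Y" and "refl_on Y r" and sym: "sym r" and trans: "trans r"
      using r by (auto simp: equiv_def refl_on_def)
    have B: "?B \<subseteq> Y" "r `` ?B \<subseteq> ?B" "u \<in> ?B"
      using rY trans u \<open>refl_on Y r\<close> by (auto simp: refl_on_def dest: transD)
    have disj: "X \<inter> ?B = {}"
    proof (rule ccontr)
      assume "X \<inter> ?B \<noteq> {}"
      then obtain w where "w \<in> X" "(w, u) \<in> r" using sym by (auto dest: symD)
      then show False using X u by blast
    qed
    have fins: "finite X" "finite ?B" using X B fin finite_subset by blast+
    have "card ?B \<le> card X" using X_max[of ?B] B small u by blast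
    moreover have "r `` (X \<union> ?B) \<subseteq> X \<union> ?B" using X B by blast
    moreover have card: "card (X \<union> ?B) = card X + card ?B"
      using disj fins by (simp add: card_Un_disjoint)
    ultimately have "?P (X \<union> ?B)" using X B \<open>\<not> n / 4 \<le> card X\<close> by simp
    then have "card ?B = 0" using X_max[of "X \<union> ?B"] card by simp
    then show False using B fins by auto
  qed
  then show ?thesis using that X by blast
qed

text \<open>
  The properties of the first cohomology of a right-angled Artin group on which the comparison rests.
  Vectors are functions on the vertices, \<open>ev v x\<close> being the value of \<open>x\<close> at \<open>v\<close>, and the pairing enters
  only through the pairs of vectors on which it vanishes.
\<close>

locale graph_pairing = vectorspace K V
  for K :: "('l, 'm) ring_scheme" and V :: "('l, 'a, 'n) module_scheme" +
  fixes W :: "('l, 'b, 'k) module_scheme"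
    and q :: "'a \<Rightarrow> 'a \<Rightarrow> 'b"
    and \<Gamma> :: "'v pair_pre_digraph"
    and ev :: "'v \<Rightarrow> 'a \<Rightarrow> 'l"
  assumes graph: "pair_graph \<Gamma>"
    and ev_closed: "v \<in> pverts \<Gamma> \<Longrightarrow> x \<in> carrier V \<Longrightarrow> ev v x \<in> carrier K"
    and ev_add: "v \<in> pverts \<Gamma> \<Longrightarrow> x \<in> carrier V \<Longrightarrow> y \<in> carrier V \<Longrightarrow>
      ev v (x \<oplus>\<^bsub>V\<^esub> y) = ev v x \<oplus>\<^bsub>K\<^esub> ev v y"
    and ev_smult: "v \<in> pverts \<Gamma> \<Longrightarrow> a \<in> carrier K \<Longrightarrow> x \<in> carrier V \<Longrightarrow>
      ev v (a \<odot>\<^bsub>V\<^esub> x) = a \<otimes>\<^bsub>K\<^esub> ev v x"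
    and ev_inject: "x \<in> carrier V \<Longrightarrow> y \<in> carrier V \<Longrightarrow> (\<And>v. v \<in> pverts \<Gamma> \<Longrightarrow> ev v x = ev v y) \<Longrightarrow> x = y"
    and ev_surject: "c \<in> pverts \<Gamma> \<rightarrow> carrier K \<Longrightarrow> \<exists>x\<in>carrier V. \<forall>v\<in>pverts \<Gamma>. ev v x = c v"
    and q_zero_iff: "x \<in> carrier V \<Longrightarrow> y \<in> carrier V \<Longrightarrow> q x y = \<zero>\<^bsub>W\<^esub> \<longleftrightarrow>
      (\<forall>(v, w) \<in> parcs \<Gamma>. ev v x \<otimes>\<^bsub>K\<^esub> ev w y = ev w x \<otimes>\<^bsub>K\<^esub> ev v y)"
begin

lemma finite_pverts: "finite (pverts \<Gamma>)"
proof -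
  interpret pair_graph \<Gamma> by (rule graph)
  show ?thesis by (rule pair_finite_verts)
qed

lemma arcs:
  assumes "(v, w) \<in> parcs \<Gamma>"
  shows "v \<in> pverts \<Gamma>" "w \<in> pverts \<Gamma>" "v \<noteq> w" "(w, v) \<in> parcs \<Gamma>"
proof -
  interpret pair_graph \<Gamma> by (rule graph)
  show "v \<in> pverts \<Gamma>" "w \<in> pverts \<Gamma>" using assms by (auto dest: in_arcsD1 in_arcsD2)
  show "v \<noteq> w" using assms no_loops[of "(v, w)"] by auto
  show "(w, v) \<in> parcs \<Gamma>" using assms arcs_symmetric by simp
qed

lemma ev_zero: "v \<in> pverts \<Gamma> \<Longrightarrow> ev v \<zero>\<^bsub>V\<^esub> = \<zero>\<^bsub>K\<^esub>"
  using ev_smult[of v "\<zero>\<^bsub>K\<^esub>" "\<zero>\<^bsub>V\<^esub>"] ev_closed[of v "\<zero>\<^bsub>V\<^esub>"] by simp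

subsection \<open>Coordinate subspaces\<close>

definition dual_vector :: "'v \<Rightarrow> 'a" where
  "dual_vector v = (SOME x. x \<in> carrier V \<and>
     (\<forall>w\<in>pverts \<Gamma>. ev w x = (if w = v then \<one>\<^bsub>K\<^esub> else \<zero>\<^bsub>K\<^esub>)))"

lemma dual_vector:
  shows "dual_vector v \<in> carrier V"
    and "w \<in> pverts \<Gamma> \<Longrightarrow> ev w (dual_vector v) = (if w = v then \<one>\<^bsub>K\<^esub> else \<zero>\<^bsub>K\<^esub>)"
proof -
  have "(\<lambda>w. if w = v then \<one>\<^bsub>K\<^esub> else \<zero>\<^bsub>K\<^esub>) \<in> pverts \<Gamma> \<rightarrow> carrier K" by auto
  then have "\<exists>x. x \<in> carrier V \<and> (\<forall>w\<in>pverts \<Gamma>. ev w x = (if w = v then \<one>\<^bsub>K\<^esub> else \<zero>\<^bsub>K\<^esub>))"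
    using ev_surject by blast
  from someI_ex[OF this]
  show "dual_vector v \<in> carrier V"
    and "w \<in> pverts \<Gamma> \<Longrightarrow> ev w (dual_vector v) = (if w = v then \<one>\<^bsub>K\<^esub> else \<zero>\<^bsub>K\<^esub>)"
    unfolding dual_vector_def by auto
qed

lemma one_neq_zero: "\<one>\<^bsub>K\<^esub> \<noteq> \<zero>\<^bsub>K\<^esub>"
  by simp

lemma inj_on_dual_vector: "inj_on dual_vector (pverts \<Gamma>)"
proof (rule inj_onI)
  fix v w assume vw: "v \<in> pverts \<Gamma>" "w \<in> pverts \<Gamma>" "dual_vector v = dual_vector w"
  then have "ev v (dual_vector w) = \<one>\<^bsub>K\<^esub>" using dual_vector(2)[of v v] by simp
  then show "v = w" using dual_vector(2)[of v w] vw one_neq_zero by (simp split: if_splits)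
qed

definition coordinate_subspace :: "'v set \<Rightarrow> 'a set" where
  "coordinate_subspace S = {x \<in> carrier V. \<forall>v\<in>pverts \<Gamma> - S. ev v x = \<zero>\<^bsub>K\<^esub>}"

lemma submodule_coordinate_subspace: "Module.submodule (coordinate_subspace S) K V"
  by (rule submoduleI) (auto simp: coordinate_subspace_def ev_zero ev_add ev_smult)

lemma coordinate_subspace_all: "coordinate_subspace (pverts \<Gamma>) = carrier V"
  by (auto simp: coordinate_subspace_def)

lemma coordinate_subspace_Int:
  "coordinate_subspace S \<inter> coordinate_subspace T = coordinate_subspace (S \<inter> T)"
  by (auto simp: coordinate_subspace_def)

lemma dual_vector_in_coordinate_subspace: "v \<in> S \<Longrightarrow> dual_vector v \<in> coordinate_subspace S"
  by (auto simp: coordinate_subspace_def dual_vector)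

lemma ev_lincomb_dual_vectors:
  assumes "finite S" "S \<subseteq> pverts \<Gamma>" "a \<in> dual_vector ` S \<rightarrow> carrier K" "v \<in> pverts \<Gamma>"
  shows "ev v (lincomb a (dual_vector ` S)) = (if v \<in> S then a (dual_vector v) else \<zero>\<^bsub>K\<^esub>)"
  using assms(1-3)
proof (induction S)
  case empty
  then show ?case using assms(4) by (simp add: lincomb_def ev_zero)
next
  case (insert u S)
  let ?e = dual_vector
  have e: "?e u \<notin> ?e ` S"
    using inj_on_dual_vector insert by (auto simp: inj_on_def)
  have a: "a \<in> ?e ` S \<rightarrow> carrier K" "a (?e u) \<in> carrier K" using insert by auto
  have sub: "?e ` S \<subseteq> carrier V" using dual_vector by auto
  have "lincomb a (?e ` insert u S) = (a (?e u) \<odot>\<^bsub>V\<^esub> ?e u) \<oplus>\<^bsub>V\<^esub> lincomb a (?e ` S)"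
    unfolding lincomb_def
    using insert.hyps e a sub dual_vector(1)
    by (simp, intro M.finsum_insert) (auto intro!: smult_closed)
  moreover have "lincomb a (?e ` S) \<in> carrier V" using sub a by auto
  moreover have "ev v (lincomb a (?e ` S)) = (if v \<in> S then a (?e v) else \<zero>\<^bsub>K\<^esub>)"
    using insert a by auto
  moreover have "v \<in> S \<Longrightarrow> a (?e v) \<in> carrier K" using a by auto
  ultimately show ?case
    using insert.hyps a(2) dual_vector assms(4)
    by (auto simp: ev_add ev_smult)
qed

lemma basis_coordinate_subspace:
  assumes "S \<subseteq> pverts \<Gamma>"
  shows "is_basis K V (coordinate_subspace S) (dual_vector ` S)"
proof -
  let ?e = dual_vector
  have fin: "finite S" using assms finite_pverts finite_subset by blast
  have sub: "?e ` S \<subseteq> carrier V" using dual_vector by auto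
  have inj: "inj_on ?e S" using inj_on_dual_vector assms inj_on_subset by blast
  have "lin_indpt (?e ` S)"
  proof (rule finite_lin_indpt2)
    fix a assume a: "a \<in> ?e ` S \<rightarrow> carrier K" "lincomb a (?e ` S) = \<zero>\<^bsub>V\<^esub>"
    have "a (?e v) = \<zero>\<^bsub>K\<^esub>" if "v \<in> S" for v
      using ev_lincomb_dual_vectors[OF fin assms a(1), of v] a(2) that assms ev_zero[of v] by auto
    then show "\<forall>v\<in>?e ` S. a v = \<zero>\<^bsub>K\<^esub>" by blast
  qed (use fin sub in auto)
  moreover have "span (?e ` S) = coordinate_subspace S"
  proof
    show "span (?e ` S) \<subseteq> coordinate_subspace S"
      by (rule span_is_subset)
        (use submodule_coordinate_subspace dual_vector_in_coordinate_subspace in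
          \<open>auto simp: submodule_iff\<close>)
    show "coordinate_subspace S \<subseteq> span (?e ` S)"
    proof
      fix x assume x: "x \<in> coordinate_subspace S"
      define a where "a b = ev (inv_into S ?e b) x" for b
      have a_e: "a (?e v) = ev v x" if "v \<in> S" for v
        using that inj by (simp add: a_def)
      have xV: "x \<in> carrier V" using x by (simp add: coordinate_subspace_def)
      have a: "a \<in> ?e ` S \<rightarrow> carrier K" using a_e assms xV ev_closed by (auto simp: Pi_iff)
      have "lincomb a (?e ` S) = x"
        by (rule ev_inject)
          (use sub a xV x assms in
            \<open>auto simp: ev_lincomb_dual_vectors[OF fin assms a] a_e coordinate_subspace_def\<close>)
      then show "x \<in> span (?e ` S)" using a fin unfolding span_def by blast
    qed
  qed
  ultimately show ?thesis
    unfolding is_basis_iff using dual_vector_in_coordinate_subspace by auto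
qed

lemma fin_dim: "fin_dim"
  unfolding fin_dim_def
  by (rule exI[of _ "dual_vector ` pverts \<Gamma>"])
    (use basis_coordinate_subspace[of "pverts \<Gamma>"] finite_pverts in
      \<open>simp add: is_basis_iff coordinate_subspace_all\<close>)

lemma finite_dim: "finite_dim K V"
  unfolding finite_dim_def
  using basis_coordinate_subspace[of "pverts \<Gamma>"] finite_pverts coordinate_subspace_all by auto

lemma lin_dim_coordinate_subspace:
  assumes "S \<subseteq> pverts \<Gamma>"
  shows "lin_dim K V (coordinate_subspace S) = card S"
  using lin_dim_eq_card[OF fin_dim submodule_coordinate_subspace basis_coordinate_subspace[OF assms]]
    card_image[of dual_vector S] inj_on_dual_vector assms inj_on_subset by metis

lemma lin_dim_carrier: "lin_dim K V (carrier V) = card (pverts \<Gamma>)"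
  using lin_dim_coordinate_subspace[of "pverts \<Gamma>"] by (simp add: coordinate_subspace_all)

text \<open>
  The hypothesis says that \<open>U\<close> meets the space of functions supported off \<open>R\<close> trivially; that space has
  codimension \<open>|R|\<close>.
\<close>

lemma lin_dim_le_determining_set:
  assumes U: "Module.submodule U K V" and R: "R \<subseteq> pverts \<Gamma>"
    and det: "\<And>x v. x \<in> U \<Longrightarrow> (\<And>u. u \<in> R \<Longrightarrow> ev u x = \<zero>\<^bsub>K\<^esub>) \<Longrightarrow> v \<in> pverts \<Gamma> - R \<Longrightarrow> ev v x = \<zero>\<^bsub>K\<^esub>"
  shows "lin_dim K V U \<le> card R"
proof -
  let ?C = "coordinate_subspace (pverts \<Gamma> - R)"
  have "?C \<inter> U \<subseteq> coordinate_subspace {}"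
    using det R unfolding coordinate_subspace_def by blast
  then have "lin_dim K V (?C \<inter> U) \<le> lin_dim K V (coordinate_subspace {})"
    by (intro lin_dim_mono fin_dim submodule_Int submodule_coordinate_subspace U)
  also have "\<dots> = 0" using lin_dim_coordinate_subspace[of "{}"] by simp
  finally have zero: "lin_dim K V (?C \<inter> U) = 0" by simp
  have "lin_dim K V U + lin_dim K V ?C \<le> lin_dim K V (?C \<inter> U) + lin_dim K V (carrier V)"
    by (rule grassmann_le[OF fin_dim U submodule_coordinate_subspace submodule_carrier])
      (use submoduleD(1)[OF U] submoduleD(1)[OF submodule_coordinate_subspace] in auto)
  moreover have "lin_dim K V ?C = card (pverts \<Gamma>) - card R"
    using lin_dim_coordinate_subspace[of "pverts \<Gamma> - R"] R
    by (simp add: card_Diff_subset finite_subset[OF R finite_pverts])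
  moreover have "card R \<le> card (pverts \<Gamma>)" using R finite_pverts card_mono by blast
  ultimately show ?thesis using zero lin_dim_carrier by linarith
qed

subsection \<open>Valence\<close>

lemma q_dual_vectors_nonzero:
  assumes "q (dual_vector v) (dual_vector w) \<noteq> \<zero>\<^bsub>W\<^esub>"
  shows "(v, w) \<in> parcs \<Gamma>"
proof (rule ccontr)
  assume no: "(v, w) \<notin> parcs \<Gamma>"
  obtain a b where ab: "(a, b) \<in> parcs \<Gamma>" and neq:
    "ev a (dual_vector v) \<otimes>\<^bsub>K\<^esub> ev b (dual_vector w) \<noteq> ev b (dual_vector v) \<otimes>\<^bsub>K\<^esub> ev a (dual_vector w)"
    using assms q_zero_iff[OF dual_vector(1) dual_vector(1)] by auto
  have "\<not> (a = v \<and> b = w)" "\<not> (b = v \<and> a = w)" using ab no arcs(4) by auto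
  then show False using neq arcs[OF ab] by (auto simp: dual_vector(2) split: if_splits)
qed

text \<open>
  The dual basis serves as the basis and as the spanning set. The zero vector is added to the latter
  because the minimum ranges over nonempty sets and the graph may have no vertices.
\<close>

lemma q_valence_le:
  assumes "\<And>v. v \<in> pverts \<Gamma> \<Longrightarrow> graph_valence \<Gamma> v \<le> N"
  shows "q_valence K V W q \<le> N"
proof -
  let ?B = "dual_vector ` pverts \<Gamma>" and ?S = "insert \<zero>\<^bsub>V\<^esub> (dual_vector ` pverts \<Gamma>)"
  have basis: "is_basis K V (carrier V) ?B"
    using basis_coordinate_subspace[of "pverts \<Gamma>"] by (simp add: coordinate_subspace_all)
  have S: "?S \<subseteq> carrier V" using dual_vector(1) by auto
  have "lin_span K V ?S = carrier V"
    using basis span_is_monotone[of ?B ?S] span_is_subset2[OF S]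
    unfolding lin_span_eq_span is_basis_iff by auto
  then have "q_valence K V W q \<le> set_valence K V W q ?S"
    unfolding q_valence_def using S by (intro cINF_lower) auto
  also have "\<dots> \<le> valence_wrt W q ?B ?S"
    unfolding set_valence_def using basis by (intro cINF_lower) auto
  also have "\<dots> \<le> N"
  proof -
    have "card {b \<in> ?B. q \<zero>\<^bsub>V\<^esub> b \<noteq> \<zero>\<^bsub>W\<^esub>} \<le> N"
    proof -
      have "q \<zero>\<^bsub>V\<^esub> b = \<zero>\<^bsub>W\<^esub>" if "b \<in> carrier V" for b
        using that arcs by (auto simp: q_zero_iff ev_zero ev_closed)
      then have "{b \<in> ?B. q \<zero>\<^bsub>V\<^esub> b \<noteq> \<zero>\<^bsub>W\<^esub>} = {}" using dual_vector(1) by auto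
      then show ?thesis by (metis (no_types, lifting) card.empty le0)
    qed
    moreover have "card {b \<in> ?B. q (dual_vector v) b \<noteq> \<zero>\<^bsub>W\<^esub>} \<le> N" if v: "v \<in> pverts \<Gamma>" for v
    proof -
      have fin: "finite {w. (v, w) \<in> parcs \<Gamma>}"
        by (rule finite_subset[OF _ finite_pverts]) (use arcs in auto)
      have "{b \<in> ?B. q (dual_vector v) b \<noteq> \<zero>\<^bsub>W\<^esub>} \<subseteq> dual_vector ` {w. (v, w) \<in> parcs \<Gamma>}"
        using q_dual_vectors_nonzero by auto
      then have "card {b \<in> ?B. q (dual_vector v) b \<noteq> \<zero>\<^bsub>W\<^esub>} \<le> graph_valence \<Gamma> v"
        unfolding graph_valence_def using fin by (meson card_image_le card_mono finite_imageI le_trans)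
      then show ?thesis using assms[OF v] by simp
    qed
    ultimately show ?thesis
      unfolding valence_wrt_def using finite_pverts by (subst Max_le_iff) auto
  qed
  finally show ?thesis .
qed

lemma spanning_set_sees_vertex:
  assumes v: "v \<in> pverts \<Gamma>" and S: "S \<subseteq> carrier V" "span S = carrier V"
  obtains s where "s \<in> S" "ev v s \<noteq> \<zero>\<^bsub>K\<^esub>"
proof (rule ccontr)
  assume "\<not> thesis"
  then have "S \<subseteq> coordinate_subspace (pverts \<Gamma> - {v})"
    using S that unfolding coordinate_subspace_def by auto
  then have "span S \<subseteq> coordinate_subspace (pverts \<Gamma> - {v})"
    by (rule span_is_subset) (use submodule_coordinate_subspace in \<open>simp add: submodule_iff\<close>)
  then have "ev v (dual_vector v) = \<zero>\<^bsub>K\<^esub>"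
    using S dual_vector(1)[of v] v by (auto simp: coordinate_subspace_def)
  then show False using dual_vector(2)[OF v, of v] one_neq_zero by simp
qed

text \<open>
  A vector \<open>y\<close> with \<open>q s y = 0\<close> takes the value \<open>s(w) y(v) / s(v)\<close> at each neighbour \<open>w\<close> of \<open>v\<close>. So it is
  determined by its values off the neighbourhood of \<open>v\<close>, and only \<open>n - graph_valence \<Gamma> v\<close> independent
  vectors can satisfy this.
\<close>

lemma card_nonzero_pairings_ge:
  assumes v: "v \<in> pverts \<Gamma>" and s: "s \<in> carrier V" "ev v s \<noteq> \<zero>\<^bsub>K\<^esub>"
    and B: "is_basis K V (carrier V) B"
  shows "graph_valence \<Gamma> v \<le> card {b \<in> B. q s b \<noteq> \<zero>\<^bsub>W\<^esub>}"
proof -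
  define Nb where "Nb = {w. (v, w) \<in> parcs \<Gamma>}"
  define U where "U = {y \<in> carrier V. \<forall>w\<in>Nb. ev v s \<otimes>\<^bsub>K\<^esub> ev w y = ev w s \<otimes>\<^bsub>K\<^esub> ev v y}"
  have Nb: "w \<in> pverts \<Gamma>" "w \<noteq> v" if "w \<in> Nb" for w using that arcs unfolding Nb_def by auto
  have B_sub: "B \<subseteq> carrier V" "lin_indpt B" using B unfolding is_basis_iff by auto
  have fin: "finite B" using finite_basis[OF fin_dim submodule_carrier B] .
  have U: "Module.submodule U K V"
  proof (rule submoduleI)
    show "x \<oplus>\<^bsub>V\<^esub> y \<in> U" if "x \<in> U" "y \<in> U" for x y
      using that v s(1) Nb by (auto simp: U_def ev_add ev_closed r_distr)
    show "a \<odot>\<^bsub>V\<^esub> x \<in> U" if "a \<in> carrier K" "x \<in> U" for a x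
    proof -
      have "ev v s \<otimes>\<^bsub>K\<^esub> (a \<otimes>\<^bsub>K\<^esub> ev w x) = ev w s \<otimes>\<^bsub>K\<^esub> (a \<otimes>\<^bsub>K\<^esub> ev v x)" if w: "w \<in> Nb" for w
      proof -
        have "ev v s \<otimes>\<^bsub>K\<^esub> (a \<otimes>\<^bsub>K\<^esub> ev w x) = a \<otimes>\<^bsub>K\<^esub> (ev v s \<otimes>\<^bsub>K\<^esub> ev w x)"
          using \<open>a \<in> carrier K\<close> \<open>x \<in> U\<close> v s(1) Nb w by (intro R.m_lcomm) (auto simp: U_def ev_closed)
        also have "\<dots> = a \<otimes>\<^bsub>K\<^esub> (ev w s \<otimes>\<^bsub>K\<^esub> ev v x)" using \<open>x \<in> U\<close> w by (simp add: U_def)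
        also have "\<dots> = ev w s \<otimes>\<^bsub>K\<^esub> (a \<otimes>\<^bsub>K\<^esub> ev v x)"
          using \<open>a \<in> carrier K\<close> \<open>x \<in> U\<close> v s(1) Nb w by (intro R.m_lcomm) (auto simp: U_def ev_closed)
        finally show ?thesis .
      qed
      then show ?thesis using that v Nb by (auto simp: U_def ev_smult)
    qed
  qed (use v s Nb in \<open>auto simp: U_def ev_zero ev_closed\<close>)
  let ?B0 = "{b \<in> B. q s b = \<zero>\<^bsub>W\<^esub>}"
  have "?B0 \<subseteq> U"
  proof
    fix y assume y: "y \<in> ?B0"
    then have yV: "y \<in> carrier V" and "q s y = \<zero>\<^bsub>W\<^esub>" using B_sub(1) by auto
    then have "\<forall>(a, b) \<in> parcs \<Gamma>. ev a s \<otimes>\<^bsub>K\<^esub> ev b y = ev b s \<otimes>\<^bsub>K\<^esub> ev a y"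
      using q_zero_iff[OF s(1) yV] by simp
    then show "y \<in> U" using yV unfolding U_def Nb_def by blast
  qed
  moreover have "lin_indpt ?B0" by (rule subset_li_is_li[OF B_sub(2)]) auto
  ultimately have "card ?B0 \<le> lin_dim K V U" by (rule lin_indpt_card_le_lin_dim(2)[OF fin_dim U])
  also have "\<dots> \<le> card (pverts \<Gamma> - Nb)"
  proof (rule lin_dim_le_determining_set[OF U])
    fix x w assume x: "x \<in> U" "\<And>u. u \<in> pverts \<Gamma> - Nb \<Longrightarrow> ev u x = \<zero>\<^bsub>K\<^esub>" "w \<in> pverts \<Gamma> - (pverts \<Gamma> - Nb)"
    have "v \<in> pverts \<Gamma> - Nb" using v Nb by auto
    then have "ev v s \<otimes>\<^bsub>K\<^esub> ev w x = ev w s \<otimes>\<^bsub>K\<^esub> \<zero>\<^bsub>K\<^esub>" using x by (auto simp: U_def)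
    also have "\<dots> = \<zero>\<^bsub>K\<^esub>" using s x by (auto simp: ev_closed)
    finally have "ev v s \<otimes>\<^bsub>K\<^esub> ev w x = \<zero>\<^bsub>K\<^esub>" .
    moreover have "ev v s \<in> carrier K" "ev w x \<in> carrier K" using s x v by (auto simp: U_def ev_closed)
    ultimately show "ev w x = \<zero>\<^bsub>K\<^esub>" using s(2) integral by blast
  qed auto
  also have "\<dots> = card (pverts \<Gamma>) - graph_valence \<Gamma> v"
    unfolding graph_valence_def Nb_def[symmetric] using Nb finite_pverts
    by (intro card_Diff_subset) (auto intro: finite_subset[of Nb "pverts \<Gamma>"])
  finally have le: "card ?B0 \<le> card (pverts \<Gamma>) - graph_valence \<Gamma> v" .
  have "graph_valence \<Gamma> v \<le> card (pverts \<Gamma>)"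
    unfolding graph_valence_def Nb_def[symmetric] using Nb finite_pverts by (intro card_mono) auto
  moreover have "card B = card (pverts \<Gamma>)"
    using lin_dim_eq_card[OF fin_dim submodule_carrier B] lin_dim_carrier by simp
  moreover have "card B = card ?B0 + card {b \<in> B. q s b \<noteq> \<zero>\<^bsub>W\<^esub>}"
    using fin by (subst card_Un_disjoint[symmetric]) (auto intro: arg_cong[where f = card])
  ultimately show ?thesis using le by linarith
qed

text \<open>
  The minimum defining the \<open>q\<close>-valence is attained, say at \<open>S\<close> and \<open>B\<close>, and some vector in the spanning set
  \<open>S\<close> does not vanish at \<open>v\<close>.
\<close>

lemma graph_valence_le_q_valence:
  assumes v: "v \<in> pverts \<Gamma>"
  shows "graph_valence \<Gamma> v \<le> q_valence K V W q"
proof -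
  have basis: "is_basis K V (carrier V) (dual_vector ` pverts \<Gamma>)"
    using basis_coordinate_subspace[of "pverts \<Gamma>"] by (simp add: coordinate_subspace_all)
  have "span (carrier V) = carrier V"
    using in_own_span[of "carrier V"] span_is_subset2[of "carrier V"] by auto
  then have "carrier V \<in> {S. S \<noteq> {} \<and> S \<subseteq> carrier V \<and> lin_span K V S = carrier V}"
    by (auto simp: lin_span_eq_span)
  then have "q_valence K V W q \<in> set_valence K V W q `
      {S. S \<noteq> {} \<and> S \<subseteq> carrier V \<and> lin_span K V S = carrier V}"
    unfolding q_valence_def by (intro Inf_nat_def1) blast
  then obtain S where S: "S \<subseteq> carrier V" "span S = carrier V"
    "q_valence K V W q = set_valence K V W q S"
    by (auto simp: lin_span_eq_span)
  have "set_valence K V W q S \<in> (\<lambda>B. valence_wrt W q B S) ` {B. is_basis K V (carrier V) B}"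
    unfolding set_valence_def by (intro Inf_nat_def1) (use basis in blast)
  then obtain B where B: "is_basis K V (carrier V) B"
    "set_valence K V W q S = valence_wrt W q B S"
    by auto
  have fin: "finite B" using finite_basis[OF fin_dim submodule_carrier B(1)] .
  obtain s where s: "s \<in> S" "ev v s \<noteq> \<zero>\<^bsub>K\<^esub>" using spanning_set_sees_vertex[OF v S(1,2)] .
  have "graph_valence \<Gamma> v \<le> card {b \<in> B. q s b \<noteq> \<zero>\<^bsub>W\<^esub>}"
    using card_nonzero_pairings_ge[OF v _ s(2) B(1)] s S by blast
  also have "\<dots> \<le> valence_wrt W q B S"
    unfolding valence_wrt_def
  proof (rule Max_ge)
    have "card {b \<in> B. q s b \<noteq> \<zero>\<^bsub>W\<^esub>} \<le> card B" for s using fin by (intro card_mono) auto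
    then show "finite ((\<lambda>s. card {b \<in> B. q s b \<noteq> \<zero>\<^bsub>W\<^esub>}) ` S)"
      by (intro finite_subset[OF _ finite_atMost[of "card B"]]) auto
  qed (use s in blast)
  finally show ?thesis using S B by simp
qed

subsection \<open>Cheeger constants\<close>

lemma annihilator_iff:
  assumes F: "F \<subseteq> carrier V"
  shows "x \<in> annihilator V W q F \<longleftrightarrow> x \<in> carrier V \<and>
    (\<forall>f\<in>F. \<forall>(v, w) \<in> parcs \<Gamma>. ev v f \<otimes>\<^bsub>K\<^esub> ev w x = ev w f \<otimes>\<^bsub>K\<^esub> ev v x)"
proof (cases "x \<in> carrier V")
  case True
  have "(\<forall>f\<in>F. q f x = \<zero>\<^bsub>W\<^esub>) \<longleftrightarrow>
      (\<forall>f\<in>F. \<forall>(v, w) \<in> parcs \<Gamma>. ev v f \<otimes>\<^bsub>K\<^esub> ev w x = ev w f \<otimes>\<^bsub>K\<^esub> ev v x)"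
    by (rule ball_cong[OF HOL.refl]) (use q_zero_iff[OF _ True] F in blast)
  then show ?thesis using True by (simp add: annihilator_def)
qed (simp add: annihilator_def)

lemma submodule_annihilator:
  assumes F: "F \<subseteq> carrier V"
  shows "Module.submodule (annihilator V W q F) K V"
proof (rule submoduleI)
  show "annihilator V W q F \<subseteq> carrier V" by (auto simp: annihilator_def)
  have closed: "ev v f \<in> carrier K" "ev w f \<in> carrier K" if "f \<in> carrier V" "(v, w) \<in> parcs \<Gamma>" for f v w
    using that arcs ev_closed by auto
  show "\<zero>\<^bsub>V\<^esub> \<in> annihilator V W q F"
    using F arcs by (auto simp: annihilator_iff[OF F] ev_zero closed subset_iff)
  show "x \<oplus>\<^bsub>V\<^esub> y \<in> annihilator V W q F"
    if "x \<in> annihilator V W q F" "y \<in> annihilator V W q F" for x y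
    unfolding annihilator_iff[OF F]
  proof (intro conjI ballI, safe)
    show "x \<oplus>\<^bsub>V\<^esub> y \<in> carrier V" using that by (auto simp: annihilator_def)
    fix f v w assume f: "f \<in> F" and vw: "(v, w) \<in> parcs \<Gamma>"
    have "x \<in> carrier V" "y \<in> carrier V" "f \<in> carrier V" using that f F by (auto simp: annihilator_def)
    moreover have "ev v f \<otimes>\<^bsub>K\<^esub> ev w x = ev w f \<otimes>\<^bsub>K\<^esub> ev v x" "ev v f \<otimes>\<^bsub>K\<^esub> ev w y = ev w f \<otimes>\<^bsub>K\<^esub> ev v y"
      using that f vw unfolding annihilator_iff[OF F] by blast+
    ultimately show "ev v f \<otimes>\<^bsub>K\<^esub> ev w (x \<oplus>\<^bsub>V\<^esub> y) = ev w f \<otimes>\<^bsub>K\<^esub> ev v (x \<oplus>\<^bsub>V\<^esub> y)"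
      using vw arcs(1,2)[OF vw] closed by (simp add: ev_add R.r_distr)
  qed
  show "a \<odot>\<^bsub>V\<^esub> x \<in> annihilator V W q F"
    if "a \<in> carrier K" "x \<in> annihilator V W q F" for a x
    unfolding annihilator_iff[OF F]
  proof (intro conjI ballI, safe)
    show "a \<odot>\<^bsub>V\<^esub> x \<in> carrier V" using that by (auto simp: annihilator_def)
    fix f v w assume f: "f \<in> F" and vw: "(v, w) \<in> parcs \<Gamma>"
    have x: "x \<in> carrier V" "f \<in> carrier V" using that f F by (auto simp: annihilator_def)
    have eq: "ev v f \<otimes>\<^bsub>K\<^esub> ev w x = ev w f \<otimes>\<^bsub>K\<^esub> ev v x"
      using that f vw unfolding annihilator_iff[OF F] by blast
    have "ev v f \<otimes>\<^bsub>K\<^esub> (a \<otimes>\<^bsub>K\<^esub> ev w x) = a \<otimes>\<^bsub>K\<^esub> (ev v f \<otimes>\<^bsub>K\<^esub> ev w x)"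
      using that(1) closed[OF _ vw] x by (intro R.m_lcomm) auto
    also have "\<dots> = ev w f \<otimes>\<^bsub>K\<^esub> (a \<otimes>\<^bsub>K\<^esub> ev v x)"
      unfolding eq using that(1) closed[OF _ vw] x by (intro R.m_lcomm) auto
    finally show "ev v f \<otimes>\<^bsub>K\<^esub> ev w (a \<odot>\<^bsub>V\<^esub> x) = ev w f \<otimes>\<^bsub>K\<^esub> ev v (a \<odot>\<^bsub>V\<^esub> x)"
      using that(1) x arcs(1,2)[OF vw] by (simp add: ev_smult)
  qed
qed

text \<open>
  Pairing \<open>x\<close> with the dual vector of \<open>v\<close> along the arc \<open>(v, w)\<close> returns the value of \<open>x\<close> at \<open>w\<close>. So a
  function is orthogonal to those supported on \<open>A\<close> exactly if it vanishes on all neighbours of \<open>A\<close>,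
  including those in \<open>A\<close>.
\<close>

lemma annihilator_coordinate_subspace:
  assumes A: "A \<subseteq> pverts \<Gamma>"
  shows "annihilator V W q (coordinate_subspace A) =
    coordinate_subspace (pverts \<Gamma> - {w. \<exists>v\<in>A. (v, w) \<in> parcs \<Gamma>})"
    (is "?C = coordinate_subspace (_ - ?N)")
proof
  note sub = submoduleD(1)[OF submodule_coordinate_subspace[of A]]
  show "?C \<subseteq> coordinate_subspace (pverts \<Gamma> - ?N)"
  proof
    fix x assume x: "x \<in> ?C"
    have xV: "x \<in> carrier V" using x by (simp add: annihilator_def)
    have "ev w x = \<zero>\<^bsub>K\<^esub>" if v: "v \<in> A" and vw: "(v, w) \<in> parcs \<Gamma>" for v w
    proof -
      have "ev v (dual_vector v) \<otimes>\<^bsub>K\<^esub> ev w x = ev w (dual_vector v) \<otimes>\<^bsub>K\<^esub> ev v x"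
        using x dual_vector_in_coordinate_subspace[OF v] vw unfolding annihilator_iff[OF sub] by blast
      then show ?thesis using arcs[OF vw] xV by (simp add: dual_vector(2) ev_closed)
    qed
    then show "x \<in> coordinate_subspace (pverts \<Gamma> - ?N)"
      using xV unfolding coordinate_subspace_def by auto
  qed
  show "coordinate_subspace (pverts \<Gamma> - ?N) \<subseteq> ?C"
  proof
    fix x assume x: "x \<in> coordinate_subspace (pverts \<Gamma> - ?N)"
    have xV: "x \<in> carrier V" using x by (simp add: coordinate_subspace_def)
    have "ev v f \<otimes>\<^bsub>K\<^esub> ev w x = \<zero>\<^bsub>K\<^esub>" if f: "f \<in> coordinate_subspace A" and vw: "(v, w) \<in> parcs \<Gamma>" for f v w
    proof (cases "v \<in> A")
      case True
      then have "ev w x = \<zero>\<^bsub>K\<^esub>" using x vw arcs[OF vw] by (auto simp: coordinate_subspace_def)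
      then show ?thesis using f arcs[OF vw] by (simp add: ev_closed coordinate_subspace_def)
    next
      case False
      then have "ev v f = \<zero>\<^bsub>K\<^esub>" using f arcs[OF vw] by (auto simp: coordinate_subspace_def)
      then show ?thesis using xV arcs[OF vw] by (simp add: ev_closed)
    qed
    then have "\<forall>f\<in>coordinate_subspace A. \<forall>(v, w) \<in> parcs \<Gamma>.
        ev v f \<otimes>\<^bsub>K\<^esub> ev w x = ev w f \<otimes>\<^bsub>K\<^esub> ev v x"
      using arcs(4) by (auto split: prod.splits)
    then show "x \<in> ?C" unfolding annihilator_iff[OF sub] using xV by blast
  qed
qed

text \<open>
  With \<open>N\<close> the set of neighbours of \<open>A\<close> and \<open>n\<close> the number of vertices, the numerator is
  \<open>n - |A| - (n - |N|) + |A - N| = |N - A|\<close>, and \<open>N - A\<close> is the boundary of \<open>A\<close>.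
\<close>

lemma subspace_cheeger_coordinate_subspace:
  assumes A: "A \<subseteq> pverts \<Gamma>"
  shows "subspace_cheeger K V W q (coordinate_subspace A) =
    real (card (graph_boundary \<Gamma> A)) / real (card A)"
proof -
  let ?N = "{w. \<exists>v\<in>A. (v, w) \<in> parcs \<Gamma>}"
  have N: "?N \<subseteq> pverts \<Gamma>" using arcs by blast
  have fin: "finite A" "finite ?N" using A N finite_pverts finite_subset by blast+
  have boundary: "graph_boundary \<Gamma> A = ?N - A"
    using N unfolding graph_boundary_def by auto
  have "card ?N + card (A - ?N) = card A + card (?N - A)"
    using card_Un_disjoint[of ?N "A - ?N"] card_Un_disjoint[of A "?N - A"] fin
    by (simp add: Un_commute)
  moreover have "card (pverts \<Gamma> - ?N) + card ?N = card (pverts \<Gamma>)"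
    using N fin finite_pverts card_mono[OF finite_pverts N] by (simp add: card_Diff_subset)
  moreover have "(pverts \<Gamma> - ?N) \<inter> A = A - ?N" using A by blast
  ultimately have "real (card (pverts \<Gamma>)) - real (card A) - real (card (pverts \<Gamma> - ?N))
      + real (card ((pverts \<Gamma> - ?N) \<inter> A)) = real (card (?N - A))"
    by simp
  then show ?thesis
    unfolding subspace_cheeger_def Let_def annihilator_coordinate_subspace[OF A]
      coordinate_subspace_Int boundary
    using A by (simp add: lin_dim_carrier lin_dim_coordinate_subspace inf.coboundedI2)
qed

lemma vs_cheeger_le_graph_cheeger: "vs_cheeger K V W q \<le> graph_cheeger \<Gamma>"
  unfolding graph_cheeger_def
proof (rule INF_greatest)
  fix A assume A: "A \<in> {A. A \<noteq> {} \<and> A \<subseteq> pverts \<Gamma> \<and> real (card A) \<le> real (card (pverts \<Gamma>)) / 2}"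
  then have fin: "finite A" using finite_pverts finite_subset by blast
  have "vs_cheeger K V W q \<le> ereal (subspace_cheeger K V W q (coordinate_subspace A))"
    unfolding vs_cheeger_def
  proof (rule INF_lower)
    show "coordinate_subspace A \<in> {F. Module.submodule F K V \<and> 0 < lin_dim K V F \<and>
        real (lin_dim K V F) \<le> real (lin_dim K V (carrier V)) / 2}"
      using A fin submodule_coordinate_subspace
      by (auto simp: lin_dim_coordinate_subspace lin_dim_carrier card_gt_0_iff)
  qed
  then show "vs_cheeger K V W q \<le> ereal (real (card (graph_boundary \<Gamma> A)) / real (card A))"
    using subspace_cheeger_coordinate_subspace A by auto
qed

text \<open>
  Along the arc \<open>(u, w)\<close> the equations \<open>f(u) x(w) = f(w) x(u)\<close>, for \<open>f\<close> in \<open>F\<close> and \<open>x\<close> in \<open>C\<close>, state an equality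
  of two tensors of rank at most one, built from the functionals evaluating at \<open>u\<close> and \<open>w\<close> on \<open>F\<close>
  and on \<open>C\<close>. If none of the functionals at \<open>u\<close> vanishes, those at \<open>w\<close> are multiples of them, with the same
  factor on \<open>F\<close> and on \<open>C\<close>. If exactly one of them vanishes at \<open>u\<close>, the same one vanishes at \<open>w\<close>.
  The sets \<open>Fl\<close> and \<open>Cl\<close> collect the vertices that are live for \<open>F\<close> and for \<open>C\<close>: there the functional
  is non-zero.
\<close>

lemma live_neighbours:
  assumes F: "F \<subseteq> carrier V" and uw: "(u, w) \<in> parcs \<Gamma>"
  defines "C \<equiv> annihilator V W q F"
  defines "Fl \<equiv> {v \<in> pverts \<Gamma>. \<exists>f\<in>F. ev v f \<noteq> \<zero>\<^bsub>K\<^esub>}"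
    and "Cl \<equiv> {v \<in> pverts \<Gamma>. \<exists>x\<in>C. ev v x \<noteq> \<zero>\<^bsub>K\<^esub>}"
  assumes live: "u \<in> Fl \<union> Cl" "w \<in> Fl \<union> Cl"
  shows "u \<in> Fl \<longleftrightarrow> w \<in> Fl" "u \<in> Cl \<longleftrightarrow> w \<in> Cl"
    and "u \<in> Fl \<inter> Cl \<Longrightarrow>
      \<exists>l\<in>carrier K - {\<zero>\<^bsub>K\<^esub>}. \<forall>y\<in>F \<union> C. ev w y = l \<otimes>\<^bsub>K\<^esub> ev u y"
proof -
  have C: "C \<subseteq> carrier V" by (auto simp: C_def annihilator_def)
  have uwP: "u \<in> pverts \<Gamma>" "w \<in> pverts \<Gamma>" using arcs[OF uw] by auto
  have eq: "ev u f \<otimes>\<^bsub>K\<^esub> ev w x = ev w f \<otimes>\<^bsub>K\<^esub> ev u x" if "f \<in> F" "x \<in> C" for f x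
    using that uw unfolding C_def annihilator_iff[OF F] by blast
  have closed: "ev u y \<in> carrier K" "ev w y \<in> carrier K" if "y \<in> F \<union> C" for y
    using that F C uwP ev_closed by blast+
  have ratio: "\<exists>l\<in>carrier K - {\<zero>\<^bsub>K\<^esub>}. \<forall>y\<in>F \<union> C. ev w y = l \<otimes>\<^bsub>K\<^esub> ev u y" if u: "u \<in> Fl \<inter> Cl"
  proof -
    obtain f0 x0 where f0: "f0 \<in> F" "ev u f0 \<noteq> \<zero>\<^bsub>K\<^esub>" and x0: "x0 \<in> C" "ev u x0 \<noteq> \<zero>\<^bsub>K\<^esub>"
      using u by (auto simp: Fl_def Cl_def)
    have c: "ev u f0 \<in> carrier K" "ev w f0 \<in> carrier K" "ev u x0 \<in> carrier K" "ev w x0 \<in> carrier K"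
      using closed f0 x0 by auto
    define l where "l = ev w x0 \<otimes>\<^bsub>K\<^esub> inv\<^bsub>K\<^esub> (ev u x0)"
    have l: "l \<in> carrier K" and lx: "ev w x0 = l \<otimes>\<^bsub>K\<^esub> ev u x0"
      using c x0 by (auto simp: l_def field_Units R.m_assoc)
    have lf: "ev w f = l \<otimes>\<^bsub>K\<^esub> ev u f" if f: "f \<in> F" for f
    proof -
      have cf: "ev u f \<in> carrier K" "ev w f \<in> carrier K" using closed f by auto
      have "ev u x0 \<otimes>\<^bsub>K\<^esub> ev w f = ev u f \<otimes>\<^bsub>K\<^esub> ev w x0"
        using eq[OF f x0(1)] cf c by (simp add: R.m_comm)
      also have "\<dots> = ev u x0 \<otimes>\<^bsub>K\<^esub> (l \<otimes>\<^bsub>K\<^esub> ev u f)"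
        unfolding lx using cf c l by (simp add: R.m_comm R.m_lcomm)
      finally show ?thesis using cf c l x0(2) by (simp add: m_lcancel)
    qed
    have lC: "ev w x = l \<otimes>\<^bsub>K\<^esub> ev u x" if x: "x \<in> C" for x
    proof -
      have cx: "ev u x \<in> carrier K" "ev w x \<in> carrier K" using closed x by auto
      have "ev u f0 \<otimes>\<^bsub>K\<^esub> ev w x = ev w f0 \<otimes>\<^bsub>K\<^esub> ev u x" using eq[OF f0(1) x] .
      also have "\<dots> = ev u f0 \<otimes>\<^bsub>K\<^esub> (l \<otimes>\<^bsub>K\<^esub> ev u x)"
        unfolding lf[OF f0(1)] using cx c l by (simp add: R.m_assoc R.m_comm R.m_lcomm)
      finally show ?thesis using cx c l f0(2) by (simp add: m_lcancel)
    qed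
    have "l \<noteq> \<zero>\<^bsub>K\<^esub>"
    proof
      assume "l = \<zero>\<^bsub>K\<^esub>"
      then have "ev w y = \<zero>\<^bsub>K\<^esub>" if "y \<in> F \<union> C" for y
        using that lf lC closed by auto
      then show False using live(2) by (auto simp: Fl_def Cl_def)
    qed
    then show ?thesis using l lf lC by blast
  qed
  have both: "w \<in> Fl \<inter> Cl" if u: "u \<in> Fl \<inter> Cl"
  proof -
    obtain l where l: "l \<in> carrier K" "l \<noteq> \<zero>\<^bsub>K\<^esub>" "\<And>y. y \<in> F \<union> C \<Longrightarrow> ev w y = l \<otimes>\<^bsub>K\<^esub> ev u y"
      using ratio[OF u] by blast
    obtain f0 x0 where f0: "f0 \<in> F" "ev u f0 \<noteq> \<zero>\<^bsub>K\<^esub>" and x0: "x0 \<in> C" "ev u x0 \<noteq> \<zero>\<^bsub>K\<^esub>"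
      using u by (auto simp: Fl_def Cl_def)
    have "ev w f0 \<noteq> \<zero>\<^bsub>K\<^esub>" "ev w x0 \<noteq> \<zero>\<^bsub>K\<^esub>"
      using l f0 x0 closed integral by (metis UnCI)+
    then show ?thesis using f0 x0 uwP by (auto simp: Fl_def Cl_def)
  qed
  have F_only: "w \<notin> Cl" if u: "u \<in> Fl" "u \<notin> Cl"
  proof
    assume "w \<in> Cl"
    then obtain x where x: "x \<in> C" "ev w x \<noteq> \<zero>\<^bsub>K\<^esub>" by (auto simp: Cl_def)
    obtain f where f: "f \<in> F" "ev u f \<noteq> \<zero>\<^bsub>K\<^esub>" using u by (auto simp: Fl_def)
    have "ev u x = \<zero>\<^bsub>K\<^esub>" using u x uwP by (auto simp: Cl_def)
    then have "ev u f \<otimes>\<^bsub>K\<^esub> ev w x = \<zero>\<^bsub>K\<^esub>" using eq[OF f(1) x(1)] closed f by auto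
    then show False using integral f x closed by (metis UnCI)
  qed
  have C_only: "w \<notin> Fl" if u: "u \<in> Cl" "u \<notin> Fl"
  proof
    assume "w \<in> Fl"
    then obtain f where f: "f \<in> F" "ev w f \<noteq> \<zero>\<^bsub>K\<^esub>" by (auto simp: Fl_def)
    obtain x where x: "x \<in> C" "ev u x \<noteq> \<zero>\<^bsub>K\<^esub>" using u by (auto simp: Cl_def)
    have "ev u f = \<zero>\<^bsub>K\<^esub>" using u f uwP by (auto simp: Fl_def)
    then have "ev w f \<otimes>\<^bsub>K\<^esub> ev u x = \<zero>\<^bsub>K\<^esub>" using eq[OF f(1) x(1)] closed x by auto
    then show False using integral f x closed by (metis UnCI)
  qed
  show "u \<in> Fl \<longleftrightarrow> w \<in> Fl" "u \<in> Cl \<longleftrightarrow> w \<in> Cl" using both F_only C_only live by blast+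
  show "u \<in> Fl \<inter> Cl \<Longrightarrow>
      \<exists>l\<in>carrier K - {\<zero>\<^bsub>K\<^esub>}. \<forall>y\<in>F \<union> C. ev w y = l \<otimes>\<^bsub>K\<^esub> ev u y"
    by (rule ratio)
qed

text \<open>
  Let \<open>C\<close> be the annihilator of \<open>F\<close>, let \<open>k = dim F\<close>, and let \<open>D\<close> be the set of vertices on which \<open>F\<close> and \<open>C\<close>
  both vanish. The numerator \<open>codim\<close> of the Cheeger quotient is the codimension of \<open>F + C\<close>, whence
  \<open>|D| \<le> codim\<close>. The relation \<open>r\<close> divides the vertices outside \<open>D\<close> into \<open>Fl - Cl\<close>, \<open>Cl - Fl\<close> and classes of
  vertices in \<open>Fl \<inter> Cl\<close> with proportional evaluation functionals. By \<open>live_neighbours\<close> the boundary of a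
  union \<open>X\<close> of classes lies in \<open>D\<close>, so expansion gives \<open>\<epsilon> |X| \<le> codim\<close> as long as \<open>|X| \<le> n / 2\<close>.

  As \<open>k \<le> n / 2\<close>, this settles the claim if \<open>|X| \<ge> n / 4\<close> for some such \<open>X\<close>. Such a set exists if all
  classes have at most \<open>n / 2\<close> elements, unless \<open>D\<close> contains half of the vertices, which is as good.
  There remains the case of a class \<open>B\<close> with more than \<open>n / 2\<close> elements.

  \<^item> If \<open>B\<close> is a class of proportional functionals, one value determines an element of \<open>F + C\<close> on all of
    \<open>B\<close>, and \<open>codim \<ge> |B| - 1 \<ge> k / 2\<close>.
  \<^item> If \<open>B = Fl - Cl\<close>, then \<open>Cl\<close> is a union of classes with less than \<open>n / 2\<close> elements. Either it has at least
    \<open>n / 4\<close> elements, or \<open>dim C < n / 4\<close> and \<open>codim \<ge> n - k - dim C \<ge> n / 4\<close>.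
  \<^item> If \<open>B = Cl - Fl\<close>, then \<open>Fl\<close> is a union of classes with less than \<open>n / 2\<close> elements, and it has at least \<open>k\<close>
    elements because \<open>F\<close> is supported on it.
\<close>

lemma subspace_cheeger_ge:
  fixes \<epsilon> :: real
  assumes eps: "0 < \<epsilon>" "\<epsilon> \<le> 1"
    and expand: "\<And>A. A \<noteq> {} \<Longrightarrow> A \<subseteq> pverts \<Gamma> \<Longrightarrow> real (card A) \<le> real (card (pverts \<Gamma>)) / 2 \<Longrightarrow>
      \<epsilon> * card A \<le> card (graph_boundary \<Gamma> A)"
    and F: "Module.submodule F K V" "0 < lin_dim K V F" "real (lin_dim K V F) \<le> real (card (pverts \<Gamma>)) / 2"
  shows "\<epsilon> / 2 \<le> subspace_cheeger K V W q F"
proof -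
  let ?P = "pverts \<Gamma>"
  define n where "n = card ?P"
  define k where "k = lin_dim K V F"
  define C where "C = annihilator V W q F"
  define Fl where "Fl = {v \<in> ?P. \<exists>f\<in>F. ev v f \<noteq> \<zero>\<^bsub>K\<^esub>}"
  define Cl where "Cl = {v \<in> ?P. \<exists>x\<in>C. ev v x \<noteq> \<zero>\<^bsub>K\<^esub>}"
  define D where "D = ?P - (Fl \<union> Cl)"
  define codim where "codim = real n - real k - real (lin_dim K V C) + real (lin_dim K V (C \<inter> F))"
  define proportional where "proportional u w \<longleftrightarrow>
    (\<exists>l\<in>carrier K - {\<zero>\<^bsub>K\<^esub>}. \<forall>y\<in>F \<union> C. ev w y = l \<otimes>\<^bsub>K\<^esub> ev u y)" for u w
  define r where "r = {(u, w). u \<in> Fl \<union> Cl \<and> w \<in> Fl \<union> Cl \<and> (u \<in> Fl \<longleftrightarrow> w \<in> Fl) \<and> (u \<in> Cl \<longleftrightarrow> w \<in> Cl) \<and>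
    (u \<in> Fl \<inter> Cl \<longrightarrow> proportional u w)}"
  have FV: "F \<subseteq> carrier V" using submoduleD(1)[OF F(1)] .
  have Csub: "Module.submodule C K V" unfolding C_def by (rule submodule_annihilator[OF FV])
  have CV: "C \<subseteq> carrier V" using submoduleD(1)[OF Csub] .
  have k: "0 < k" "real k \<le> real n / 2" using F by (auto simp: k_def n_def)
  have finP: "finite Z" if "Z \<subseteq> ?P" for Z using that finite_pverts finite_subset by blast
  have LP: "Fl \<union> Cl \<subseteq> ?P" by (auto simp: Fl_def Cl_def)
  note finL = finP[OF LP]
  have closed: "ev v y \<in> carrier K" if "v \<in> ?P" "y \<in> F \<union> C" for v y
    using that FV CV ev_closed by blast

  have equiv: "equiv (Fl \<union> Cl) r"
  proof (rule equivI)
    show "r \<subseteq> (Fl \<union> Cl) \<times> (Fl \<union> Cl)" by (auto simp: r_def)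
    have "proportional u u" if "u \<in> Fl \<union> Cl" for u
      unfolding proportional_def using that LP closed by (intro bexI[of _ "\<one>\<^bsub>K\<^esub>"]) auto
    then show "refl_on (Fl \<union> Cl) r" by (auto simp: refl_on_def r_def)
    have "proportional w u" if uw: "u \<in> ?P" "w \<in> ?P" and prop_uw: "proportional u w" for u w
    proof -
      obtain l where l: "l \<in> carrier K" "l \<noteq> \<zero>\<^bsub>K\<^esub>" "\<And>y. y \<in> F \<union> C \<Longrightarrow> ev w y = l \<otimes>\<^bsub>K\<^esub> ev u y"
        using prop_uw unfolding proportional_def by blast
      have unit: "l \<in> Units K" using l by (simp add: field_Units)
      then have "inv\<^bsub>K\<^esub> l \<in> carrier K - {\<zero>\<^bsub>K\<^esub>}"
        using R.Units_inv_Units field_Units by blast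
      moreover have "ev u y = inv\<^bsub>K\<^esub> l \<otimes>\<^bsub>K\<^esub> ev w y" if "y \<in> F \<union> C" for y
        using l(3)[OF that] unit l(1) closed[OF uw(1) that] by (simp flip: R.m_assoc)
      ultimately show ?thesis unfolding proportional_def by blast
    qed
    then show "sym r" using LP by (auto simp: sym_def r_def)
    have "proportional u w" if uv: "proportional u v" and vw: "proportional v w" and u: "u \<in> ?P" for u v w
    proof -
      obtain l where l: "l \<in> carrier K" "l \<noteq> \<zero>\<^bsub>K\<^esub>" "\<And>y. y \<in> F \<union> C \<Longrightarrow> ev v y = l \<otimes>\<^bsub>K\<^esub> ev u y"
        using uv unfolding proportional_def by blast
      obtain m where m: "m \<in> carrier K" "m \<noteq> \<zero>\<^bsub>K\<^esub>" "\<And>y. y \<in> F \<union> C \<Longrightarrow> ev w y = m \<otimes>\<^bsub>K\<^esub> ev v y"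
        using vw unfolding proportional_def by blast
      have "m \<otimes>\<^bsub>K\<^esub> l \<in> carrier K - {\<zero>\<^bsub>K\<^esub>}" using l m integral by blast
      moreover have "ev w y = (m \<otimes>\<^bsub>K\<^esub> l) \<otimes>\<^bsub>K\<^esub> ev u y" if "y \<in> F \<union> C" for y
        using l m that closed[OF u that] by (simp add: R.m_assoc)
      ultimately show ?thesis unfolding proportional_def by blast
    qed
    then show "trans r" using LP by (auto simp: trans_def r_def)
  qed

  have codim_ge: "real n - real (lin_dim K V U) \<le> codim"
    if "Module.submodule U K V" "F \<subseteq> U" "C \<subseteq> U" for U
    using grassmann_le[OF fin_dim F(1) Csub that] unfolding codim_def k_def by linarith

  have D_le: "real (card D) \<le> codim"
  proof -
    have "F \<subseteq> coordinate_subspace (Fl \<union> Cl)" "C \<subseteq> coordinate_subspace (Fl \<union> Cl)"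
      using FV CV by (auto simp: coordinate_subspace_def Fl_def Cl_def)
    then have "real n - real (card (Fl \<union> Cl)) \<le> codim"
      using codim_ge[OF submodule_coordinate_subspace] lin_dim_coordinate_subspace[OF LP] by metis
    moreover have "card D = n - card (Fl \<union> Cl)"
      unfolding D_def n_def using finL LP by (simp add: card_Diff_subset)
    ultimately show ?thesis
      using card_mono[OF finite_pverts LP] by (simp add: n_def)
  qed

  have saturated_le: "\<epsilon> * card X \<le> codim"
    if X: "X \<subseteq> Fl \<union> Cl" "r `` X \<subseteq> X" "real (card X) \<le> real n / 2" for X
  proof (cases "X = {}")
    case True
    then show ?thesis using D_le by simp
  next
    case False
    \<comment> \<open>A live neighbour of a vertex in \<open>X\<close> lies in the same class, hence in \<open>X\<close>.\<close>
    have "graph_boundary \<Gamma> X \<subseteq> D"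
    proof
      fix w assume "w \<in> graph_boundary \<Gamma> X"
      then obtain u where u: "u \<in> X" "(u, w) \<in> parcs \<Gamma>" "w \<in> ?P" "w \<notin> X"
        unfolding graph_boundary_def by blast
      have "(u, w) \<in> r" if "w \<in> Fl \<union> Cl"
      proof -
        have "u \<in> Fl \<union> Cl" using u(1) X(1) by blast
        note live = live_neighbours[OF FV u(2), folded C_def, folded Fl_def Cl_def, OF this that]
        have "u \<in> Fl \<inter> Cl \<longrightarrow> proportional u w"
          unfolding proportional_def using live(3) by (rule impI)
        then show ?thesis
          unfolding r_def using live(1,2) \<open>u \<in> Fl \<union> Cl\<close> that by blast
      qed
      moreover have "(u, w) \<notin> r" using u(1,4) X(2) by blast
      ultimately show "w \<in> D" using u(3) by (auto simp: D_def)
    qed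
    then have "real (card (graph_boundary \<Gamma> X)) \<le> real (card D)"
      using card_mono[of D] finP[of D] by (simp add: D_def)
    moreover have "\<epsilon> * card X \<le> card (graph_boundary \<Gamma> X)"
      using expand[OF False] X LP unfolding n_def by blast
    ultimately show ?thesis using D_le by linarith
  qed
  have quarter: "\<epsilon> / 2 * k \<le> codim" if "real n / 4 \<le> x" "\<epsilon> * x \<le> codim" for x
  proof -
    have "\<epsilon> / 2 * k \<le> \<epsilon> / 2 * (real n / 2)" using k eps by (intro mult_left_mono) auto
    also have "\<dots> = \<epsilon> * (real n / 4)" by simp
    also have "\<dots> \<le> \<epsilon> * x" using that eps by (intro mult_left_mono) auto
    finally show ?thesis using that by simp
  qed
  have half: "\<epsilon> / 2 * k \<le> codim" if "real k / 2 \<le> codim"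
  proof -
    have "\<epsilon> / 2 * k \<le> 1 / 2 * real k" using eps by (intro mult_right_mono) auto
    then show ?thesis using that by simp
  qed

  have "\<epsilon> / 2 * k \<le> codim"
  proof (cases "\<exists>u\<in>Fl \<union> Cl. card (r `` {u}) > real n / 2")
    case False
    then obtain X where X: "X \<subseteq> Fl \<union> Cl" "r `` X \<subseteq> X" "card X \<le> real n / 2"
      "X = Fl \<union> Cl \<or> real n / 4 \<le> card X"
      using saturated_set_of_medium_size[OF finL equiv, of "real n"] by (metis not_less of_nat_0_le_iff)
    from X(4) show ?thesis
    proof
      assume "real n / 4 \<le> card X"
      then show ?thesis using saturated_le[OF X(1-3)] by (rule quarter)
    next
      assume "X = Fl \<union> Cl"
      then have "real n \<le> real (card D) + real n / 2"
        using X(3) finL LP card_mono[OF finite_pverts LP] unfolding D_def n_def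
        by (simp add: card_Diff_subset)
      then show ?thesis using D_le k half by linarith
    qed
  next
    case True
    then obtain u where u: "u \<in> Fl \<union> Cl" and big: "card (r `` {u}) > real n / 2" by blast
    let ?B = "r `` {u}"
    have BP: "?B \<subseteq> ?P" using LP by (auto simp: r_def)
    have rest: "card Z < real n / 2" if "Z \<subseteq> ?P" "Z \<inter> ?B = {}" for Z
    proof -
      have "card Z + card ?B \<le> n"
        using that card_mono[OF finite_pverts, of "Z \<union> ?B"] BP finP[OF BP] finP[OF that(1)]
        unfolding n_def by (simp add: card_Un_disjoint)
      then show ?thesis using big by linarith
    qed
    consider "u \<in> Fl \<inter> Cl" | "u \<in> Fl - Cl" | "u \<in> Cl - Fl" using u by blast
    then show ?thesis
    proof cases
      case 1
      \<comment> \<open>Quantifying over all factors \<open>l\<close> avoids choosing one for every \<open>w\<close>.\<close>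
      define U where "U = {y \<in> carrier V. \<forall>w\<in>?B. \<forall>l\<in>carrier K.
        (\<forall>z\<in>F \<union> C. ev w z = l \<otimes>\<^bsub>K\<^esub> ev u z) \<longrightarrow> ev w y = l \<otimes>\<^bsub>K\<^esub> ev u y}"
      have uP: "u \<in> ?P" and uB: "u \<in> ?B" using u LP equiv_class_self[OF equiv u] by auto
      have U: "Module.submodule U K V"
      proof (rule submoduleI)
        show "U \<subseteq> carrier V" by (auto simp: U_def)
        show "\<zero>\<^bsub>V\<^esub> \<in> U" using BP uP by (auto simp: U_def ev_zero subset_iff)
        show "x \<oplus>\<^bsub>V\<^esub> y \<in> U" if "x \<in> U" "y \<in> U" for x y
          unfolding U_def
        proof (intro CollectI conjI ballI impI)
          show "x \<oplus>\<^bsub>V\<^esub> y \<in> carrier V" using that by (auto simp: U_def)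
          fix w l assume w: "w \<in> ?B" and l: "l \<in> carrier K" and *: "\<forall>z\<in>F \<union> C. ev w z = l \<otimes>\<^bsub>K\<^esub> ev u z"
          have "w \<in> ?P" "x \<in> carrier V" "y \<in> carrier V" using w BP that by (auto simp: U_def)
          moreover have "ev w x = l \<otimes>\<^bsub>K\<^esub> ev u x" "ev w y = l \<otimes>\<^bsub>K\<^esub> ev u y"
            using that w l * unfolding U_def by blast+
          ultimately show "ev w (x \<oplus>\<^bsub>V\<^esub> y) = l \<otimes>\<^bsub>K\<^esub> ev u (x \<oplus>\<^bsub>V\<^esub> y)"
            using uP l by (simp add: ev_add ev_closed R.r_distr)
        qed
        show "a \<odot>\<^bsub>V\<^esub> x \<in> U" if "a \<in> carrier K" "x \<in> U" for a x
          unfolding U_def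
        proof (intro CollectI conjI ballI impI)
          show "a \<odot>\<^bsub>V\<^esub> x \<in> carrier V" using that by (auto simp: U_def)
          fix w l assume w: "w \<in> ?B" and l: "l \<in> carrier K" and *: "\<forall>z\<in>F \<union> C. ev w z = l \<otimes>\<^bsub>K\<^esub> ev u z"
          have "w \<in> ?P" "x \<in> carrier V" using w BP that by (auto simp: U_def)
          moreover have "ev w x = l \<otimes>\<^bsub>K\<^esub> ev u x"
            using that w l * unfolding U_def by blast
          ultimately show "ev w (a \<odot>\<^bsub>V\<^esub> x) = l \<otimes>\<^bsub>K\<^esub> ev u (a \<odot>\<^bsub>V\<^esub> x)"
            using uP l that(1) by (simp add: ev_smult ev_closed R.m_lcomm)
        qed
      qed
      have "lin_dim K V U \<le> card (insert u (?P - ?B))"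
      proof (rule lin_dim_le_determining_set[OF U])
        fix x w assume x: "x \<in> U" "\<And>v. v \<in> insert u (?P - ?B) \<Longrightarrow> ev v x = \<zero>\<^bsub>K\<^esub>"
          and w: "w \<in> ?P - insert u (?P - ?B)"
        have "proportional u w" using w 1 by (auto simp: r_def)
        then obtain l where "l \<in> carrier K" "ev w x = l \<otimes>\<^bsub>K\<^esub> ev u x"
          using w x(1) unfolding proportional_def U_def by blast
        then show "ev w x = \<zero>\<^bsub>K\<^esub>" using x(2)[of u] by simp
      qed (use uP in auto)
      also have "\<dots> = Suc (n - card ?B)"
        unfolding n_def using uB finite_pverts finP[OF BP] BP by (simp add: card_Diff_subset)
      finally have "real (lin_dim K V U) \<le> 1 + real n - card ?B"
        using card_mono[OF finite_pverts BP] by (simp add: n_def)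
      moreover have "F \<subseteq> U" "C \<subseteq> U" using FV CV by (auto simp: U_def)
      ultimately have "real (card ?B) - 1 \<le> codim" using codim_ge[OF U] by linarith
      moreover have "2 \<le> card ?B" using big k by linarith
      ultimately show ?thesis using big k by (intro half) linarith
    next
      case 2
      then have B: "?B = Fl - Cl" by (auto simp: r_def)
      have CP: "Cl \<subseteq> ?P" using LP by blast
      have sat: "r `` Cl \<subseteq> Cl" by (auto simp: r_def)
      have small: "card Cl < real n / 2" using rest[OF CP] B by blast
      show ?thesis
      proof (cases "real n / 4 \<le> card Cl")
        case True
        then show ?thesis using saturated_le[of Cl] sat small by (intro quarter) auto
      next
        case False
        have "C \<subseteq> coordinate_subspace Cl" using CV by (auto simp: coordinate_subspace_def Cl_def)
        then have "lin_dim K V C \<le> card Cl"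
          using lin_dim_mono[OF fin_dim Csub submodule_coordinate_subspace]
            lin_dim_coordinate_subspace[OF CP] by metis
        then have "real k / 2 \<le> codim" using False k unfolding codim_def by linarith
        then show ?thesis by (rule half)
      qed
    next
      case 3
      then have B: "?B = Cl - Fl" by (auto simp: r_def)
      have FP: "Fl \<subseteq> ?P" using LP by blast
      have sat: "r `` Fl \<subseteq> Fl" by (auto simp: r_def)
      have "card Fl < real n / 2" using rest[OF FP] B by blast
      then have "\<epsilon> * card Fl \<le> codim" using saturated_le[of Fl] sat by simp
      moreover have "F \<subseteq> coordinate_subspace Fl" using FV by (auto simp: coordinate_subspace_def Fl_def)
      then have "k \<le> card Fl"
        using lin_dim_mono[OF fin_dim F(1) submodule_coordinate_subspace]
          lin_dim_coordinate_subspace[OF FP] unfolding k_def by metis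
      then have "\<epsilon> / 2 * k \<le> \<epsilon> * card Fl" using eps by (intro mult_mono) auto
      ultimately show ?thesis by linarith
    qed
  qed
  then have "\<epsilon> / 2 \<le> codim / k" using k by (simp add: le_divide_eq)
  then show ?thesis
    unfolding subspace_cheeger_def Let_def codim_def C_def[symmetric] lin_dim_carrier n_def k_def .
qed

lemma vs_cheeger_ge:
  assumes eps: "0 < \<epsilon>" "\<epsilon> \<le> 1" and graph_cheeger: "ereal \<epsilon> \<le> graph_cheeger \<Gamma>"
  shows "ereal (\<epsilon> / 2) \<le> vs_cheeger K V W q"
  unfolding vs_cheeger_def
proof (rule INF_greatest)
  fix F assume F: "F \<in> {F. Module.submodule F K V \<and> 0 < lin_dim K V F \<and>
    real (lin_dim K V F) \<le> real (lin_dim K V (carrier V)) / 2}"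
  have expand: "\<epsilon> * card A \<le> card (graph_boundary \<Gamma> A)"
    if A: "A \<noteq> {}" "A \<subseteq> pverts \<Gamma>" "real (card A) \<le> real (card (pverts \<Gamma>)) / 2" for A
  proof -
    have "ereal \<epsilon> \<le> ereal (real (card (graph_boundary \<Gamma> A)) / real (card A))"
      using graph_cheeger A unfolding graph_cheeger_def le_INF_iff by blast
    moreover have "0 < card A" using A finite_subset[OF A(2) finite_pverts] by (simp add: card_gt_0_iff)
    ultimately show ?thesis by (simp add: le_divide_eq)
  qed
  show "ereal (\<epsilon> / 2) \<le> ereal (subspace_cheeger K V W q F)"
    using subspace_cheeger_ge[OF eps expand] F by (auto simp: lin_dim_carrier)
qed

end

section \<open>Quotient modules\<close>

locale quotient_by_submodule = Module.module R M for R and M (structure) +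
  fixes N
  assumes N: "Module.submodule N R M"
begin

abbreviation "cls x \<equiv> N +>\<^bsub>M\<^esub> x"
abbreviation "Q \<equiv> quotient_module M N"

sublocale N: abelian_subgroup N M
  using N M.abelian_group_axioms unfolding Module.submodule_def
  by (intro abelian_subgroupI3) (auto simp: additive_subgroup_def)

lemma class_in: "x \<in> carrier M \<Longrightarrow> cls x \<in> carrier Q"
  using a_rcosetsI[OF N.a_subset] by (simp add: quotient_module_def)

lemma class_cases:
  assumes "X \<in> carrier Q"
  obtains x where "x \<in> carrier M" "X = cls x"
  using assms unfolding quotient_module_def A_RCOSETS_def' by auto

lemma class_zero: "\<zero>\<^bsub>Q\<^esub> = N"
  by (simp add: quotient_module_def)

lemma class_eq_zero_iff: "x \<in> carrier M \<Longrightarrow> cls x = \<zero>\<^bsub>Q\<^esub> \<longleftrightarrow> x \<in> N"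
  unfolding class_zero using N.a_rcos_self N.a_rcos_const by metis

lemma class_add:
  "x \<in> carrier M \<Longrightarrow> y \<in> carrier M \<Longrightarrow> cls x \<oplus>\<^bsub>Q\<^esub> cls y = cls (x \<oplus>\<^bsub>M\<^esub> y)"
  using N.a_rcos_sum by (simp add: quotient_module_def)

text \<open>
  Scalar multiplication of cosets is a union over representatives, all of which contribute the same
  coset.
\<close>

lemma class_smult:
  assumes a: "a \<in> carrier R" and x: "x \<in> carrier M"
  shows "a \<odot>\<^bsub>Q\<^esub> cls x = cls (a \<odot>\<^bsub>M\<^esub> x)"
proof -
  have "cls (a \<odot>\<^bsub>M\<^esub> y) = cls (a \<odot>\<^bsub>M\<^esub> x)" if y: "y \<in> cls x" for y
  proof -
    obtain h where h: "h \<in> N" "y = h \<oplus>\<^bsub>M\<^esub> x" using y unfolding a_r_coset_def' by auto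
    have "h \<in> carrier M" using h(1) N.a_subset by auto
    then have "a \<odot>\<^bsub>M\<^esub> y = a \<odot>\<^bsub>M\<^esub> h \<oplus>\<^bsub>M\<^esub> a \<odot>\<^bsub>M\<^esub> x" using h a x by (simp add: smult_r_distr)
    then have "a \<odot>\<^bsub>M\<^esub> y \<in> cls (a \<odot>\<^bsub>M\<^esub> x)"
      using submoduleD(4)[OF N a h(1)] unfolding a_r_coset_def' by auto
    then show ?thesis by (rule N.a_repr_independence'[symmetric]) (use a x in simp)
  qed
  moreover have "cls x \<noteq> {}" using N.a_rcos_self[OF x] by (rule ex_in_conv[THEN iffD1, OF exI])
  ultimately have "(\<Union>y\<in>cls x. cls (a \<odot>\<^bsub>M\<^esub> y)) = cls (a \<odot>\<^bsub>M\<^esub> x)"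
    by (intro SUP_eq_const)
  then show ?thesis by (simp add: quotient_module_def)
qed

lemma quotient_module: "Module.module R Q"
proof (rule moduleI)
  show "cring R" by (rule R.cring_axioms)
  show "abelian_group Q"
  proof (rule abelian_groupI)
    fix X Y assume "X \<in> carrier Q" "Y \<in> carrier Q"
    then obtain x y where [simp]: "x \<in> carrier M" "y \<in> carrier M" and XY: "X = cls x" "Y = cls y"
      by (metis class_cases)
    show "X \<oplus>\<^bsub>Q\<^esub> Y \<in> carrier Q" by (simp add: XY class_add class_in)
    show "X \<oplus>\<^bsub>Q\<^esub> Y = Y \<oplus>\<^bsub>Q\<^esub> X" by (simp add: XY class_add M.a_comm)
    fix Z assume "Z \<in> carrier Q"
    then obtain z where "z \<in> carrier M" "Z = cls z" by (rule class_cases)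
    then show "X \<oplus>\<^bsub>Q\<^esub> Y \<oplus>\<^bsub>Q\<^esub> Z = X \<oplus>\<^bsub>Q\<^esub> (Y \<oplus>\<^bsub>Q\<^esub> Z)" by (simp add: XY class_add M.a_assoc)
  next
    have zero: "\<zero>\<^bsub>Q\<^esub> = cls \<zero>\<^bsub>M\<^esub>" using class_eq_zero_iff[of "\<zero>\<^bsub>M\<^esub>"] N.zero_closed by simp
    show "\<zero>\<^bsub>Q\<^esub> \<in> carrier Q" unfolding zero by (rule class_in) simp
    fix X assume "X \<in> carrier Q"
    then obtain x where x: "x \<in> carrier M" "X = cls x" by (rule class_cases)
    show "\<zero>\<^bsub>Q\<^esub> \<oplus>\<^bsub>Q\<^esub> X = X" using x by (simp add: zero class_add)
    have "cls (\<ominus>\<^bsub>M\<^esub> x) \<oplus>\<^bsub>Q\<^esub> X = \<zero>\<^bsub>Q\<^esub>" using x by (simp add: zero class_add M.l_neg)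
    then show "\<exists>Y\<in>carrier Q. Y \<oplus>\<^bsub>Q\<^esub> X = \<zero>\<^bsub>Q\<^esub>" using x class_in by blast
  qed
  fix a X assume a: "a \<in> carrier R" and "X \<in> carrier Q"
  then obtain x where x: "x \<in> carrier M" "X = cls x" by (metis class_cases)
  show "a \<odot>\<^bsub>Q\<^esub> X \<in> carrier Q" using a x by (simp add: class_smult class_in)
  {
    fix b assume b: "b \<in> carrier R"
    show "(a \<oplus>\<^bsub>R\<^esub> b) \<odot>\<^bsub>Q\<^esub> X = a \<odot>\<^bsub>Q\<^esub> X \<oplus>\<^bsub>Q\<^esub> b \<odot>\<^bsub>Q\<^esub> X"
      using a b x by (simp add: class_smult class_add smult_l_distr)
    show "(a \<otimes>\<^bsub>R\<^esub> b) \<odot>\<^bsub>Q\<^esub> X = a \<odot>\<^bsub>Q\<^esub> (b \<odot>\<^bsub>Q\<^esub> X)"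
      using a b x by (simp add: class_smult smult_assoc1)
  }
  fix Y assume "Y \<in> carrier Q"
  then obtain y where "y \<in> carrier M" "Y = cls y" by (rule class_cases)
  then show "a \<odot>\<^bsub>Q\<^esub> (X \<oplus>\<^bsub>Q\<^esub> Y) = a \<odot>\<^bsub>Q\<^esub> X \<oplus>\<^bsub>Q\<^esub> a \<odot>\<^bsub>Q\<^esub> Y"
    using a x by (simp add: class_smult class_add smult_r_distr)
next
  fix X assume "X \<in> carrier Q"
  then obtain x where "x \<in> carrier M" "X = cls x" by (rule class_cases)
  then show "\<one>\<^bsub>R\<^esub> \<odot>\<^bsub>Q\<^esub> X = X" by (simp add: class_smult)
qed

end

section \<open>Group cohomology in degrees one and two\<close>

text \<open>
  The bar complex involves only products in \<open>G\<close>; a presented group can be used as soon as it is known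
  to be a monoid.
\<close>

locale bar_complex = L: cring L + G: monoid G for L :: "('l, 'm) ring_scheme" (structure)
  and G :: "('g, 'n) monoid_scheme"
begin

lemma cochain_closed: "f \<in> carrier (cochains L G n) \<Longrightarrow> xs \<in> tuples G n \<Longrightarrow> f xs \<in> carrier L"
  by (auto simp: cochains_def)

lemma cochain_eqI:
  "f \<in> carrier (cochains L G n) \<Longrightarrow> g \<in> carrier (cochains L G n) \<Longrightarrow>
    (\<And>xs. xs \<in> tuples G n \<Longrightarrow> f xs = g xs) \<Longrightarrow> f = g"
  unfolding cochains_def by (auto intro: PiE_ext)

lemma cochain_add_apply: "xs \<in> tuples G n \<Longrightarrow> (f \<oplus>\<^bsub>cochains L G n\<^esub> g) xs = f xs \<oplus> g xs"
  by (simp add: cochains_def)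

lemma cochain_smult_apply: "xs \<in> tuples G n \<Longrightarrow> (a \<odot>\<^bsub>cochains L G n\<^esub> f) xs = a \<otimes> f xs"
  by (simp add: cochains_def)

lemma cochain_zero_apply: "xs \<in> tuples G n \<Longrightarrow> \<zero>\<^bsub>cochains L G n\<^esub> xs = \<zero>"
  by (simp add: cochains_def)

lemma cochain_add_closed:
  "f \<in> carrier (cochains L G n) \<Longrightarrow> g \<in> carrier (cochains L G n) \<Longrightarrow>
    f \<oplus>\<^bsub>cochains L G n\<^esub> g \<in> carrier (cochains L G n)"
  by (auto simp: cochains_def)

lemma cochain_smult_closed:
  "a \<in> carrier L \<Longrightarrow> f \<in> carrier (cochains L G n) \<Longrightarrow> a \<odot>\<^bsub>cochains L G n\<^esub> f \<in> carrier (cochains L G n)"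
  by (auto simp: cochains_def)

lemma cochain_zero_closed: "\<zero>\<^bsub>cochains L G n\<^esub> \<in> carrier (cochains L G n)"
  by (auto simp: cochains_def)

lemmas cochain_simps = cochain_closed cochain_add_apply cochain_smult_apply cochain_zero_apply
  cochain_add_closed cochain_smult_closed cochain_zero_closed

lemma module_cochains: "Module.module L (cochains L G n)"
proof (rule moduleI)
  show "cring L" by (rule L.cring_axioms)
  show "abelian_group (cochains L G n)"
  proof (rule abelian_groupI)
    fix f assume f: "f \<in> carrier (cochains L G n)"
    have neg: "(\<ominus> \<one>) \<odot>\<^bsub>cochains L G n\<^esub> f \<in> carrier (cochains L G n)"
      using f by (simp add: cochain_simps)
    have "(\<ominus> \<one>) \<odot>\<^bsub>cochains L G n\<^esub> f \<oplus>\<^bsub>cochains L G n\<^esub> f = \<zero>\<^bsub>cochains L G n\<^esub>"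
      by (rule cochain_eqI[of _ n])
        (use f in \<open>simp_all add: cochain_simps L.l_minus L.l_neg\<close>)
    then show "\<exists>g\<in>carrier (cochains L G n). g \<oplus>\<^bsub>cochains L G n\<^esub> f = \<zero>\<^bsub>cochains L G n\<^esub>"
      using neg by blast
  qed (rule cochain_eqI[of _ n]; simp add: cochain_simps L.a_ac | simp add: cochain_simps)+
qed (rule cochain_eqI[of _ n]; simp add: cochain_simps L.l_distr L.r_distr L.m_assoc | simp add: cochain_simps)+

lemma face_in_tuples:
  assumes "xs \<in> tuples G (Suc n)"
  shows "tl xs \<in> tuples G n" "butlast xs \<in> tuples G n"
    and "i \<in> {1..n} \<Longrightarrow> take (i - 1) xs @ [xs ! (i - 1) \<otimes>\<^bsub>G\<^esub> xs ! i] @ drop (i + 1) xs \<in> tuples G n"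
proof -
  have xs: "length xs = Suc n" "set xs \<subseteq> carrier G" using assms by (auto simp: tuples_def)
  then show "tl xs \<in> tuples G n" "butlast xs \<in> tuples G n"
    by (auto simp: tuples_def dest: in_set_butlastD list.set_sel(2)[rotated])
  assume i: "i \<in> {1..n}"
  have "xs ! (i - 1) \<in> carrier G" "xs ! i \<in> carrier G" using xs i by (auto intro!: subsetD[OF xs(2)])
  then show "take (i - 1) xs @ [xs ! (i - 1) \<otimes>\<^bsub>G\<^esub> xs ! i] @ drop (i + 1) xs \<in> tuples G n"
    using xs i by (auto simp: tuples_def dest!: in_set_takeD in_set_dropD)
qed

text \<open>
  Linearity is stated as a module homomorphism, so that cocycles and coboundaries inherit the structure
  of a submodule as its kernel and image.
\<close>

lemma coboundary_map_linear:
  "mod_hom L (cochains L G n) (cochains L G (Suc n)) (coboundary_map L G n)"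
proof -
  let ?C = "cochains L G n" and ?D = "cochains L G (Suc n)" and ?d = "coboundary_map L G n"
  let ?s = "\<lambda>i::nat. (\<ominus> \<one>) [^]\<^bsub>L\<^esub> i"
  let ?face = "\<lambda>i xs. take (i - 1) xs @ [xs ! (i - 1) \<otimes>\<^bsub>G\<^esub> xs ! i] @ drop (i + 1) xs"
  have d: "?d f xs = f (tl xs) \<oplus> (\<Oplus>i\<in>{1..n}. ?s i \<otimes> f (?face i xs)) \<oplus> ?s (Suc n) \<otimes> f (butlast xs)"
    if "xs \<in> tuples G (Suc n)" for f xs
    using that by (simp add: coboundary_map_def)
  have s: "?s i \<in> carrier L" for i by simp
  have d_closed: "?d f \<in> carrier ?D" if "f \<in> carrier ?C" for f
  proof -
    have "?d f xs \<in> carrier L" if xs: "xs \<in> tuples G (Suc n)" for xs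
      unfolding d[OF xs] using face_in_tuples[OF xs] cochain_closed[OF \<open>f \<in> carrier ?C\<close>] s
      by (intro L.a_closed L.m_closed L.finsum_closed) (auto simp del: append.simps)
    then show ?thesis by (auto simp: cochains_def coboundary_map_def)
  qed
  have d_add: "?d (f \<oplus>\<^bsub>?C\<^esub> g) = ?d f \<oplus>\<^bsub>?D\<^esub> ?d g" if f: "f \<in> carrier ?C" and g: "g \<in> carrier ?C" for f g
  proof (rule cochain_eqI[of _ "Suc n"])
    fix xs assume xs: "xs \<in> tuples G (Suc n)"
    note face = face_in_tuples[OF xs]
    note cl = cochain_closed[OF f] cochain_closed[OF g]
    have "(\<Oplus>i\<in>{1..n}. ?s i \<otimes> (f \<oplus>\<^bsub>?C\<^esub> g) (?face i xs)) =
        (\<Oplus>i\<in>{1..n}. ?s i \<otimes> f (?face i xs) \<oplus> ?s i \<otimes> g (?face i xs))"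
      using face cl s by (intro L.finsum_cong') (auto simp: cochain_add_apply L.r_distr simp del: append.simps)
    also have "\<dots> = (\<Oplus>i\<in>{1..n}. ?s i \<otimes> f (?face i xs)) \<oplus> (\<Oplus>i\<in>{1..n}. ?s i \<otimes> g (?face i xs))"
      using face cl s by (intro L.finsum_addf) (auto simp del: append.simps)
    finally have sum: "(\<Oplus>i\<in>{1..n}. ?s i \<otimes> (f \<oplus>\<^bsub>?C\<^esub> g) (?face i xs)) = \<dots>" .
    have sums: "(\<Oplus>i\<in>{1..n}. ?s i \<otimes> f (?face i xs)) \<in> carrier L" "(\<Oplus>i\<in>{1..n}. ?s i \<otimes> g (?face i xs)) \<in> carrier L"
      using face cl s by (auto intro!: L.finsum_closed simp del: append.simps)
    show "?d (f \<oplus>\<^bsub>?C\<^esub> g) xs = (?d f \<oplus>\<^bsub>?D\<^esub> ?d g) xs"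
      unfolding cochain_add_apply[OF xs] d[OF xs] sum
      using face(1,2) cl s[of "Suc n"] sums
      by (simp add: cochain_add_apply L.r_distr L.a_ac del: L.nat_pow_Suc)
  qed (use f g in \<open>simp_all add: cochain_simps d_closed\<close>)
  have d_smult: "?d (a \<odot>\<^bsub>?C\<^esub> f) = a \<odot>\<^bsub>?D\<^esub> ?d f" if a: "a \<in> carrier L" and f: "f \<in> carrier ?C" for a f
  proof (rule cochain_eqI[of _ "Suc n"])
    fix xs assume xs: "xs \<in> tuples G (Suc n)"
    note face = face_in_tuples[OF xs]
    note cl = cochain_closed[OF f]
    have "(\<Oplus>i\<in>{1..n}. ?s i \<otimes> (a \<odot>\<^bsub>?C\<^esub> f) (?face i xs)) = (\<Oplus>i\<in>{1..n}. a \<otimes> (?s i \<otimes> f (?face i xs)))"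
      using face cl s a by (intro L.finsum_cong') (auto simp: cochain_smult_apply L.m_lcomm simp del: append.simps)
    also have "\<dots> = a \<otimes> (\<Oplus>i\<in>{1..n}. ?s i \<otimes> f (?face i xs))"
      using face cl s a by (intro L.finsum_rdistr[symmetric]) (auto simp del: append.simps)
    finally have sum: "(\<Oplus>i\<in>{1..n}. ?s i \<otimes> (a \<odot>\<^bsub>?C\<^esub> f) (?face i xs)) = \<dots>" .
    have sums: "(\<Oplus>i\<in>{1..n}. ?s i \<otimes> f (?face i xs)) \<in> carrier L"
      using face cl s by (auto intro!: L.finsum_closed simp del: append.simps)
    show "?d (a \<odot>\<^bsub>?C\<^esub> f) xs = (a \<odot>\<^bsub>?D\<^esub> ?d f) xs"
      unfolding cochain_smult_apply[OF xs] d[OF xs] sum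
      using face(1,2) cl s[of "Suc n"] sums a
      by (simp add: cochain_smult_apply L.r_distr L.m_lcomm del: L.nat_pow_Suc)
  qed (use a f in \<open>simp_all add: cochain_simps d_closed\<close>)
  show ?thesis
    by (intro mod_hom.intro mod_hom_axioms.intro module_cochains)
      (use d_closed d_add d_smult in \<open>auto simp: module_hom_def\<close>)
qed

lemma submodule_cocycles: "Module.submodule (cocycles L G n) L (cochains L G n)"
proof -
  interpret d: mod_hom L "cochains L G n" "cochains L G (Suc n)" "coboundary_map L G n"
    by (rule coboundary_map_linear)
  have "cocycles L G n = d.ker" unfolding cocycles_def d.ker_def by simp
  then show ?thesis using d.ker_is_submodule module.submodule_iff[OF module_cochains] by simp
qed

lemma submodule_coboundaries: "Module.submodule (coboundaries L G (Suc n)) L (cochains L G (Suc n))"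
proof -
  interpret d: mod_hom L "cochains L G n" "cochains L G (Suc n)" "coboundary_map L G n"
    by (rule coboundary_map_linear)
  have "coboundaries L G (Suc n) = d.im" unfolding coboundaries_def d.im_def by simp
  then show ?thesis using d.im_is_submodule module.submodule_iff[OF module_cochains] by simp
qed

lemma tuples_small:
  "tuples G 0 = {[]}" "tuples G (Suc 0) = {[a] |a. a \<in> carrier G}"
  "tuples G 2 = {[a, b] |a b. a \<in> carrier G \<and> b \<in> carrier G}"
  "tuples G 3 = {[a, b, c] |a b c. a \<in> carrier G \<and> b \<in> carrier G \<and> c \<in> carrier G}"
  by (auto simp: tuples_def length_Suc_conv numeral_2_eq_2 numeral_3_eq_3)

lemma coboundary_0:
  assumes "f \<in> carrier (cochains L G 0)"
  shows "coboundary_map L G 0 f = \<zero>\<^bsub>cochains L G (Suc 0)\<^esub>"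
proof -
  have "f [] \<in> carrier L" using assms by (auto simp: cochains_def tuples_small)
  then show ?thesis
    by (auto simp: coboundary_map_def cochains_def tuples_small L.l_minus L.r_neg intro!: restrict_ext)
qed

lemma coboundary_1:
  assumes "f \<in> carrier (cochains L G (Suc 0))" "a \<in> carrier G" "b \<in> carrier G"
  shows "coboundary_map L G (Suc 0) f [a, b] = f [b] \<ominus> f [a \<otimes>\<^bsub>G\<^esub> b] \<oplus> f [a]"
proof -
  have "f [x] \<in> carrier L" if "x \<in> carrier G" for x
    using assms(1) that by (auto simp: cochains_def tuples_small)
  then have c: "f [a] \<in> carrier L" "f [b] \<in> carrier L" "f [a \<otimes>\<^bsub>G\<^esub> b] \<in> carrier L" using assms by auto
  have "[a, b] \<in> tuples G (Suc (Suc 0))" using assms by (auto simp: tuples_def)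
  then show ?thesis using c
    by (simp add: coboundary_map_def L.l_minus L.r_minus L.minus_minus a_minus_def)
qed

lemma coboundary_2:
  assumes "f \<in> carrier (cochains L G 2)" "a \<in> carrier G" "b \<in> carrier G" "c \<in> carrier G"
  shows "coboundary_map L G 2 f [a, b, c] =
    f [b, c] \<ominus> f [a \<otimes>\<^bsub>G\<^esub> b, c] \<oplus> f [a, b \<otimes>\<^bsub>G\<^esub> c] \<ominus> f [a, b]"
proof -
  have "f [x, y] \<in> carrier L" if "x \<in> carrier G" "y \<in> carrier G" for x y
    using assms(1) that by (auto simp: cochains_def tuples_small)
  then have c: "f [a, b] \<in> carrier L" "f [b, c] \<in> carrier L" "f [a \<otimes>\<^bsub>G\<^esub> b, c] \<in> carrier L"
    "f [a, b \<otimes>\<^bsub>G\<^esub> c] \<in> carrier L" using assms by auto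
  have t: "[a, b, c] \<in> tuples G (Suc 2)" using assms by (auto simp: tuples_def)
  have range: "{1..2::nat} = {1, 2}" by auto
  have powers: "(\<ominus> \<one>) [^]\<^bsub>L\<^esub> (1::nat) = \<ominus> \<one>" "(\<ominus> \<one>) [^]\<^bsub>L\<^esub> (2::nat) = \<one>" "(\<ominus> \<one>) [^]\<^bsub>L\<^esub> Suc 2 = \<ominus> \<one>"
    by (simp_all add: numeral_2_eq_2 L.l_minus L.r_minus)
  show ?thesis
    unfolding coboundary_map_def restrict_apply'[OF t] range powers(3)
    using c by (simp add: powers numeral_2_eq_2 L.l_minus a_minus_def L.a_ac)
qed

lemma minus_eq_zero_iff: "x \<in> carrier L \<Longrightarrow> y \<in> carrier L \<Longrightarrow> x \<ominus> y = \<zero> \<longleftrightarrow> x = y"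
  unfolding a_minus_def
  using L.minus_equality[of x "\<ominus> y"] L.r_neg[of y] L.minus_minus[of y] L.a_inv_closed[of y] by auto

lemma cocycles_1_iff:
  "f \<in> cocycles L G (Suc 0) \<longleftrightarrow> f \<in> carrier (cochains L G (Suc 0)) \<and>
    (\<forall>a\<in>carrier G. \<forall>b\<in>carrier G. f [a \<otimes>\<^bsub>G\<^esub> b] = f [a] \<oplus> f [b])"
proof (cases "f \<in> carrier (cochains L G (Suc 0))")
  case f: True
  have cl: "f [x] \<in> carrier L" if "x \<in> carrier G" for x
    using f that by (auto simp: cochains_def tuples_small)
  interpret d: mod_hom L "cochains L G (Suc 0)" "cochains L G (Suc (Suc 0))" "coboundary_map L G (Suc 0)"
    by (rule coboundary_map_linear)
  have df: "coboundary_map L G (Suc 0) f \<in> carrier (cochains L G 2)"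
    using d.f_im[OF f] by (simp add: numeral_2_eq_2)
  have "coboundary_map L G (Suc 0) f = \<zero>\<^bsub>cochains L G 2\<^esub> \<longleftrightarrow>
      (\<forall>a\<in>carrier G. \<forall>b\<in>carrier G. coboundary_map L G (Suc 0) f [a, b] = \<zero>)" (is "?z \<longleftrightarrow> ?e")
  proof
    assume ?z
    then show ?e using cochain_zero_apply[of _ 2] by (auto simp: tuples_small)
  next
    assume ?e
    then show ?z by (intro cochain_eqI[OF df cochain_zero_closed]) (auto simp: cochain_zero_apply tuples_small)
  qed
  also have "\<dots> \<longleftrightarrow> (\<forall>a\<in>carrier G. \<forall>b\<in>carrier G. f [a \<otimes>\<^bsub>G\<^esub> b] = f [a] \<oplus> f [b])"
  proof (intro ball_cong[OF HOL.refl])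
    fix a b assume ab: "a \<in> carrier G" "b \<in> carrier G"
    have c: "f [a] \<in> carrier L" "f [b] \<in> carrier L" "f [a \<otimes>\<^bsub>G\<^esub> b] \<in> carrier L" using ab cl by auto
    have "f [b] \<ominus> f [a \<otimes>\<^bsub>G\<^esub> b] \<oplus> f [a] = (f [a] \<oplus> f [b]) \<ominus> f [a \<otimes>\<^bsub>G\<^esub> b]"
      using c by (simp add: a_minus_def L.a_ac)
    then show "coboundary_map L G (Suc 0) f [a, b] = \<zero> \<longleftrightarrow> f [a \<otimes>\<^bsub>G\<^esub> b] = f [a] \<oplus> f [b]"
      unfolding coboundary_1[OF f ab] using c by (simp add: minus_eq_zero_iff) metis
  qed
  finally show ?thesis using f by (simp add: cocycles_def numeral_2_eq_2)
qed (simp add: cocycles_def)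

lemma quotient_cohomology:
  assumes "coboundaries L G (Suc n) \<subseteq> cocycles L G (Suc n)"
  shows "quotient_by_submodule L ((cochains L G (Suc n))\<lparr>carrier := cocycles L G (Suc n)\<rparr>)
    (coboundaries L G (Suc n))"
proof -
  let ?Z = "(cochains L G (Suc n))\<lparr>carrier := cocycles L G (Suc n)\<rparr>"
  have Z: "Module.module L ?Z"
    using submodule.submodule_is_module[OF submodule_cocycles module_cochains] by blast
  have "Module.submodule (coboundaries L G (Suc n)) L ?Z"
    by (rule module.submoduleI[OF Z])
      (use assms module.submoduleD[OF module_cochains submodule_coboundaries] in auto)
  then show ?thesis
    using Z by (intro quotient_by_submodule.intro quotient_by_submodule_axioms.intro)
qed

lemma coset_carrier_update: "a_r_coset (M\<lparr>carrier := Z\<rparr>) N x = N +>\<^bsub>M\<^esub> x"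
  by (simp add: a_r_coset_def r_coset_def)

subsection \<open>The first cohomology group\<close>

lemma coboundaries_1: "coboundaries L G (Suc 0) = {\<zero>\<^bsub>cochains L G (Suc 0)\<^esub>}"
  using coboundary_0 cochain_zero_closed[of 0] by (auto simp: coboundaries_def)

sublocale H1: quotient_by_submodule L "(cochains L G (Suc 0))\<lparr>carrier := cocycles L G (Suc 0)\<rparr>"
  "coboundaries L G (Suc 0)"
  using module.submoduleD(2)[OF module_cochains submodule_cocycles]
  by (intro quotient_cohomology) (simp add: coboundaries_1)

text \<open>
  The coboundary of a 0-cochain is zero, so classes in degree one are singletons.
\<close>

lemma class_1:
  assumes "f \<in> cocycles L G (Suc 0)"
  shows "H1.cls f = {f}"
proof -
  have "f \<in> carrier (cochains L G (Suc 0))" using assms by (simp add: cocycles_def)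
  then have "\<zero>\<^bsub>cochains L G (Suc 0)\<^esub> \<oplus>\<^bsub>cochains L G (Suc 0)\<^esub> f = f"
    using module_cochains[of "Suc 0"] by (simp add: Module.module_def abelian_group_def abelian_monoid.l_zero)
  then show ?thesis
    unfolding coset_carrier_update coboundaries_1 by (simp add: a_r_coset_def r_coset_def)
qed

lemma module_H1: "Module.module L (cohomology L G (Suc 0))"
  unfolding cohomology_def by (rule H1.quotient_module)

lemma carrier_H1: "carrier (cohomology L G (Suc 0)) = (\<lambda>f. {f}) ` cocycles L G (Suc 0)"
proof -
  have "carrier (cohomology L G (Suc 0)) = H1.cls ` cocycles L G (Suc 0)"
    unfolding cohomology_def using H1.class_in H1.class_cases by force
  then show ?thesis using class_1 by simp
qed

lemma add_H1:
  assumes "f \<in> cocycles L G (Suc 0)" "g \<in> cocycles L G (Suc 0)"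
  shows "f \<oplus>\<^bsub>cochains L G (Suc 0)\<^esub> g \<in> cocycles L G (Suc 0)"
    and "{f} \<oplus>\<^bsub>cohomology L G (Suc 0)\<^esub> {g} = {f \<oplus>\<^bsub>cochains L G (Suc 0)\<^esub> g}"
proof -
  show fg: "f \<oplus>\<^bsub>cochains L G (Suc 0)\<^esub> g \<in> cocycles L G (Suc 0)"
    using module.submoduleD(3)[OF module_cochains submodule_cocycles assms] .
  show "{f} \<oplus>\<^bsub>cohomology L G (Suc 0)\<^esub> {g} = {f \<oplus>\<^bsub>cochains L G (Suc 0)\<^esub> g}"
    using H1.class_add[of f g] assms class_1[OF fg] class_1[OF assms(1)] class_1[OF assms(2)]
    by (simp add: cohomology_def)
qed

lemma smult_H1:
  assumes "a \<in> carrier L" "f \<in> cocycles L G (Suc 0)"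
  shows "a \<odot>\<^bsub>cochains L G (Suc 0)\<^esub> f \<in> cocycles L G (Suc 0)"
    and "a \<odot>\<^bsub>cohomology L G (Suc 0)\<^esub> {f} = {a \<odot>\<^bsub>cochains L G (Suc 0)\<^esub> f}"
proof -
  show af: "a \<odot>\<^bsub>cochains L G (Suc 0)\<^esub> f \<in> cocycles L G (Suc 0)"
    using module.submoduleD(4)[OF module_cochains submodule_cocycles assms] .
  show "a \<odot>\<^bsub>cohomology L G (Suc 0)\<^esub> {f} = {a \<odot>\<^bsub>cochains L G (Suc 0)\<^esub> f}"
    using H1.class_smult[of a f] assms class_1[OF af] class_1[OF assms(2)]
    by (simp add: cohomology_def)
qed

lemma cocycle_1_closed: "f \<in> cocycles L G (Suc 0) \<Longrightarrow> a \<in> carrier G \<Longrightarrow> f [a] \<in> carrier L"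
  using cochain_closed[of f "Suc 0" "[a]"] by (auto simp: cocycles_def tuples_def)

lemma cocycle_1_mult:
  "f \<in> cocycles L G (Suc 0) \<Longrightarrow> a \<in> carrier G \<Longrightarrow> b \<in> carrier G \<Longrightarrow> f [a \<otimes>\<^bsub>G\<^esub> b] = f [a] \<oplus> f [b]"
  by (simp add: cocycles_1_iff)

lemma cocycle_1_one:
  assumes "f \<in> cocycles L G (Suc 0)"
  shows "f [\<one>\<^bsub>G\<^esub>] = \<zero>"
  using cocycle_1_mult[OF assms G.one_closed G.one_closed] cocycle_1_closed[OF assms G.one_closed]
  by simp

subsection \<open>The second cohomology group\<close>

lemma coboundaries_2_iff:
  "F \<in> coboundaries L G 2 \<longleftrightarrow> F \<in> carrier (cochains L G 2) \<and>
    (\<exists>\<phi>\<in>carrier (cochains L G (Suc 0)). \<forall>a\<in>carrier G. \<forall>b\<in>carrier G.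
      F [a, b] = \<phi> [b] \<ominus> \<phi> [a \<otimes>\<^bsub>G\<^esub> b] \<oplus> \<phi> [a])"
proof -
  interpret d: mod_hom L "cochains L G (Suc 0)" "cochains L G (Suc (Suc 0))" "coboundary_map L G (Suc 0)"
    by (rule coboundary_map_linear)
  have d_in: "coboundary_map L G (Suc 0) \<phi> \<in> carrier (cochains L G 2)"
    if "\<phi> \<in> carrier (cochains L G (Suc 0))" for \<phi>
    using d.f_im[OF that] by (simp add: numeral_2_eq_2)
  have "F \<in> coboundaries L G 2 \<longleftrightarrow>
      (\<exists>\<phi>\<in>carrier (cochains L G (Suc 0)). F = coboundary_map L G (Suc 0) \<phi>)"
    by (auto simp: coboundaries_def numeral_2_eq_2)
  moreover have "F = coboundary_map L G (Suc 0) \<phi> \<longleftrightarrow> F \<in> carrier (cochains L G 2) \<and>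
      (\<forall>a\<in>carrier G. \<forall>b\<in>carrier G. F [a, b] = \<phi> [b] \<ominus> \<phi> [a \<otimes>\<^bsub>G\<^esub> b] \<oplus> \<phi> [a])"
    if \<phi>: "\<phi> \<in> carrier (cochains L G (Suc 0))" for \<phi>
  proof
    assume "F = coboundary_map L G (Suc 0) \<phi>"
    then show "F \<in> carrier (cochains L G 2) \<and>
      (\<forall>a\<in>carrier G. \<forall>b\<in>carrier G. F [a, b] = \<phi> [b] \<ominus> \<phi> [a \<otimes>\<^bsub>G\<^esub> b] \<oplus> \<phi> [a])"
      using d_in[OF \<phi>] coboundary_1[OF \<phi>] by simp
  next
    assume *: "F \<in> carrier (cochains L G 2) \<and>
      (\<forall>a\<in>carrier G. \<forall>b\<in>carrier G. F [a, b] = \<phi> [b] \<ominus> \<phi> [a \<otimes>\<^bsub>G\<^esub> b] \<oplus> \<phi> [a])"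
    show "F = coboundary_map L G (Suc 0) \<phi>"
      by (rule cochain_eqI[OF _ d_in[OF \<phi>]])
        (use * in \<open>auto simp: tuples_small coboundary_1[OF \<phi>]\<close>)
  qed
  ultimately show ?thesis by blast
qed

lemma cocycles_2I:
  assumes F: "F \<in> carrier (cochains L G 2)"
    and eq: "\<And>a b c. a \<in> carrier G \<Longrightarrow> b \<in> carrier G \<Longrightarrow> c \<in> carrier G \<Longrightarrow>
      F [b, c] \<ominus> F [a \<otimes>\<^bsub>G\<^esub> b, c] \<oplus> F [a, b \<otimes>\<^bsub>G\<^esub> c] \<ominus> F [a, b] = \<zero>"
  shows "F \<in> cocycles L G 2"
proof -
  interpret d: mod_hom L "cochains L G 2" "cochains L G (Suc 2)" "coboundary_map L G 2"
    by (rule coboundary_map_linear)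
  have "coboundary_map L G 2 F = \<zero>\<^bsub>cochains L G (Suc 2)\<^esub>"
  proof (rule cochain_eqI[OF d.f_im[OF F] cochain_zero_closed])
    fix xs assume xs: "xs \<in> tuples G (Suc 2)"
    then obtain a b c where "xs = [a, b, c]" and abc: "a \<in> carrier G" "b \<in> carrier G" "c \<in> carrier G"
      by (auto simp: tuples_small numeral_3_eq_3[symmetric] simp flip: numeral_2_eq_2)
    then show "coboundary_map L G 2 F xs = \<zero>\<^bsub>cochains L G (Suc 2)\<^esub> xs"
      using coboundary_2[OF F abc] eq[OF abc] cochain_zero_apply[OF xs] by simp
  qed
  then show ?thesis using F by (simp add: cocycles_def)
qed

lemma coboundaries_2_subset_cocycles: "coboundaries L G 2 \<subseteq> cocycles L G 2"
proof
  fix F assume "F \<in> coboundaries L G 2"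
  then obtain f where FC: "F \<in> carrier (cochains L G 2)" and f: "f \<in> carrier (cochains L G (Suc 0))"
    and F: "\<And>a b. a \<in> carrier G \<Longrightarrow> b \<in> carrier G \<Longrightarrow> F [a, b] = f [b] \<ominus> f [a \<otimes>\<^bsub>G\<^esub> b] \<oplus> f [a]"
    unfolding coboundaries_2_iff by blast
  have cl: "f [x] \<in> carrier L" if "x \<in> carrier G" for x
    using f that by (auto simp: cochains_def tuples_small)
  show "F \<in> cocycles L G 2"
  proof (rule cocycles_2I[OF FC])
    fix a b c assume abc: "a \<in> carrier G" "b \<in> carrier G" "c \<in> carrier G"
    define p q r s t u where "p = f [a]" and "q = f [b]" and "r = f [c]"
      and "s = f [a \<otimes>\<^bsub>G\<^esub> b]" and "t = f [b \<otimes>\<^bsub>G\<^esub> c]" and "u = f [a \<otimes>\<^bsub>G\<^esub> (b \<otimes>\<^bsub>G\<^esub> c)]"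
    have "p \<in> carrier L" "q \<in> carrier L" "r \<in> carrier L" "s \<in> carrier L" "t \<in> carrier L" "u \<in> carrier L"
      unfolding p_def q_def r_def s_def t_def u_def using cl abc by auto
    then have "(r \<ominus> t \<oplus> q) \<ominus> (r \<ominus> u \<oplus> s) \<oplus> (t \<ominus> u \<oplus> p) \<ominus> (q \<ominus> s \<oplus> p) = \<zero>"
      by algebra
    then show "F [b, c] \<ominus> F [a \<otimes>\<^bsub>G\<^esub> b, c] \<oplus> F [a, b \<otimes>\<^bsub>G\<^esub> c] \<ominus> F [a, b] = \<zero>"
      unfolding p_def q_def r_def s_def t_def u_def
      using abc by (simp add: F G.m_assoc)
  qed
qed

sublocale H2: quotient_by_submodule L "(cochains L G 2)\<lparr>carrier := cocycles L G 2\<rparr>"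
  "coboundaries L G 2"
  using quotient_cohomology[of "Suc 0"] coboundaries_2_subset_cocycles by (simp add: numeral_2_eq_2)

lemma module_H2: "Module.module L (cohomology L G 2)"
  unfolding cohomology_def by (rule H2.quotient_module)

subsection \<open>The cup product of degree one classes\<close>

definition cup :: "('g list \<Rightarrow> 'l) \<Rightarrow> ('g list \<Rightarrow> 'l) \<Rightarrow> 'g list \<Rightarrow> 'l" where
  "cup f g = cup_cochain L G (Suc 0) (Suc 0) f g"

lemma cup_apply: "a \<in> carrier G \<Longrightarrow> b \<in> carrier G \<Longrightarrow> cup f g [a, b] = f [a] \<otimes> g [b]"
  by (simp add: cup_def cup_cochain_def tuples_def)

lemma cup_in_cocycles:
  assumes f: "f \<in> cocycles L G (Suc 0)" and g: "g \<in> cocycles L G (Suc 0)"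
  shows "cup f g \<in> cocycles L G 2"
proof (rule cocycles_2I)
  note cl = cocycle_1_closed[OF f] cocycle_1_closed[OF g]
  have "\<And>xs. xs \<in> tuples G 2 \<Longrightarrow> cup f g xs \<in> carrier L"
    using cl by (auto simp: tuples_small cup_apply)
  moreover have "cup f g \<in> extensional (tuples G 2)"
    by (simp add: cup_def cup_cochain_def numeral_2_eq_2)
  ultimately show "cup f g \<in> carrier (cochains L G 2)" by (auto simp: cochains_def PiE_def)
  fix a b c assume abc: "a \<in> carrier G" "b \<in> carrier G" "c \<in> carrier G"
  define fa fb gb gc where "fa = f [a]" and "fb = f [b]" and "gb = g [b]" and "gc = g [c]"
  have "fa \<in> carrier L" "fb \<in> carrier L" "gb \<in> carrier L" "gc \<in> carrier L"
    unfolding fa_def fb_def gb_def gc_def using cl abc by auto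
  then have "fb \<otimes> gc \<ominus> (fa \<oplus> fb) \<otimes> gc \<oplus> fa \<otimes> (gb \<oplus> gc) \<ominus> fa \<otimes> gb = \<zero>"
    by algebra
  then show "cup f g [b, c] \<ominus> cup f g [a \<otimes>\<^bsub>G\<^esub> b, c] \<oplus> cup f g [a, b \<otimes>\<^bsub>G\<^esub> c] \<ominus> cup f g [a, b] = \<zero>"
    using abc by (simp add: cup_apply cocycle_1_mult[OF f] cocycle_1_mult[OF g] fa_def fb_def gb_def gc_def)
qed

lemma cup_product_H1:
  "cup_product L G (Suc 0) (Suc 0) {f} {g} = H2.cls (cup f g)"
  unfolding coset_carrier_update cup_def by (simp add: cup_product_def numeral_2_eq_2)

lemma cup_product_zero_iff:
  assumes f: "f \<in> cocycles L G (Suc 0)" and g: "g \<in> cocycles L G (Suc 0)"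
  shows "cup_product L G (Suc 0) (Suc 0) {f} {g} = \<zero>\<^bsub>cohomology L G 2\<^esub> \<longleftrightarrow>
    (\<exists>\<phi>\<in>carrier (cochains L G (Suc 0)). \<forall>a\<in>carrier G. \<forall>b\<in>carrier G.
      f [a] \<otimes> g [b] = \<phi> [b] \<ominus> \<phi> [a \<otimes>\<^bsub>G\<^esub> b] \<oplus> \<phi> [a])"
proof -
  have "cup f g \<in> carrier (cochains L G 2)" using cup_in_cocycles[OF f g] by (simp add: cocycles_def)
  then have "cup f g \<in> coboundaries L G 2 \<longleftrightarrow> (\<exists>\<phi>\<in>carrier (cochains L G (Suc 0)).
      \<forall>a\<in>carrier G. \<forall>b\<in>carrier G. f [a] \<otimes> g [b] = \<phi> [b] \<ominus> \<phi> [a \<otimes>\<^bsub>G\<^esub> b] \<oplus> \<phi> [a])"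
    unfolding coboundaries_2_iff by (simp add: cup_apply)
  then show ?thesis
    using H2.class_eq_zero_iff[of "cup f g"] cup_in_cocycles[OF f g]
    by (simp add: cup_product_H1 cohomology_def)
qed

lemma H2_class:
  assumes "F \<in> cocycles L G 2"
  shows "H2.cls F \<in> carrier (cohomology L G 2)"
    and "F' \<in> cocycles L G 2 \<Longrightarrow>
      H2.cls F \<oplus>\<^bsub>cohomology L G 2\<^esub> H2.cls F' = H2.cls (F \<oplus>\<^bsub>cochains L G 2\<^esub> F')"
    and "a \<in> carrier L \<Longrightarrow> a \<odot>\<^bsub>cohomology L G 2\<^esub> H2.cls F = H2.cls (a \<odot>\<^bsub>cochains L G 2\<^esub> F)"
  using H2.class_in[of F] H2.class_add[of F F'] H2.class_smult[of a F] assms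
  by (simp_all add: cohomology_def)

lemma cup_eqI:
  assumes "F \<in> cocycles L G 2" "F' \<in> cocycles L G 2"
    and "\<And>a b. a \<in> carrier G \<Longrightarrow> b \<in> carrier G \<Longrightarrow> F [a, b] = F' [a, b]"
  shows "F = F'"
  by (rule cochain_eqI[of _ 2]) (use assms in \<open>auto simp: cocycles_def tuples_small\<close>)

lemma cup_bilinear:
  assumes f: "f \<in> cocycles L G (Suc 0)" and g: "g \<in> cocycles L G (Suc 0)"
    and h: "h \<in> cocycles L G (Suc 0)"
  shows "cup (f \<oplus>\<^bsub>cochains L G (Suc 0)\<^esub> g) h = cup f h \<oplus>\<^bsub>cochains L G 2\<^esub> cup g h"
    and "cup h (f \<oplus>\<^bsub>cochains L G (Suc 0)\<^esub> g) = cup h f \<oplus>\<^bsub>cochains L G 2\<^esub> cup h g"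
    and "a \<in> carrier L \<Longrightarrow> cup (a \<odot>\<^bsub>cochains L G (Suc 0)\<^esub> f) h = a \<odot>\<^bsub>cochains L G 2\<^esub> cup f h"
    and "a \<in> carrier L \<Longrightarrow> cup h (a \<odot>\<^bsub>cochains L G (Suc 0)\<^esub> f) = a \<odot>\<^bsub>cochains L G 2\<^esub> cup h f"
proof -
  note Z2 = module.submoduleD[OF module_cochains submodule_cocycles]
  note cl = cocycle_1_closed[OF f] cocycle_1_closed[OF g] cocycle_1_closed[OF h]
  have t: "[x] \<in> tuples G (Suc 0)" "[x, y] \<in> tuples G 2" if "x \<in> carrier G" "y \<in> carrier G" for x y
    using that by (auto simp: tuples_def)
  note simps = cup_apply cochain_add_apply cochain_smult_apply t cl L.l_distr L.r_distr L.m_assoc L.m_lcomm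
  show "cup (f \<oplus>\<^bsub>cochains L G (Suc 0)\<^esub> g) h = cup f h \<oplus>\<^bsub>cochains L G 2\<^esub> cup g h"
    by (rule cup_eqI) (use f g h in \<open>auto intro!: cup_in_cocycles Z2 simp: simps\<close>)
  show "cup h (f \<oplus>\<^bsub>cochains L G (Suc 0)\<^esub> g) = cup h f \<oplus>\<^bsub>cochains L G 2\<^esub> cup h g"
    by (rule cup_eqI) (use f g h in \<open>auto intro!: cup_in_cocycles Z2 simp: simps\<close>)
  show "a \<in> carrier L \<Longrightarrow> cup (a \<odot>\<^bsub>cochains L G (Suc 0)\<^esub> f) h = a \<odot>\<^bsub>cochains L G 2\<^esub> cup f h"
    by (rule cup_eqI) (use f h in \<open>auto intro!: cup_in_cocycles Z2 simp: simps\<close>)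
  show "a \<in> carrier L \<Longrightarrow> cup h (a \<odot>\<^bsub>cochains L G (Suc 0)\<^esub> f) = a \<odot>\<^bsub>cochains L G 2\<^esub> cup h f"
    by (rule cup_eqI) (use f h in \<open>auto intro!: cup_in_cocycles Z2 simp: simps\<close>)
qed

lemma bilinear_cup_product:
  "bilinear_pairing L (cohomology L G (Suc 0)) (cohomology L G 2) (cup_product L G (Suc 0) (Suc 0))"
  unfolding bilinear_pairing_def carrier_H1
  by (auto simp: add_H1 smult_H1 cup_product_H1 H2_class cup_in_cocycles cup_bilinear)

text \<open>
  The pointwise product \<open>f g\<close> of two homomorphisms is a 1-cochain with coboundary
  \<open>- (f \<smile> g + g \<smile> f)\<close>.
\<close>

lemma cup_product_antisym:
  assumes f: "f \<in> cocycles L G (Suc 0)" and g: "g \<in> cocycles L G (Suc 0)"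
  shows "cup_product L G (Suc 0) (Suc 0) {f} {g} =
    \<ominus>\<^bsub>cohomology L G 2\<^esub> cup_product L G (Suc 0) (Suc 0) {g} {f}"
proof -
  interpret H2': Module.module L "cohomology L G 2" by (rule module_H2)
  note cl = cocycle_1_closed[OF f] cocycle_1_closed[OF g]
  let ?\<phi> = "\<lambda>xs\<in>tuples G (Suc 0). \<ominus> (f xs \<otimes> g xs)"
  let ?s = "cup f g \<oplus>\<^bsub>cochains L G 2\<^esub> cup g f"
  have s: "?s \<in> cocycles L G 2"
    using module.submoduleD(3)[OF module_cochains submodule_cocycles] cup_in_cocycles f g by blast
  have "?s \<in> coboundaries L G 2"
    unfolding coboundaries_2_iff
  proof (intro conjI bexI[of _ ?\<phi>] ballI)
    show "?s \<in> carrier (cochains L G 2)" using s by (simp add: cocycles_def)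
    show "?\<phi> \<in> carrier (cochains L G (Suc 0))"
      using cl by (auto simp: cochains_def tuples_small)
    fix a b assume ab: "a \<in> carrier G" "b \<in> carrier G"
    define fa fb ga gb where "fa = f [a]" and "fb = f [b]" and "ga = g [a]" and "gb = g [b]"
    have "fa \<in> carrier L" "fb \<in> carrier L" "ga \<in> carrier L" "gb \<in> carrier L"
      unfolding fa_def fb_def ga_def gb_def using cl ab by auto
    then have "fa \<otimes> gb \<oplus> ga \<otimes> fb =
        \<ominus> (fb \<otimes> gb) \<ominus> (\<ominus> ((fa \<oplus> fb) \<otimes> (ga \<oplus> gb))) \<oplus> (\<ominus> (fa \<otimes> ga))"
      by algebra
    then show "?s [a, b] = ?\<phi> [b] \<ominus> ?\<phi> [a \<otimes>\<^bsub>G\<^esub> b] \<oplus> ?\<phi> [a]"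
      using ab by (simp add: cochain_add_apply cup_apply tuples_def cocycle_1_mult[OF f] cocycle_1_mult[OF g]
          fa_def fb_def ga_def gb_def)
  qed
  then have "H2.cls (cup f g) \<oplus>\<^bsub>cohomology L G 2\<^esub> H2.cls (cup g f) = \<zero>\<^bsub>cohomology L G 2\<^esub>"
    using H2.class_eq_zero_iff[of ?s] s H2_class(2) cup_in_cocycles f g by (simp add: cohomology_def)
  then show ?thesis
    unfolding cup_product_H1 using H2_class(1) cup_in_cocycles f g
    by (metis H2'.M.minus_equality)
qed

end

section \<open>Presented groups\<close>

lemma words_append: "u @ v \<in> words X \<longleftrightarrow> u \<in> words X \<and> v \<in> words X"
  by (auto simp: words_def)

lemma words_Cons: "l # u \<in> words X \<longleftrightarrow> fst l \<in> X \<and> u \<in> words X"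
  by (cases l) (auto simp: words_def)

lemma words_Nil: "[] \<in> words X"
  by (simp add: words_def)

locale presentation =
  fixes X :: "'x set" and R :: "'x word set"
  assumes relators: "R \<subseteq> words X"
begin

abbreviation "G \<equiv> presented_group X R"

definition cls :: "'x word \<Rightarrow> 'x word set" where
  "cls u = pres_rel X R `` {u}"

lemma pres_rel_words:
  assumes "(u, v) \<in> pres_rel X R"
  shows "u \<in> words X" "v \<in> words X"
proof -
  have "u \<in> words X \<and> v \<in> words X"
    using assms relators by (induction) (auto simp: words_append words_Cons words_Nil)
  then show "u \<in> words X" "v \<in> words X" by auto
qed

lemma equiv_pres_rel: "equiv (words X) (pres_rel X R)"
  by (rule equivI)
    (auto simp: refl_on_def sym_def trans_def dest: pres_rel_words intro: pres_rel.intros)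

lemma pres_rel_append_left:
  assumes "(u, v) \<in> pres_rel X R" "w \<in> words X"
  shows "(w @ u, w @ v) \<in> pres_rel X R"
  using assms
proof induction
  case (cancel u w' x b)
  then show ?case using pres_rel.cancel[of "w @ u" X w' x b R] by (simp add: words_append)
next
  case (relator u w' r)
  then show ?case using pres_rel.relator[where u = "w @ u" and w = w' and r = r and R = R and X = X] by (simp add: words_append)
qed (auto intro: pres_rel.refl pres_rel.sym pres_rel.trans simp: words_append)

lemma pres_rel_append_right:
  assumes "(u, v) \<in> pres_rel X R" "w \<in> words X"
  shows "(u @ w, v @ w) \<in> pres_rel X R"
  using assms
proof induction
  case (cancel u w' x b)
  then show ?case using pres_rel.cancel[of u X "w' @ w" x b R] by (simp add: words_append)
next
  case (relator u w' r)
  then show ?case using pres_rel.relator[where u = u and w = "w' @ w" and r = r and R = R and X = X] by (simp add: words_append)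
qed (auto intro: pres_rel.refl pres_rel.sym pres_rel.trans simp: words_append)

lemma pres_rel_append:
  assumes "(u, u') \<in> pres_rel X R" "(v, v') \<in> pres_rel X R"
  shows "(u @ v, u' @ v') \<in> pres_rel X R"
  using pres_rel_append_right[OF assms(1) pres_rel_words(1)[OF assms(2)]]
    pres_rel_append_left[OF assms(2) pres_rel_words(2)[OF assms(1)]]
  by (rule pres_rel.trans)

lemma cls_eq_iff: "u \<in> words X \<Longrightarrow> v \<in> words X \<Longrightarrow> cls u = cls v \<longleftrightarrow> (u, v) \<in> pres_rel X R"
  unfolding cls_def using eq_equiv_class_iff[OF equiv_pres_rel] by simp

lemma carrier_presented_group: "carrier G = cls ` words X"
  by (auto simp: presented_group_def quotient_def cls_def)

lemma one_presented_group: "\<one>\<^bsub>G\<^esub> = cls []"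
  by (simp add: presented_group_def cls_def)

lemma mult_presented_group:
  assumes "u \<in> words X" "v \<in> words X"
  shows "cls u \<otimes>\<^bsub>G\<^esub> cls v = cls (u @ v)"
proof -
  have "cls (u' @ v') = cls (u @ v)" if "u' \<in> cls u" "v' \<in> cls v" for u' v'
  proof -
    have uv: "(u, u') \<in> pres_rel X R" "(v, v') \<in> pres_rel X R" using that by (auto simp: cls_def)
    note rel = pres_rel_append[OF uv]
    show ?thesis using rel cls_eq_iff[OF pres_rel_words[OF rel]] by simp
  qed
  moreover have "u \<in> cls u" "v \<in> cls v" using assms by (auto simp: cls_def intro: pres_rel.refl)
  ultimately have "(\<Union>u'\<in>cls u. \<Union>v'\<in>cls v. cls (u' @ v')) = cls (u @ v)"
    by (intro SUP_eq_const) blast+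
  then show ?thesis by (simp add: presented_group_def cls_def)
qed

lemma monoid_presented_group: "monoid G"
  by (rule monoidI)
    (auto simp: carrier_presented_group one_presented_group mult_presented_group words_append words_Nil)

lemma pres_rel_invariant:
  assumes "(u, v) \<in> pres_rel X R"
    and "\<And>u w x b. u \<in> words X \<Longrightarrow> w \<in> words X \<Longrightarrow> x \<in> X \<Longrightarrow>
      \<Phi> (u @ [(x, b), (x, \<not> b)] @ w) = \<Phi> (u @ w)"
    and "\<And>u w r. u \<in> words X \<Longrightarrow> w \<in> words X \<Longrightarrow> r \<in> R \<Longrightarrow> \<Phi> (u @ r @ w) = \<Phi> (u @ w)"
  shows "\<Phi> u = \<Phi> v"
  using assms(1) by induction (use assms(2,3) in auto)

text \<open>
  The function on the group induced by a function on words that is constant on classes.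
\<close>

definition lift :: "('x word \<Rightarrow> 'c) \<Rightarrow> 'x word set \<Rightarrow> 'c" where
  "lift \<Phi> A = \<Phi> (SOME u. u \<in> A)"

lemma lift_cls:
  assumes "\<And>u v. (u, v) \<in> pres_rel X R \<Longrightarrow> \<Phi> u = \<Phi> v" "u \<in> words X"
  shows "lift \<Phi> (cls u) = \<Phi> u"
proof -
  have "u \<in> cls u" using assms(2) by (auto simp: cls_def intro: pres_rel.refl)
  then have "(SOME v. v \<in> cls u) \<in> cls u" by (rule someI)
  then show ?thesis unfolding lift_def using assms(1) by (auto simp: cls_def)
qed

end

section \<open>Lifting homomorphisms to the Heisenberg group\<close>

context cring
begin

definition letter_value :: "('x \<Rightarrow> 'a) \<Rightarrow> 'x \<times> bool \<Rightarrow> 'a" where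
  "letter_value f l = (if snd l then f (fst l) else \<ominus> f (fst l))"

primrec word_sum :: "('x \<Rightarrow> 'a) \<Rightarrow> 'x word \<Rightarrow> 'a" where
  "word_sum f [] = \<zero>"
| "word_sum f (l # u) = letter_value f l \<oplus> word_sum f u"

text \<open>
  Send a generator \<open>x\<close> to the upper unitriangular matrix of size three with entries \<open>f x\<close> and \<open>g x\<close> next to
  the diagonal and corner entry 0. Then \<open>heisenberg f g u\<close> is minus the corner entry of the product of
  matrices along the word \<open>u\<close>; the sign makes its coboundary \<open>f \<smile> g\<close> (see \<open>heisenberg_append\<close>). The inverse of
  the matrix of \<open>x\<close> has corner entry \<open>f x * g x\<close>, which is the source of the value at an inverse letter.
\<close>

primrec heisenberg :: "('x \<Rightarrow> 'a) \<Rightarrow> ('x \<Rightarrow> 'a) \<Rightarrow> 'x word \<Rightarrow> 'a" where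
  "heisenberg f g [] = \<zero>"
| "heisenberg f g (l # u) =
    (if snd l then \<zero> else \<ominus> (f (fst l) \<otimes> g (fst l)))
      \<oplus> heisenberg f g u \<ominus> letter_value f l \<otimes> word_sum g u"

lemma letter_value_closed: "f \<in> X \<rightarrow> carrier R \<Longrightarrow> fst l \<in> X \<Longrightarrow> letter_value f l \<in> carrier R"
  by (auto simp: letter_value_def)

lemma word_sum_closed: "f \<in> X \<rightarrow> carrier R \<Longrightarrow> u \<in> words X \<Longrightarrow> word_sum f u \<in> carrier R"
  by (induction u) (auto simp: words_Cons letter_value_closed)

lemma word_sum_append:
  assumes f: "f \<in> X \<rightarrow> carrier R" and "u \<in> words X" "v \<in> words X"
  shows "word_sum f (u @ v) = word_sum f u \<oplus> word_sum f v"
  using assms(2,3)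
  by (induction u) (auto simp: words_Cons a_assoc letter_value_closed[OF f] word_sum_closed[OF f])

lemma heisenberg_closed:
  assumes f: "f \<in> X \<rightarrow> carrier R" and g: "g \<in> X \<rightarrow> carrier R"
  shows "u \<in> words X \<Longrightarrow> heisenberg f g u \<in> carrier R"
proof (induction u)
  case (Cons l u)
  have "f (fst l) \<in> carrier R" "g (fst l) \<in> carrier R"
    using Cons.prems f g by (auto simp: words_Cons)
  then show ?case
    using Cons letter_value_closed[OF f, of l] word_sum_closed[OF g, of u] by (auto simp: words_Cons)
qed simp

lemma heisenberg_append:
  assumes f: "f \<in> X \<rightarrow> carrier R" and g: "g \<in> X \<rightarrow> carrier R" and "u \<in> words X" "v \<in> words X"
  shows "heisenberg f g (u @ v) = heisenberg f g u \<oplus> heisenberg f g v \<ominus> word_sum f u \<otimes> word_sum g v"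
  using assms(3)
proof (induction u)
  case Nil
  then show ?case using heisenberg_closed[OF f g assms(4)] word_sum_closed[OF g assms(4)]
    by (simp add: a_minus_def)
next
  case (Cons l u)
  have u: "u \<in> words X" "fst l \<in> X" using Cons.prems by (auto simp: words_Cons)
  define e where "e = (if snd l then \<zero> else \<ominus> (f (fst l) \<otimes> g (fst l)))"
  define a where "a = letter_value f l"
  define su sv gu gv hu hv where "su = word_sum f u" and "sv = word_sum f v" and
    "gu = word_sum g u" and "gv = word_sum g v" and "hu = heisenberg f g u" and "hv = heisenberg f g v"
  have "e \<in> carrier R" using u f g by (auto simp: e_def)
  moreover have "a \<in> carrier R" "su \<in> carrier R" "sv \<in> carrier R" "gu \<in> carrier R" "gv \<in> carrier R"
    "hu \<in> carrier R" "hv \<in> carrier R"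
    unfolding a_def su_def sv_def gu_def gv_def hu_def hv_def
    using u assms(4)
    by (simp_all add: letter_value_closed[OF f] word_sum_closed[OF f] word_sum_closed[OF g]
        heisenberg_closed[OF f g])
  ultimately have "e \<oplus> (hu \<oplus> hv \<ominus> su \<otimes> gv) \<ominus> a \<otimes> (gu \<oplus> gv) =
      (e \<oplus> hu \<ominus> a \<otimes> gu) \<oplus> hv \<ominus> (a \<oplus> su) \<otimes> gv"
    by algebra
  then show ?case
    using Cons.IH[OF u(1)] word_sum_append[OF g u(1) assms(4)]
    by (simp add: e_def a_def su_def sv_def gu_def gv_def hu_def hv_def)
qed

lemma word_sum_delete:
  assumes f: "f \<in> X \<rightarrow> carrier R" and "u \<in> words X" "m \<in> words X" "w \<in> words X"
    and m: "word_sum f m = \<zero>"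
  shows "word_sum f (u @ m @ w) = word_sum f (u @ w)"
  using assms by (simp add: word_sum_append[OF f] words_append word_sum_closed[OF f])

lemma heisenberg_delete:
  assumes f: "f \<in> X \<rightarrow> carrier R" and g: "g \<in> X \<rightarrow> carrier R"
    and "u \<in> words X" "m \<in> words X" "w \<in> words X"
    and "word_sum f m = \<zero>" "word_sum g m = \<zero>" "heisenberg f g m = \<zero>"
  shows "heisenberg f g (u @ m @ w) = heisenberg f g (u @ w)"
  using assms
  by (simp add: heisenberg_append[OF f g] word_sum_append[OF f] word_sum_append[OF g] words_append
      word_sum_closed[OF f] word_sum_closed[OF g] heisenberg_closed[OF f g] a_minus_def)

lemma word_sum_cancel:
  assumes "f \<in> X \<rightarrow> carrier R" "x \<in> X"
  shows "word_sum f [(x, b), (x, \<not> b)] = \<zero>"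
  using assms by (cases b) (auto simp: letter_value_def r_neg l_neg Pi_iff)

lemma heisenberg_cancel:
  assumes "f \<in> X \<rightarrow> carrier R" "g \<in> X \<rightarrow> carrier R" "x \<in> X"
  shows "heisenberg f g [(x, b), (x, \<not> b)] = \<zero>"
proof -
  have "f x \<in> carrier R" "g x \<in> carrier R" using assms by auto
  then show ?thesis
    by (cases b) (auto simp: letter_value_def a_minus_def r_neg l_neg l_minus r_minus)
qed

definition commutator_word :: "'x \<Rightarrow> 'x \<Rightarrow> 'x word" where
  "commutator_word v w = [(v, True), (w, True), (v, False), (w, False)]"

lemma word_sum_commutator:
  assumes "f \<in> X \<rightarrow> carrier R" "v \<in> X" "w \<in> X"
  shows "word_sum f (commutator_word v w) = \<zero>"
proof -
  have "f v \<in> carrier R" "f w \<in> carrier R" using assms by auto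
  then have "f v \<oplus> (f w \<oplus> (\<ominus> f v \<oplus> (\<ominus> f w \<oplus> \<zero>))) = \<zero>" by algebra
  then show ?thesis by (simp add: commutator_word_def letter_value_def)
qed

text \<open>
  The commutator of the two matrices is central, with corner entry \<open>f v * g w - f w * g v\<close>.
\<close>

lemma heisenberg_commutator:
  assumes "f \<in> X \<rightarrow> carrier R" "g \<in> X \<rightarrow> carrier R" "v \<in> X" "w \<in> X"
    and eq: "f v \<otimes> g w = f w \<otimes> g v"
  shows "heisenberg f g (commutator_word v w) = \<zero>"
proof -
  define a b c d where "a = f v" and "b = f w" and "c = g v" and "d = g w"
  have cl: "a \<in> carrier R" "b \<in> carrier R" "c \<in> carrier R" "d \<in> carrier R"
    unfolding a_def b_def c_def d_def using assms by auto
  then have "heisenberg f g (commutator_word v w) = b \<otimes> c \<ominus> a \<otimes> d"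
    unfolding commutator_word_def
    by (simp add: letter_value_def flip: a_def b_def c_def d_def) algebra
  then show ?thesis using eq cl by (simp add: a_def b_def c_def d_def a_minus_def r_neg)
qed

end

section \<open>Right-angled Artin groups\<close>

locale raag_cohomology = field L for L :: "('l, 'm) ring_scheme" (structure) +
  fixes \<Gamma> :: "'v pair_pre_digraph"
  assumes graph: "pair_graph \<Gamma>"
begin

abbreviation "A \<equiv> raag \<Gamma>"

abbreviation "relations \<equiv>
  {[(v, True), (w, True), (v, False), (w, False)] |v w. (v, w) \<in> parcs \<Gamma>}"

lemma arc_vertices:
  assumes "(v, w) \<in> parcs \<Gamma>"
  shows "v \<in> pverts \<Gamma>" "w \<in> pverts \<Gamma>"
proof -
  interpret pair_graph \<Gamma> by (rule graph)
  show "v \<in> pverts \<Gamma>" "w \<in> pverts \<Gamma>" using assms by (auto dest: in_arcsD1 in_arcsD2)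
qed

sublocale P: presentation "pverts \<Gamma>" relations
  by unfold_locales (auto simp: words_Cons words_Nil dest: arc_vertices)

lemma presented: "presented_group (pverts \<Gamma>) relations = A"
  by (simp add: raag_def)

sublocale bar_complex L A
  by (intro bar_complex.intro cring_axioms P.monoid_presented_group[unfolded presented])

lemmas carrier_raag = P.carrier_presented_group[unfolded presented]
  and one_raag = P.one_presented_group[unfolded presented]
  and mult_raag = P.mult_presented_group[unfolded presented]

definition gen :: "'v \<Rightarrow> 'v word set" where
  "gen v = P.cls [(v, True)]"

lemma letter_word: "v \<in> pverts \<Gamma> \<Longrightarrow> [(v, b)] \<in> words (pverts \<Gamma>)"
  by (simp add: words_Cons words_Nil)

lemma gen_closed: "v \<in> pverts \<Gamma> \<Longrightarrow> gen v \<in> carrier A"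
  unfolding gen_def carrier_raag using letter_word by blast

lemma gen_commute:
  assumes vw: "(v, w) \<in> parcs \<Gamma>"
  shows "gen v \<otimes>\<^bsub>A\<^esub> gen w = gen w \<otimes>\<^bsub>A\<^esub> gen v"
proof -
  let ?X = "pverts \<Gamma>" and ?rel = "pres_rel (pverts \<Gamma>) relations"
  note vs = arc_vertices[OF vw]
  let ?r = "[(v, True), (w, True), (v, False), (w, False)]"
  have wd: "[(a, b), (c, d)] \<in> words ?X" if "a \<in> ?X" "c \<in> ?X" for a b c d
    using that by (simp add: words_Cons words_Nil)
  have "([] @ ?r @ [(w, True), (v, True)], [] @ [(w, True), (v, True)]) \<in> ?rel"
    by (rule pres_rel.relator) (use vw vs wd words_Nil in auto)
  then have 1: "(?r @ [(w, True), (v, True)], [(w, True), (v, True)]) \<in> ?rel" by simp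
  have "([(v, True), (w, True), (v, False)] @ [(w, False), (w, \<not> False)] @ [(v, True)],
      [(v, True), (w, True), (v, False)] @ [(v, True)]) \<in> ?rel"
    by (rule pres_rel.cancel) (use vs in \<open>auto simp: words_Cons words_Nil\<close>)
  then have 2: "(?r @ [(w, True), (v, True)], [(v, True), (w, True), (v, False), (v, True)]) \<in> ?rel"
    by simp
  have "([(v, True), (w, True)] @ [(v, False), (v, \<not> False)] @ [], [(v, True), (w, True)] @ []) \<in> ?rel"
    by (rule pres_rel.cancel) (use vs in \<open>auto simp: words_Cons words_Nil\<close>)
  then have 3: "([(v, True), (w, True), (v, False), (v, True)], [(v, True), (w, True)]) \<in> ?rel"
    by simp
  have "([(v, True), (w, True)], [(w, True), (v, True)]) \<in> ?rel"
    using 1 2 3 by (blast intro: pres_rel.sym pres_rel.trans)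
  then show ?thesis
    unfolding gen_def using vs
    by (simp add: mult_raag letter_word wd P.cls_eq_iff)
qed

text \<open>
  A homomorphism to \<open>L\<close> is determined by its values at the generators.
\<close>

lemma cocycle_on_words:
  assumes f: "f \<in> cocycles L A (Suc 0)" and u: "u \<in> words (pverts \<Gamma>)"
  shows "f [P.cls u] = word_sum (\<lambda>v. f [gen v]) u"
  using u
proof (induction u)
  case Nil
  then show ?case using cocycle_1_one[OF f] by (simp add: one_raag)
next
  case (Cons l u)
  obtain v b where l: "l = (v, b)" by (cases l)
  have v: "v \<in> pverts \<Gamma>" and u: "u \<in> words (pverts \<Gamma>)" using Cons.prems by (auto simp: words_Cons l)
  have carr: "P.cls [(v, b)] \<in> carrier A" "P.cls u \<in> carrier A" for b
    unfolding carrier_raag using letter_word[OF v] u by blast+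
  have cl: "f [P.cls [(v, b)]] \<in> carrier L" for b using cocycle_1_closed[OF f carr(1)] .
  have "P.cls [(v, True)] \<otimes>\<^bsub>A\<^esub> P.cls [(v, False)] = \<one>\<^bsub>A\<^esub>"
  proof -
    have "([] @ [(v, True), (v, \<not> True)] @ [], [] @ []) \<in> pres_rel (pverts \<Gamma>) relations"
      by (rule pres_rel.cancel) (use v words_Nil in auto)
    then show ?thesis
      using v by (simp add: mult_raag one_raag letter_word P.cls_eq_iff words_Cons words_Nil)
  qed
  then have "f [P.cls [(v, True)]] \<oplus> f [P.cls [(v, False)]] = \<zero>"
    using cocycle_1_mult[OF f carr(1)[of True] carr(1)[of False]] cocycle_1_one[OF f] by simp
  then have "f [P.cls [(v, False)]] \<oplus> f [P.cls [(v, True)]] = \<zero>"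
    using cl[of True] cl[of False] by (simp add: a_comm)
  then have "f [P.cls [(v, False)]] = \<ominus> f [P.cls [(v, True)]]"
    by (rule minus_equality[symmetric]) (rule cl)+
  then have "f [P.cls [(v, b)]] = letter_value (\<lambda>v. f [gen v]) l"
    by (cases b) (simp_all add: letter_value_def l gen_def)
  moreover have "P.cls (l # u) = P.cls [(v, b)] \<otimes>\<^bsub>A\<^esub> P.cls u"
    using mult_raag[OF letter_word[OF v] u, of b] by (simp add: l)
  ultimately show ?case
    using cocycle_1_mult[OF f carr] Cons.IH[OF u] by simp
qed

lemma cocycle_eqI:
  assumes f: "f \<in> cocycles L A (Suc 0)" and g: "g \<in> cocycles L A (Suc 0)"
    and eq: "\<And>v. v \<in> pverts \<Gamma> \<Longrightarrow> f [gen v] = g [gen v]"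
  shows "f = g"
proof (rule cochain_eqI)
  show "f \<in> carrier (cochains L A (Suc 0))" "g \<in> carrier (cochains L A (Suc 0))"
    using f g by (auto simp: cocycles_def)
  fix xs assume "xs \<in> tuples A (Suc 0)"
  then obtain u where xs: "xs = [P.cls u]" and u: "u \<in> words (pverts \<Gamma>)"
    by (auto simp: tuples_small carrier_raag)
  have "word_sum (\<lambda>v. f [gen v]) u = word_sum (\<lambda>v. g [gen v]) u"
    using u by (induction u) (auto simp: words_Cons letter_value_def eq)
  then show "f xs = g xs" using cocycle_on_words[OF f u] cocycle_on_words[OF g u] xs by simp
qed

lemma word_sum_respects:
  assumes c: "c \<in> pverts \<Gamma> \<rightarrow> carrier L" and "(u, v) \<in> pres_rel (pverts \<Gamma>) relations"
  shows "word_sum c u = word_sum c v"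
  using assms(2)
proof (rule P.pres_rel_invariant)
  fix u w :: "'v word" and x b
  assume "u \<in> words (pverts \<Gamma>)" "w \<in> words (pverts \<Gamma>)" "x \<in> pverts \<Gamma>"
  then show "word_sum c (u @ [(x, b), (x, \<not> b)] @ w) = word_sum c (u @ w)"
    by (intro word_sum_delete[OF c] word_sum_cancel[OF c]) (auto simp: words_Cons words_Nil)
next
  fix u w r assume "u \<in> words (pverts \<Gamma>)" "w \<in> words (pverts \<Gamma>)" "r \<in> relations"
  then obtain x y where "r = commutator_word x y" "(x, y) \<in> parcs \<Gamma>"
    by (auto simp: commutator_word_def)
  then show "word_sum c (u @ r @ w) = word_sum c (u @ w)"
    using \<open>u \<in> _\<close> \<open>w \<in> _\<close> \<open>r \<in> _\<close> P.relators arc_vertices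
    by (intro word_sum_delete[OF c]) (auto intro: word_sum_commutator[OF c])
qed

lemma cocycle_exists:
  assumes c: "c \<in> pverts \<Gamma> \<rightarrow> carrier L"
  shows "\<exists>f\<in>cocycles L A (Suc 0). \<forall>v\<in>pverts \<Gamma>. f [gen v] = c v"
proof -
  let ?f = "\<lambda>xs\<in>tuples A (Suc 0). P.lift (word_sum c) (hd xs)"
  have f: "?f [P.cls u] = word_sum c u" if "u \<in> words (pverts \<Gamma>)" for u
    using that P.lift_cls[of "word_sum c", OF word_sum_respects[OF c]]
    by (auto simp: tuples_small carrier_raag)
  have "?f \<in> cocycles L A (Suc 0)"
    unfolding cocycles_1_iff
  proof
    show "?f \<in> carrier (cochains L A (Suc 0))"
      using f word_sum_closed[OF c] by (auto simp: cochains_def tuples_small carrier_raag)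
    show "\<forall>a\<in>carrier A. \<forall>b\<in>carrier A. ?f [a \<otimes>\<^bsub>A\<^esub> b] = ?f [a] \<oplus> ?f [b]"
      unfolding carrier_raag
      by (auto simp: mult_raag f words_append word_sum_append[OF c] simp del: restrict_apply)
  qed
  moreover have "?f [gen v] = c v" if v: "v \<in> pverts \<Gamma>" for v
    unfolding gen_def f[OF letter_word[OF v]] using funcset_mem[OF c v] by (simp add: letter_value_def)
  ultimately show ?thesis by blast
qed

lemma heisenberg_respects:
  assumes f: "f \<in> pverts \<Gamma> \<rightarrow> carrier L" and g: "g \<in> pverts \<Gamma> \<rightarrow> carrier L"
    and eq: "\<And>v w. (v, w) \<in> parcs \<Gamma> \<Longrightarrow> f v \<otimes> g w = f w \<otimes> g v"
    and "(u, v) \<in> pres_rel (pverts \<Gamma>) relations"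
  shows "heisenberg f g u = heisenberg f g v"
  using assms(4)
proof (rule P.pres_rel_invariant)
  fix u w :: "'v word" and x b
  assume "u \<in> words (pverts \<Gamma>)" "w \<in> words (pverts \<Gamma>)" "x \<in> pverts \<Gamma>"
  then show "heisenberg f g (u @ [(x, b), (x, \<not> b)] @ w) = heisenberg f g (u @ w)"
    by (intro heisenberg_delete[OF f g] word_sum_cancel[OF f] word_sum_cancel[OF g] heisenberg_cancel[OF f g])
      (auto simp: words_Cons words_Nil)
next
  fix u w r assume "u \<in> words (pverts \<Gamma>)" "w \<in> words (pverts \<Gamma>)" "r \<in> relations"
  then obtain x y where "r = commutator_word x y" and xy: "(x, y) \<in> parcs \<Gamma>"
    by (auto simp: commutator_word_def)
  then show "heisenberg f g (u @ r @ w) = heisenberg f g (u @ w)"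
    using \<open>u \<in> _\<close> \<open>w \<in> _\<close> \<open>r \<in> _\<close> P.relators arc_vertices[OF xy] eq[OF xy]
    by (intro heisenberg_delete[OF f g])
      (auto intro: word_sum_commutator[OF f] word_sum_commutator[OF g] heisenberg_commutator[OF f g])
qed

text \<open>
  If \<open>f \<smile> g\<close> is the coboundary of \<open>\<phi>\<close>, then \<open>f(a) g(b) = \<phi>(b) - \<phi>(a b) + \<phi>(a)\<close> is symmetric whenever \<open>a\<close> and \<open>b\<close>
  commute, in particular for adjacent generators. Conversely, the equations on the arcs make
  \<open>heisenberg\<close> constant on the words that represent one element, and it induces the required cochain.
\<close>

lemma cup_product_raag_zero_iff:
  assumes f: "f \<in> cocycles L A (Suc 0)" and g: "g \<in> cocycles L A (Suc 0)"
  shows "cup_product L A (Suc 0) (Suc 0) {f} {g} = \<zero>\<^bsub>cohomology L A 2\<^esub> \<longleftrightarrow>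
    (\<forall>(v, w) \<in> parcs \<Gamma>. f [gen v] \<otimes> g [gen w] = f [gen w] \<otimes> g [gen v])"
    (is "_ \<longleftrightarrow> ?comm")
  unfolding cup_product_zero_iff[OF f g]
proof
  assume "\<exists>\<phi>\<in>carrier (cochains L A (Suc 0)). \<forall>a\<in>carrier A. \<forall>b\<in>carrier A.
      f [a] \<otimes> g [b] = \<phi> [b] \<ominus> \<phi> [a \<otimes>\<^bsub>A\<^esub> b] \<oplus> \<phi> [a]"
  then obtain \<phi> where \<phi>: "\<phi> \<in> carrier (cochains L A (Suc 0))"
    and eq: "\<And>a b. a \<in> carrier A \<Longrightarrow> b \<in> carrier A \<Longrightarrow>
      f [a] \<otimes> g [b] = \<phi> [b] \<ominus> \<phi> [a \<otimes>\<^bsub>A\<^esub> b] \<oplus> \<phi> [a]"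
    by blast
  show ?comm
  proof safe
    fix v w assume vw: "(v, w) \<in> parcs \<Gamma>"
    note gens = gen_closed[OF arc_vertices(1)[OF vw]] gen_closed[OF arc_vertices(2)[OF vw]]
    have cl: "\<phi> [a] \<in> carrier L" if "a \<in> carrier A" for a
      using cochain_closed[OF \<phi>, of "[a]"] that by (auto simp: tuples_def)
    define p q r where "p = \<phi> [gen v]" and "q = \<phi> [gen w]" and "r = \<phi> [gen w \<otimes>\<^bsub>A\<^esub> gen v]"
    have "p \<in> carrier L" "q \<in> carrier L" "r \<in> carrier L"
      unfolding p_def q_def r_def using cl gens by auto
    then have "q \<ominus> r \<oplus> p = p \<ominus> r \<oplus> q" by algebra
    then have "f [gen v] \<otimes> g [gen w] = f [gen w] \<otimes> g [gen v]"
      using eq[OF gens] eq[OF gens(2,1)] gen_commute[OF vw] by (simp add: p_def q_def r_def)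
    then show "f [gen v] \<otimes> g [gen w] = f [gen w] \<otimes> g [gen v]" .
  qed
next
  assume comm: ?comm
  let ?F = "\<lambda>v. f [gen v]" and ?G = "\<lambda>v. g [gen v]"
  let ?\<phi> = "\<lambda>xs\<in>tuples A (Suc 0). P.lift (heisenberg ?F ?G) (hd xs)"
  have F: "?F \<in> pverts \<Gamma> \<rightarrow> carrier L" and G: "?G \<in> pverts \<Gamma> \<rightarrow> carrier L"
    using cocycle_1_closed[OF f] cocycle_1_closed[OF g] gen_closed by auto
  have respects: "heisenberg ?F ?G u = heisenberg ?F ?G v" if "(u, v) \<in> pres_rel (pverts \<Gamma>) relations" for u v
    by (rule heisenberg_respects[OF F G _ that]) (use comm in blast)
  have \<phi>: "?\<phi> [P.cls u] = heisenberg ?F ?G u" if "u \<in> words (pverts \<Gamma>)" for u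
    using that P.lift_cls[of "heisenberg ?F ?G", OF respects]
    by (auto simp: tuples_small carrier_raag)
  show "\<exists>\<phi>\<in>carrier (cochains L A (Suc 0)). \<forall>a\<in>carrier A. \<forall>b\<in>carrier A.
      f [a] \<otimes> g [b] = \<phi> [b] \<ominus> \<phi> [a \<otimes>\<^bsub>A\<^esub> b] \<oplus> \<phi> [a]"
  proof (intro bexI[of _ ?\<phi>] ballI)
    show "?\<phi> \<in> carrier (cochains L A (Suc 0))"
      using \<phi> heisenberg_closed[OF F G] by (auto simp: cochains_def tuples_small carrier_raag)
    fix a b assume "a \<in> carrier A" "b \<in> carrier A"
    then obtain u v where u: "u \<in> words (pverts \<Gamma>)" "a = P.cls u" and v: "v \<in> words (pverts \<Gamma>)" "b = P.cls v"
      by (auto simp: carrier_raag)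
    define su sv hu hv where "su = word_sum ?F u" and "sv = word_sum ?G v"
      and "hu = heisenberg ?F ?G u" and "hv = heisenberg ?F ?G v"
    have "su \<in> carrier L" "sv \<in> carrier L" "hu \<in> carrier L" "hv \<in> carrier L"
      unfolding su_def sv_def hu_def hv_def using u v
      by (simp_all add: word_sum_closed[OF F] word_sum_closed[OF G] heisenberg_closed[OF F G])
    then have "su \<otimes> sv = hv \<ominus> (hu \<oplus> hv \<ominus> su \<otimes> sv) \<oplus> hu" by algebra
    moreover have "f [a] = su" "g [b] = sv"
      using cocycle_on_words[OF f u(1)] cocycle_on_words[OF g v(1)] by (simp_all add: u v su_def sv_def)
    moreover have "?\<phi> [a \<otimes>\<^bsub>A\<^esub> b] = hu \<oplus> hv \<ominus> su \<otimes> sv"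
      using u v \<phi>[of "u @ v"] heisenberg_append[OF F G u(1) v(1)]
      by (simp add: mult_raag words_append su_def sv_def hu_def hv_def del: restrict_apply)
    ultimately show "f [a] \<otimes> g [b] = ?\<phi> [b] \<ominus> ?\<phi> [a \<otimes>\<^bsub>A\<^esub> b] \<oplus> ?\<phi> [a]"
      using \<phi>[OF u(1)] \<phi>[OF v(1)] by (simp only: u v hu_def hv_def)
  qed
qed

definition coordinate :: "'v \<Rightarrow> ('v word set list \<Rightarrow> 'l) set \<Rightarrow> 'l" where
  "coordinate v x = the_elem x [gen v]"

lemma graph_pairing_raag:
  "graph_pairing L (cohomology L A (Suc 0)) (cohomology L A 2) (cup_product L A (Suc 0) (Suc 0))
    \<Gamma> coordinate"
proof (intro graph_pairing.intro graph_pairing_axioms.intro vectorspace.intro)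
  let ?H = "cohomology L A (Suc 0)"
  show "Module.module L ?H" by (rule module_H1)
  show "field L" by (rule field_axioms)
  show "pair_graph \<Gamma>" by (rule graph)
  fix v assume v: "v \<in> pverts \<Gamma>"
  have t: "[gen v] \<in> tuples A (Suc 0)" using gen_closed[OF v] by (auto simp: tuples_def)
  show "coordinate v x \<in> carrier L" if "x \<in> carrier ?H" for x
    using that gen_closed[OF v] cocycle_1_closed by (auto simp: carrier_H1 coordinate_def)
  show "coordinate v (x \<oplus>\<^bsub>?H\<^esub> y) = coordinate v x \<oplus> coordinate v y"
    if "x \<in> carrier ?H" "y \<in> carrier ?H" for x y
    using that t by (auto simp: carrier_H1 coordinate_def add_H1 cochain_add_apply)
  show "coordinate v (a \<odot>\<^bsub>?H\<^esub> x) = a \<otimes> coordinate v x" if "a \<in> carrier L" "x \<in> carrier ?H" for a x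
    using that t by (auto simp: carrier_H1 coordinate_def smult_H1 cochain_smult_apply)
next
  let ?H = "cohomology L A (Suc 0)"
  show "x = y" if "x \<in> carrier ?H" "y \<in> carrier ?H"
    "\<And>v. v \<in> pverts \<Gamma> \<Longrightarrow> coordinate v x = coordinate v y" for x y
    using that cocycle_eqI by (auto simp: carrier_H1 coordinate_def)
  show "\<exists>x\<in>carrier ?H. \<forall>v\<in>pverts \<Gamma>. coordinate v x = c v" if "c \<in> pverts \<Gamma> \<rightarrow> carrier L" for c
    using cocycle_exists[OF that] by (auto simp: carrier_H1 coordinate_def)
  show "cup_product L A (Suc 0) (Suc 0) x y = \<zero>\<^bsub>cohomology L A 2\<^esub> \<longleftrightarrow>
      (\<forall>(v, w) \<in> parcs \<Gamma>. coordinate v x \<otimes> coordinate w y = coordinate w x \<otimes> coordinate v y)"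
    if xy: "x \<in> carrier ?H" "y \<in> carrier ?H" for x y
  proof -
    obtain f g where fg: "f \<in> cocycles L A (Suc 0)" "g \<in> cocycles L A (Suc 0)"
      and eq: "x = {f}" "y = {g}"
      using xy by (auto simp: carrier_H1)
    show ?thesis unfolding eq coordinate_def the_elem_eq by (rule cup_product_raag_zero_iff[OF fg])
  qed
qed

lemma pairing_triple_raag:
  "pairing_triple L (cohomology L A (Suc 0)) (cohomology L A 2) (cup_product L A (Suc 0) (Suc 0))"
  unfolding pairing_triple_def
proof (intro conjI disjI2 ballI)
  fix x y assume "x \<in> carrier (cohomology L A (Suc 0))" "y \<in> carrier (cohomology L A (Suc 0))"
  then obtain f g where fg: "f \<in> cocycles L A (Suc 0)" "g \<in> cocycles L A (Suc 0)"
    and xy: "x = {f}" "y = {g}"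
    by (auto simp: carrier_H1)
  show "cup_product L A (Suc 0) (Suc 0) x y =
      \<ominus>\<^bsub>cohomology L A 2\<^esub> cup_product L A (Suc 0) (Suc 0) y x"
    unfolding xy by (rule cup_product_antisym[OF fg])
qed (rule module_H1 module_H2 bilinear_cup_product graph_pairing.finite_dim[OF graph_pairing_raag])+

end

section \<open>Expander families\<close>

text \<open>
  The bound \<open>\<epsilon> \<le> 1\<close> can be imposed for free, and the comparison of Cheeger constants depends on it.
\<close>

lemma INF_ereal_pos_iff:
  fixes h :: "nat \<Rightarrow> ereal"
  shows "0 < (INF i. h i) \<longleftrightarrow> (\<exists>\<epsilon>. 0 < \<epsilon> \<and> \<epsilon> \<le> 1 \<and> (\<forall>i. ereal \<epsilon> \<le> h i))"
proof
  assume pos: "0 < (INF i. h i)"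
  then obtain r where r: "0 < ereal r" "ereal r < (INF i. h i)" using ereal_dense2 by blast
  have "ereal (min r 1) \<le> h i" for i
  proof -
    have "ereal (min r 1) \<le> ereal r" by simp
    also have "\<dots> \<le> (INF i. h i)" using r by simp
    also have "\<dots> \<le> h i" by (rule INF_lower) simp
    finally show ?thesis .
  qed
  then show "\<exists>\<epsilon>. 0 < \<epsilon> \<and> \<epsilon> \<le> 1 \<and> (\<forall>i. ereal \<epsilon> \<le> h i)"
    using r by (intro exI[of _ "min r 1"]) auto
next
  assume "\<exists>\<epsilon>. 0 < \<epsilon> \<and> \<epsilon> \<le> 1 \<and> (\<forall>i. ereal \<epsilon> \<le> h i)"
  then obtain \<epsilon> where \<epsilon>: "0 < \<epsilon>" "\<And>i. ereal \<epsilon> \<le> h i" by blast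
  have "0 < ereal \<epsilon>" using \<epsilon> by simp
  also have "\<dots> \<le> (INF i. h i)" using \<epsilon> by (intro INF_greatest)
  finally show "0 < (INF i. h i)" .
qed

theorem theorem1p3:
  fixes L :: "('l, 'm) ring_scheme"
    and \<Gamma> :: "nat \<Rightarrow> 'v pair_pre_digraph"
  assumes "field L"
    and "\<And>i. pair_graph (\<Gamma> i)"
  shows "graph_expander_family \<Gamma> \<longleftrightarrow>
    vs_expander_family L
      (\<lambda>i. cohomology L (raag (\<Gamma> i)) 1)
      (\<lambda>i. cohomology L (raag (\<Gamma> i)) 2)
      (\<lambda>i. cup_product L (raag (\<Gamma> i)) 1 1)"
proof -
  let ?H = "\<lambda>i. cohomology L (raag (\<Gamma> i)) (Suc 0)" and ?W = "\<lambda>i. cohomology L (raag (\<Gamma> i)) 2"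
    and ?q = "\<lambda>i. cup_product L (raag (\<Gamma> i)) (Suc 0) (Suc 0)"
  have raag: "raag_cohomology L (\<Gamma> i)" for i
    using assms by (intro raag_cohomology.intro raag_cohomology_axioms.intro)
  note pairing = raag_cohomology.graph_pairing_raag[OF raag]
  have valence: "(\<exists>N. \<forall>i. \<forall>v \<in> pverts (\<Gamma> i). graph_valence (\<Gamma> i) v \<le> N) \<longleftrightarrow>
      (\<exists>N. \<forall>i. q_valence L (?H i) (?W i) (?q i) \<le> N)"
  proof (intro iff_exI iffI allI ballI)
    fix N i assume "\<forall>i. \<forall>v \<in> pverts (\<Gamma> i). graph_valence (\<Gamma> i) v \<le> N"
    then show "q_valence L (?H i) (?W i) (?q i) \<le> N"
      by (intro graph_pairing.q_valence_le[OF pairing]) simp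
  next
    fix N i v assume N: "\<forall>i. q_valence L (?H i) (?W i) (?q i) \<le> N" and v: "v \<in> pverts (\<Gamma> i)"
    show "graph_valence (\<Gamma> i) v \<le> N"
      using graph_pairing.graph_valence_le_q_valence[OF pairing v] N le_trans by blast
  qed
  have cheeger: "0 < (INF i. graph_cheeger (\<Gamma> i)) \<longleftrightarrow> 0 < (INF i. vs_cheeger L (?H i) (?W i) (?q i))"
  proof
    assume "0 < (INF i. graph_cheeger (\<Gamma> i))"
    then obtain \<epsilon> where \<epsilon>: "0 < \<epsilon>" "\<epsilon> \<le> 1" "\<And>i. ereal \<epsilon> \<le> graph_cheeger (\<Gamma> i)"
      unfolding INF_ereal_pos_iff by blast
    have "ereal (\<epsilon> / 2) \<le> vs_cheeger L (?H i) (?W i) (?q i)" for i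
      by (rule graph_pairing.vs_cheeger_ge[OF pairing \<epsilon>])
    then show "0 < (INF i. vs_cheeger L (?H i) (?W i) (?q i))"
      unfolding INF_ereal_pos_iff using \<epsilon> by (intro exI[of _ "\<epsilon> / 2"]) auto
  next
    assume "0 < (INF i. vs_cheeger L (?H i) (?W i) (?q i))"
    also have "\<dots> \<le> (INF i. graph_cheeger (\<Gamma> i))"
      by (intro INF_mono' graph_pairing.vs_cheeger_le_graph_cheeger[OF pairing])
    finally show "0 < (INF i. graph_cheeger (\<Gamma> i))" .
  qed
  show ?thesis
    unfolding graph_expander_family_def vs_expander_family_def One_nat_def
    using assms(2) raag_cohomology.pairing_triple_raag[OF raag] valence cheeger
    by (simp add: graph_pairing.lin_dim_carrier[OF pairing])
qed

end
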